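(* There exists $\overline t>0$ such that if $t>\overline t$ and $n\in\mathcal{A}$ depends only on $z$, $n=n(z)$, then $n$ is not a local minimiser of $I$.
   Context: Let $L_1,L_2,d,K>0$ be fixed, $\Omega=(-L_1,L_1)\times(-L_2,L_2)\times(0,d)\subset\mathbb{R}^3$ with coordinates $(x,y,z)$, $w(n,\nabla n)=|\nabla n|^2+2t\,n\cdot\nabla\times n+t^2|n|^2$, $$I(n)=\int_\Omega w(n,\nabla n)\,dx+K\mathcal{H}^2(S_n),$$ $$\mathcal{A}=\left\{n\in SBV^2(\Omega,\mathbb{S}^2\cup\{0\}) : n|_{z=0}=e_1,\ n|_{z=d}=e_3,\ n|_{x=-L_1}=n|_{x=L_1},\ n|_{y=-L_2}=n|_{y=L_2}\right\}.$$ $SBV^2$ denotes the functions in $SBV$ with approximate gradient $\nabla n\in L^2$ and $\mathcal{H}^2(S_n)<\infty$, $S_n$ being the approximate discontinuity set. Boundary conditions are imposed in the weak (extended domain) sense: with $\epsilon>0$ fixed, $n$ is extended by $e_1$ to $-\epsilon<z<0$ and by $e_3$ to $d<z<d+\epsilon$, and periodically in $x,y$; $S_n$ is the discontinuity set of the extended map (counted once per period cell), so $S_n$ may contain parts of $\partial\Omega$. Write $\Omega_\epsilon=(-L_1,L_1)\times(-L_2,L_2)\times(-\epsilon,d+\epsilon)$. Local minimiser: $n\in\mathcal{A}$ is a local minimiser of $I$ if $$\int_Aw(n,\nabla n)\,dx+K\mathcal{H}^2(A\cap S_n)\leqslant\int_Aw(m,\nabla m)\,dx+K\mathcal{H}^2(A\cap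 S_m)$$ whenever $m\in\mathcal{A}$, $A$ is open and $\{n\neq m\}\subset\subset A\subset\subset\Omega_\epsilon$. *)

theory Defs
  imports "HOL-Analysis.Analysis"
begin

section \<open>Hausdorff measure\<close>

text \<open>
  Hausdorff outer measure of integer dimension, normalised so that it agrees with Lebesgue
  measure on \<open>k\<close>-planes. Boundedness is demanded because \<^const>\<open>diameter\<close> is unspecified on
  unbounded sets; the case distinction makes empty covering sets free also for \<open>k = 0\<close>.
\<close>

definition hausdorff_delta :: "nat \<Rightarrow> real \<Rightarrow> 'a::metric_space set \<Rightarrow> ennreal" where
  "hausdorff_delta k \<delta> E =
     ennreal (unit_ball_vol (real k) / 2 ^ k) *
     (INF C \<in> {C :: nat \<Rightarrow> 'a set. E \<subseteq> (\<Union>i. C i) \<and> (\<forall>i. bounded (C i) \<and> diameter (C i) < \<delta>)}.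
        (\<Sum>i. if C i = {} then 0 else ennreal (diameter (C i) ^ k)))"

definition hausdorff :: "nat \<Rightarrow> 'a::metric_space set \<Rightarrow> ennreal" where
  "hausdorff k E = (SUP \<delta> \<in> {0<..}. hausdorff_delta k \<delta> E)"


section \<open>Approximate limits and approximate differentiability\<close>

text \<open>
  The Bochner averages below are meant for locally integrable \<open>u\<close>; all maps to which these
  notions are applied in the sequel are locally integrable.
\<close>

definition approx_limit :: "(real^3 \<Rightarrow> real^3) \<Rightarrow> real^3 \<Rightarrow> real^3 \<Rightarrow> bool" where
  "approx_limit u x z \<longleftrightarrow>
     ((\<lambda>r. (LINT y:ball x r|lebesgue. norm (u y - z)) / measure lebesgue (ball x r))
        \<longlongrightarrow> 0) (at_right 0)"

definition approx_discontinuity_set :: "(real^3 \<Rightarrow> real^3) \<Rightarrow> (real^3) set" where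
  "approx_discontinuity_set u = {x. \<not> (\<exists>z. approx_limit u x z)}"

text \<open>The derivative matrix has the entries \<open>G $ i $ j = \<partial>\<^sub>j u\<^sub>i\<close>.\<close>

definition has_approx_gradient :: "(real^3 \<Rightarrow> real^3) \<Rightarrow> real^3 \<Rightarrow> real^3^3 \<Rightarrow> bool" where
  "has_approx_gradient u x G \<longleftrightarrow>
     (\<exists>z. approx_limit u x z \<and>
        ((\<lambda>r. (LINT y:ball x r|lebesgue. norm (u y - z - G *v (y - x)) / r)
               / measure lebesgue (ball x r)) \<longlongrightarrow> 0) (at_right 0))"

text \<open>
  The value 0 at points without an approximate gradient is immaterial: a function of bounded
  variation is approximately differentiable almost everywhere.
\<close>

definition approx_gradient :: "(real^3 \<Rightarrow> real^3) \<Rightarrow> real^3 \<Rightarrow> real^3^3" where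
  "approx_gradient u x =
     (if \<exists>G. has_approx_gradient u x G then THE G. has_approx_gradient u x G else 0)"


section \<open>Special functions of bounded variation\<close>

definition test_function_on ::
    "(real^3) set \<Rightarrow> (real^3 \<Rightarrow> real) \<Rightarrow> (real^3 \<Rightarrow> real^3) \<Rightarrow> bool" where
  "test_function_on U \<phi> D\<phi> \<longleftrightarrow>
     (\<forall>x. GDERIV \<phi> x :> D\<phi> x) \<and> continuous_on UNIV D\<phi> \<and>
     (\<exists>C. compact C \<and> C \<subseteq> U \<and> (\<forall>x. x \<notin> C \<longrightarrow> \<phi> x = 0))"

text \<open>
  The matrix-valued measure \<open>Du\<close> is represented by its polar decomposition \<open>Du = \<sigma> \<mu>\<close>, where
  \<open>\<mu> = |Du|\<close> is its total variation and \<open>|\<sigma>| = 1\<close> holds \<open>\<mu>\<close>-almost everywhere.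
\<close>

definition distributional_derivative ::
    "(real^3) set \<Rightarrow> (real^3 \<Rightarrow> real^3) \<Rightarrow> (real^3) measure \<Rightarrow> (real^3 \<Rightarrow> real^3^3) \<Rightarrow> bool" where
  "distributional_derivative U u \<mu> \<sigma> \<longleftrightarrow>
     finite_measure \<mu> \<and> sets \<mu> = sets borel \<and> (AE x in \<mu>. x \<in> U) \<and>
     \<sigma> \<in> borel_measurable borel \<and> (AE x in \<mu>. norm (\<sigma> x) = 1) \<and>
     (\<forall>\<phi> D\<phi>. test_function_on U \<phi> D\<phi> \<longrightarrow>
        (\<forall>i j. (LINT x:U|lebesgue. u x $ i * D\<phi> x $ j) = - (LINT x|\<mu>. \<phi> x * \<sigma> x $ i $ j)))"

text \<open>
  The null set \<open>N\<close> realises the Lebesgue decomposition: \<open>\<mu>\<close> restricted to \<open>N\<close> is the singular part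
  of \<open>|Du|\<close>, and \<open>\<mu>\<close> restricted to the complement of \<open>N\<close> is the absolutely continuous one. The
  Cantor part is the singular part restricted to the complement of the approximate discontinuity
  set, and the last conjunct says that it vanishes.
\<close>

definition SBV :: "(real^3) set \<Rightarrow> (real^3 \<Rightarrow> real^3) \<Rightarrow> bool" where
  "SBV U u \<longleftrightarrow>
     set_integrable lebesgue U u \<and>
     (\<exists>\<mu> \<sigma>. distributional_derivative U u \<mu> \<sigma> \<and>
        (\<exists>N \<in> null_sets lborel.
           absolutely_continuous lborel (density \<mu> (indicator (- N))) \<and>
           (AE x in \<mu>. x \<in> N \<longrightarrow> x \<in> approx_discontinuity_set u)))"

definition SBV2 :: "(real^3) set \<Rightarrow> (real^3 \<Rightarrow> real^3) \<Rightarrow> bool" where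
  "SBV2 U u \<longleftrightarrow>
     SBV U u \<and>
     approx_gradient u \<in> borel_measurable (lebesgue_on U) \<and>
     set_integrable lebesgue U (\<lambda>x. (norm (approx_gradient u x))\<^sup>2) \<and>
     hausdorff 2 (U \<inter> approx_discontinuity_set u) < \<infinity>"


section \<open>The variational problem\<close>

definition Omega :: "real \<Rightarrow> real \<Rightarrow> real \<Rightarrow> (real^3) set" where
  "Omega L1 L2 d = {p. - L1 < p $ 1 \<and> p $ 1 < L1 \<and> - L2 < p $ 2 \<and> p $ 2 < L2 \<and> 0 < p $ 3 \<and> p $ 3 < d}"

definition Omega_ext :: "real \<Rightarrow> real \<Rightarrow> real \<Rightarrow> real \<Rightarrow> (real^3) set" where
  "Omega_ext L1 L2 d \<epsilon> =
     {p. - L1 < p $ 1 \<and> p $ 1 < L1 \<and> - L2 < p $ 2 \<and> p $ 2 < L2 \<and> - \<epsilon> < p $ 3 \<and> p $ 3 < d + \<epsilon>}"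

definition curl_of :: "real^3^3 \<Rightarrow> real^3" where
  "curl_of G = vector [G $ 3 $ 2 - G $ 2 $ 3, G $ 1 $ 3 - G $ 3 $ 1, G $ 2 $ 1 - G $ 1 $ 2]"

text \<open>The norm on \<^typ>\<open>real^3^3\<close> is the Frobenius norm.\<close>

definition w :: "real \<Rightarrow> real^3 \<Rightarrow> real^3^3 \<Rightarrow> real" where
  "w t v G = (norm G)\<^sup>2 + 2 * t * (v \<bullet> curl_of G) + t\<^sup>2 * (norm v)\<^sup>2"

text \<open>
  The class \<open>\<A>\<close>. Its members are represented by their extensions, i.e. by maps which on the
  slab \<open>-\<epsilon> < z < d + \<epsilon>\<close> are the periodic extension of a map on \<open>\<Omega>\<close> and equal \<open>e\<^sub>1\<close> and
  \<open>e\<^sub>3\<close> below and above it; values outside the slab are irrelevant. This is the weak form of the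
  boundary conditions: a mismatch of traces on \<open>\<partial>\<Omega>\<close> is not forbidden, but makes
  \<^term>\<open>approx_discontinuity_set n\<close> contain a part of \<open>\<partial>\<Omega>\<close>. As functions of bounded variation
  on \<open>\<Omega>\<close> have integrable traces, the extension of such a map is again (locally) of class \<^const>\<open>SBV2\<close>, so no
  regularity across \<open>\<partial>\<Omega>\<close> has to be imposed.
\<close>

definition admissible ::
    "real \<Rightarrow> real \<Rightarrow> real \<Rightarrow> real \<Rightarrow> (real^3 \<Rightarrow> real^3) \<Rightarrow> bool" where
  "admissible L1 L2 d \<epsilon> n \<longleftrightarrow>
     SBV2 (Omega L1 L2 d) n \<and>
     (AE p in lebesgue_on (Omega L1 L2 d). n p \<in> sphere 0 1 \<union> {0}) \<and>
     (AE p in lebesgue. - \<epsilon> < p $ 3 \<and> p $ 3 < 0 \<longrightarrow> n p = axis 1 1) \<and>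
     (AE p in lebesgue. d < p $ 3 \<and> p $ 3 < d + \<epsilon> \<longrightarrow> n p = axis 3 1) \<and>
     (AE p in lebesgue. - \<epsilon> < p $ 3 \<and> p $ 3 < d + \<epsilon> \<longrightarrow>
        n (p + axis 1 (2 * L1)) = n p \<and> n (p + axis 2 (2 * L2)) = n p)"

definition energy_on :: "real \<Rightarrow> real \<Rightarrow> (real^3) set \<Rightarrow> (real^3 \<Rightarrow> real^3) \<Rightarrow> ereal" where
  "energy_on t K A n =
     ereal (LINT p:A|lebesgue. w t (n p) (approx_gradient n p)) +
     ereal K * enn2ereal (hausdorff 2 (A \<inter> approx_discontinuity_set n))"

definition compactly_inside :: "(real^3) set \<Rightarrow> (real^3) set \<Rightarrow> bool" where
  "compactly_inside B A \<longleftrightarrow> compact (closure B) \<and> closure B \<subseteq> A"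

text \<open>
  As maps in \<open>\<A>\<close> are identified when they agree almost everywhere, \<open>{n \<noteq> m} \<subset>\<subset> A\<close> is read modulo
  null sets: \<open>n\<close> and \<open>m\<close> agree almost everywhere outside some set \<open>B \<subset>\<subset> A\<close>.
\<close>

definition local_minimiser ::
    "real \<Rightarrow> real \<Rightarrow> real \<Rightarrow> real \<Rightarrow> real \<Rightarrow> real \<Rightarrow> (real^3 \<Rightarrow> real^3) \<Rightarrow> bool" where
  "local_minimiser L1 L2 d \<epsilon> K t n \<longleftrightarrow>
     admissible L1 L2 d \<epsilon> n \<and>
     (\<forall>m A. admissible L1 L2 d \<epsilon> m \<and> open A \<and> compactly_inside A (Omega_ext L1 L2 d \<epsilon>) \<and>
        (\<exists>B. compactly_inside B A \<and>
           (AE p in lebesgue_on (Omega_ext L1 L2 d \<epsilon>). p \<notin> B \<longrightarrow> n p = m p)) \<longrightarrow>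
        energy_on t K A n \<le> energy_on t K A m)"

definition depends_only_on_z :: "real \<Rightarrow> real \<Rightarrow> real \<Rightarrow> (real^3 \<Rightarrow> real^3) \<Rightarrow> bool" where
  "depends_only_on_z L1 L2 d n \<longleftrightarrow>
     (\<exists>f :: real \<Rightarrow> real^3. AE p in lebesgue_on (Omega L1 L2 d). n p = f (p $ 3))"

end

theory Submission
  imports Defs
begin

text \<open>
  For a field \<open>n = F(z)\<close> the energy density is a sum of squares, hence nonnegative. The double twist
  \<open>v = (t y, - t x, 1) / sqrt (1 + t\<^sup>2 (x\<^sup>2 + y\<^sup>2))\<close>, on the other hand, has energy density at most
  \<open>- t\<^sup>2 / 2\<close> within distance of order \<open>1 / t\<close> from its axis. Replacing \<open>n\<close> by \<open>v\<close> in a box of side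
  of order \<open>1 / t\<close> therefore gains bulk energy of order \<open>1 / t\<close>, whereas the new jumps on the boundary
  of the box cost at most a multiple of \<open>K / t\<^sup>2\<close>.

  The main work is to see that the modified map is again special of bounded variation.
  Testing the derivatives of \<open>n\<close> and \<open>v\<close> with \<open>\<phi>\<close> times \<open>C\<^sup>1\<close> cutoffs converging to the indicator
  of the box yields the jump part on the faces, provided that the box is placed so that its faces
  are null for \<open>|Dn|\<close> and its horizontal faces lie at Lebesgue points of \<open>F\<close>.
\<close>

section \<open>Polar decomposition of sums of vector measures\<close>

text \<open>\<open>SBV\<close> asks for more than a derivative that is a measure: its singular part
  has to sit on the approximate discontinuity set. Every face point at which the two values differ
  must therefore be shown to be a genuine discontinuity, and this is where one-sided traces would
  normally enter. Dependence on \<open>z\<close> alone replaces them. Along the normal of a vertical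
  face \<open>F\<close> is constant, so its trace is \<open>F z\<close>; along the normal of a
  horizontal face a Lebesgue point provides the trace. Faces that are null for \<open>|Dn|\<close>
  ensure that every remaining singular point of \<open>n\<close> has a neighbourhood in which the
  new map is \<open>n\<close>.

  An upper bound for the area of the faces suffices, so \<open>hausdorff 2\<close> is estimated
  crudely by covering each face with small squares. This gives the area \<open>6 * pi * s^2\<close>,
  and with \<open>s = 1 / (3 * t)\<close> the gain \<open>s^2 * t / 48\<close> beats
  \<open>6 * pi * K * s^2\<close> exactly when \<open>t > 288 * pi * K\<close>.\<close>

definition sum_measure :: "'i set \<Rightarrow> ('i \<Rightarrow> 'a::topological_space measure) \<Rightarrow> 'a measure" where
  "sum_measure I M = measure_of UNIV (sets borel) (\<lambda>A. \<Sum>i\<in>I. emeasure (M i) A)"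

lemma sets_sum_measure [simp, measurable_cong]: "sets (sum_measure I M) = sets borel"
  and space_sum_measure [simp]: "space (sum_measure I M) = UNIV"
  using sets.sets_measure_of_eq[of borel] sets.space_measure_of_eq[of borel] by (simp_all add: sum_measure_def)

lemma emeasure_sum_measure:
  assumes "finite I" "\<And>i. i \<in> I \<Longrightarrow> sets (M i) = sets borel" "A \<in> sets borel"
  shows "emeasure (sum_measure I M) A = (\<Sum>i\<in>I. emeasure (M i) A)"
proof (rule emeasure_measure_of[OF sum_measure_def])
  show "countably_additive (sets (sum_measure I M)) (\<lambda>A. \<Sum>i\<in>I. emeasure (M i) A)"
  proof (rule countably_additiveI)
    fix A :: "nat \<Rightarrow> _" assume A: "range A \<subseteq> sets (sum_measure I M)" "disjoint_family A"
    have "(\<Sum>n. \<Sum>i\<in>I. emeasure (M i) (A n)) = (\<Sum>i\<in>I. \<Sum>n. emeasure (M i) (A n))"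
      by (rule suminf_sum) auto
    also have "\<dots> = (\<Sum>i\<in>I. emeasure (M i) (\<Union>n. A n))"
      using A assms by (intro sum.cong refl suminf_emeasure) auto
    finally show "(\<Sum>n. \<Sum>i\<in>I. emeasure (M i) (A n)) = (\<Sum>i\<in>I. emeasure (M i) (\<Union>n. A n))" .
  qed
qed (use assms in \<open>auto simp: positive_def\<close>)

text \<open>All exceptional points lie in the null set chosen for each summand, hence in the
  intersection of these finitely many Borel sets, and the intersection is null for every
  \<open>M i\<close> at once.\<close>

lemma AE_sum_measure:
  assumes "finite I" "\<And>i. i \<in> I \<Longrightarrow> sets (M i) = sets borel"
    and "\<And>i. i \<in> I \<Longrightarrow> AE x in M i. P x"
  shows "AE x in sum_measure I M. P x"
proof -
  have "\<exists>N. N \<in> null_sets (M i) \<and> {x. \<not> P x} \<subseteq> N" if i: "i \<in> I" for i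
  proof -
    have "space (M i) = UNIV" using assms(2)[OF i] sets_eq_imp_space_eq by force
    then show ?thesis using AE_E[OF assms(3)[OF i]] by (simp add: null_sets_def) metis
  qed
  then have "\<exists>N. \<forall>i\<in>I. N i \<in> null_sets (M i) \<and> {x. \<not> P x} \<subseteq> N i" by (intro bchoice) auto
  then obtain N where N: "\<And>i. i \<in> I \<Longrightarrow> N i \<in> null_sets (M i)" "\<And>i. i \<in> I \<Longrightarrow> {x. \<not> P x} \<subseteq> N i"
    by blast
  show ?thesis
  proof (cases "I = {}")
    \<comment> \<open>An empty intersection would be the whole space; here the measure itself is
      0.\<close>
    case True
    then have "emeasure (sum_measure I M) UNIV = 0" using emeasure_sum_measure[of "{}" M UNIV] by simp
    then show ?thesis by (intro AE_I[of _ _ UNIV]) auto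
  next
    case False
    have b: "(\<Inter>i\<in>I. N i) \<in> sets borel"
    proof (rule sets.finite_INT[OF assms(1) False])
      fix i assume i: "i \<in> I"
      show "N i \<in> sets borel" using N(1)[OF i] assms(2)[OF i] by (simp add: null_sets_def)
    qed
    have "emeasure (M i) (\<Inter>i\<in>I. N i) = 0" if "i \<in> I" for i
    proof -
      have "emeasure (M i) (\<Inter>i\<in>I. N i) \<le> emeasure (M i) (N i)"
        using N(1)[OF that] that by (intro emeasure_mono) auto
      then show ?thesis using N(1)[OF that] by auto
    qed
    then have "emeasure (sum_measure I M) (\<Inter>i\<in>I. N i) = 0"
      using b assms by (subst emeasure_sum_measure) auto
    then show ?thesis
      using b N(2) by (intro AE_I[of _ _ "\<Inter>i\<in>I. N i"]) auto
  qed
qed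

lemma borel_measurable_vec_nth [measurable]:
  fixes f :: "'a \<Rightarrow> ('b::real_normed_vector)^'n"
  assumes "f \<in> borel_measurable M"
  shows "(\<lambda>x. f x $ i) \<in> borel_measurable M"
proof -
  have "(\<lambda>v :: 'b^'n. v $ i) \<in> borel_measurable borel"
    by (intro borel_measurable_continuous_onI continuous_intros)
  then show ?thesis using assms by (rule measurable_compose[rotated])
qed

lemma test_function_continuous:
  assumes "test_function_on U \<phi> D\<phi>"
  shows "continuous_on UNIV \<phi>"
proof (intro continuous_at_imp_continuous_on ballI)
  fix x show "isCont \<phi> x"
    using assms unfolding test_function_on_def gderiv_def by (blast intro: has_derivative_continuous)
qed

lemma test_function_measurable:
  assumes "test_function_on U \<phi> D\<phi>"
  shows "\<phi> \<in> borel_measurable borel" "D\<phi> \<in> borel_measurable borel"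
proof -
  show "\<phi> \<in> borel_measurable borel"
    by (rule borel_measurable_continuous_onI[OF test_function_continuous[OF assms]])
  show "D\<phi> \<in> borel_measurable borel"
    using assms by (simp add: test_function_on_def borel_measurable_continuous_onI)
qed

text \<open>The derivative also vanishes off \<open>C\<close>, because the complement of
  \<open>C\<close> is open and \<phi> is 0 on it.\<close>

lemma test_function_support:
  assumes "test_function_on U \<phi> D\<phi>"
  obtains C where "compact C" "C \<subseteq> U" "\<And>x. x \<notin> C \<Longrightarrow> \<phi> x = 0" "\<And>x. x \<notin> C \<Longrightarrow> D\<phi> x = 0"
proof -
  from assms have "\<exists>C. compact C \<and> C \<subseteq> U \<and> (\<forall>x. x \<notin> C \<longrightarrow> \<phi> x = 0)"
    by (simp add: test_function_on_def)
  then obtain C where C: "compact C" "C \<subseteq> U" "\<forall>x. x \<notin> C \<longrightarrow> \<phi> x = 0" by metis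
  have "D\<phi> x = 0" if x: "x \<notin> C" for x
  proof -
    have o: "open (- C)" using C(1) by (simp add: compact_imp_closed open_Compl)
    have "(\<phi> has_derivative (\<lambda>h. 0)) (at x)"
      by (rule has_derivative_transform_within_open[OF has_derivative_const[of 0] o]) (use x C(3) in auto)
    moreover have "(\<phi> has_derivative (\<lambda>h. inner h (D\<phi> x))) (at x)"
      using assms by (simp add: test_function_on_def gderiv_def)
    ultimately have "(\<lambda>h. inner h (D\<phi> x)) = (\<lambda>h. 0)" by (rule has_derivative_unique[rotated])
    then have "inner (D\<phi> x) (D\<phi> x) = 0" by meson
    then show ?thesis by simp
  qed
  then show ?thesis using C by (intro that) auto
qed

lemma bounded_of_compact_support:
  fixes f :: "'a::topological_space \<Rightarrow> 'b::real_normed_vector"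
  assumes "continuous_on UNIV f" "compact C" "\<And>x. x \<notin> C \<Longrightarrow> f x = 0"
  shows "\<exists>B. \<forall>x. norm (f x) \<le> B"
proof -
  have "bounded (f ` C)"
    using assms by (meson compact_continuous_image compact_imp_bounded continuous_on_subset subset_UNIV)
  then obtain B where B: "\<And>x. x \<in> C \<Longrightarrow> norm (f x) \<le> B" unfolding bounded_iff by auto
  have "norm (f x) \<le> max B 0" for x
    using B[of x] assms(3)[of x] by (cases "x \<in> C") (auto simp: le_max_iff_disj)
  then show ?thesis by metis
qed

lemma test_function_bounded:
  assumes "test_function_on U \<phi> D\<phi>"
  shows "\<exists>B. \<forall>x. \<bar>\<phi> x\<bar> \<le> B" "\<exists>B. \<forall>x. norm (D\<phi> x) \<le> B"
proof -
  obtain C where C: "compact C" "\<And>x. x \<notin> C \<Longrightarrow> \<phi> x = 0" "\<And>x. x \<notin> C \<Longrightarrow> D\<phi> x = 0"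
    using test_function_support[OF assms] by metis
  show "\<exists>B. \<forall>x. \<bar>\<phi> x\<bar> \<le> B"
    using bounded_of_compact_support[OF test_function_continuous[OF assms] C(1,2)] by simp
  have c: "continuous_on UNIV D\<phi>" using assms by (simp add: test_function_on_def)
  show "\<exists>B. \<forall>x. norm (D\<phi> x) \<le> B"
    by (rule bounded_of_compact_support[OF c C(1,3)])
qed

text \<open>The form in which absolute continuity is checked: restricting \<open>M\<close> to
  \<open>- N\<close> gives \<open>A\<close> the mass of \<open>A - N\<close>.\<close>

lemma absolutely_continuous_density_iff:
  assumes M: "sets M = sets borel" and N: "N \<in> sets borel"
  shows "absolutely_continuous lborel (density M (indicator (- N))) \<longleftrightarrow> (\<forall>A\<in>null_sets lborel. emeasure M (A - N) = 0)"
proof -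
  have "A \<in> null_sets (density M (indicator (- N))) \<longleftrightarrow> emeasure M (A - N) = 0" if "A \<in> null_sets lborel" for A
  proof -
    have A: "A \<in> sets M" using null_setsD2[OF that] M by simp
    have cN: "- N \<in> sets M" using N M by (simp add: borel_comp)
    have AN: "A - N \<in> sets M" using A N M by simp
    have "emeasure (density M (indicator (- N))) A = (\<integral>\<^sup>+x. indicator (- N) x * indicator A x \<partial>M)"
      by (rule emeasure_density[OF borel_measurable_indicator[OF cN] A])
    also have "\<dots> = (\<integral>\<^sup>+x. indicator (A - N) x \<partial>M)"
      by (rule nn_integral_cong) (auto simp: indicator_def)
    also have "\<dots> = emeasure M (A - N)" by (rule nn_integral_indicator[OF AN])
    finally show ?thesis using A by (simp add: null_sets_def)
  qed
  then show ?thesis unfolding absolutely_continuous_def by blast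
qed

text \<open>Lets the derivative be presented as a finite sum of vector measures, \<open>g k\<close>
  times \<open>M k\<close>. The sum of all \<open>M k\<close> dominates each of them, so
  Radon-Nikodym densities turn the whole into a single density \<open>G\<close>, whose polar
  decomposition is the one that \<open>SBV\<close> requires. The last premise is restricted to
  \<open>g k x \<noteq> 0\<close> because a face point where inner and outer value agree may fail to
  be a discontinuity.\<close>

lemma SBV_intro:
  fixes M :: "'i \<Rightarrow> (real^3) measure" and g :: "'i \<Rightarrow> real^3 \<Rightarrow> real^3^3"
  assumes u: "set_integrable lebesgue U u"
    and I: "finite I"
    and M: "\<And>k. k \<in> I \<Longrightarrow> finite_measure (M k)" "\<And>k. k \<in> I \<Longrightarrow> sets (M k) = sets borel"
      "\<And>k. k \<in> I \<Longrightarrow> AE x in M k. x \<in> U"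
    and g: "\<And>k. k \<in> I \<Longrightarrow> g k \<in> borel_measurable borel" "\<And>k. k \<in> I \<Longrightarrow> integrable (M k) (g k)"
    and eq: "\<And>\<phi> D\<phi> i j. test_function_on U \<phi> D\<phi> \<Longrightarrow>
        (LINT x:U|lebesgue. u x $ i * D\<phi> x $ j) = - (\<Sum>k\<in>I. LINT x|M k. \<phi> x * g k x $ i $ j)"
    and N: "N \<in> null_sets lborel"
      "\<And>k. k \<in> I \<Longrightarrow> absolutely_continuous lborel (density (M k) (indicator (- N)))"
      "\<And>k. k \<in> I \<Longrightarrow> AE x in M k. x \<in> N \<longrightarrow> g k x \<noteq> 0 \<longrightarrow> x \<in> approx_discontinuity_set u"
  shows "SBV U u"
proof -
  define \<Lambda> where "\<Lambda> = sum_measure I M"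
  have em: "emeasure \<Lambda> A = (\<Sum>k\<in>I. emeasure (M k) A)" if "A \<in> sets borel" for A
    unfolding \<Lambda>_def using I M(2) that by (rule emeasure_sum_measure)
  have sL [simp, measurable_cong]: "sets \<Lambda> = sets borel" and spL [simp]: "space \<Lambda> = UNIV"
    by (simp_all add: \<Lambda>_def)
  note sM [measurable_cong] = M(2)
  have spM: "space (M k) = UNIV" if "k \<in> I" for k using M(2)[OF that] sets_eq_imp_space_eq by force
  have "emeasure \<Lambda> (space \<Lambda>) \<noteq> \<infinity>"
    using I finite_measure.emeasure_finite[OF M(1)] by (simp add: em)
  then interpret L: finite_measure \<Lambda> by (rule finite_measureI)
  have ac: "absolutely_continuous \<Lambda> (M k)" if k: "k \<in> I" for k
    using I k by (auto simp: absolutely_continuous_def null_sets_def em M(2)[OF k])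
  define h where "h k x = enn2real (RN_deriv \<Lambda> (M k) x)" for k x
  have h_meas [measurable]: "h k \<in> borel_measurable borel" for k
    unfolding h_def using borel_measurable_RN_deriv[of \<Lambda> "M k"] by measurable
  have h_nn [simp]: "h k x \<ge> 0" for k x by (simp add: h_def)
  have dens: "density \<Lambda> (\<lambda>x. ennreal (h k x)) = M k" if k: "k \<in> I" for k
  proof -
    have "AE x in \<Lambda>. RN_deriv \<Lambda> (M k) x \<noteq> \<infinity>"
      using L.RN_deriv_finite[of "M k"] finite_measure.axioms(1)[OF M(1)[OF k]] ac[OF k] M(2)[OF k] by auto
    then have "AE x in \<Lambda>. ennreal (h k x) = RN_deriv \<Lambda> (M k) x"
      by eventually_elim (auto simp: h_def top.not_eq_extremum)
    then have "density \<Lambda> (\<lambda>x. ennreal (h k x)) = density \<Lambda> (RN_deriv \<Lambda> (M k))"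
      by (intro density_cong) auto
    also have "\<dots> = M k" using ac[OF k] M(2)[OF k] by (intro L.density_RN_deriv) auto
    finally show ?thesis .
  qed
  define G where "G x = (\<Sum>k\<in>I. h k x *\<^sub>R g k x)" for x
  have G_meas [measurable]: "G \<in> borel_measurable borel"
    unfolding G_def using g(1) by measurable
  have inthg: "integrable \<Lambda> (\<lambda>x. h k x *\<^sub>R g k x)" if k: "k \<in> I" for k
    using g(2)[OF k] g(1)[OF k] unfolding dens[OF k, symmetric]
    by (subst (asm) integrable_density) auto
  have intG: "integrable \<Lambda> G" unfolding G_def by (intro Bochner_Integration.integrable_sum inthg)
  \<comment> \<open>Only a default unit matrix: \<open>E\<close> is the value of \<sigma> where
    \<open>G = 0\<close>, a set that \<mu> does not charge.\<close>
  define E :: "real^3^3" where "E = axis 1 (axis 1 1)"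
  have nE: "norm E = 1" by (simp add: E_def)
  define \<mu> where "\<mu> = density \<Lambda> (\<lambda>x. ennreal (norm (G x)))"
  define \<sigma> where "\<sigma> x = (if G x = 0 then E else (1 / norm (G x)) *\<^sub>R G x)" for x
  have \<sigma>_meas [measurable]: "\<sigma> \<in> borel_measurable borel" unfolding \<sigma>_def by measurable
  have n\<sigma>: "norm (\<sigma> x) = 1" for x by (simp add: \<sigma>_def nE)
  have G\<sigma>: "norm (G x) *\<^sub>R \<sigma> x = G x" for x by (simp add: \<sigma>_def)
  have "emeasure \<mu> (space \<mu>) \<noteq> \<infinity>"
    using intG unfolding \<mu>_def by (subst emeasure_density) (auto simp: integrable_iff_bounded)
  then have fm: "finite_measure \<mu>" by (rule finite_measureI)
  have s\<mu> [simp, measurable_cong]: "sets \<mu> = sets borel" by (simp add: \<mu>_def)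
  have AEU: "AE x in \<mu>. x \<in> U"
  proof -
    have "AE x in \<Lambda>. x \<in> U" unfolding \<Lambda>_def using I M by (intro AE_sum_measure) auto
    then show ?thesis unfolding \<mu>_def by (subst AE_density) auto
  qed
  have DD: "distributional_derivative U u \<mu> \<sigma>"
    unfolding distributional_derivative_def
  proof (intro conjI allI impI fm s\<mu> AEU \<sigma>_meas)
    show "AE x in \<mu>. norm (\<sigma> x) = 1" by (simp add: n\<sigma>)
    fix \<phi> D\<phi> i j assume t: "test_function_on U \<phi> D\<phi>"
    note [measurable] = test_function_measurable[OF t]
    obtain C where C: "\<And>x. \<bar>\<phi> x\<bar> \<le> C" using test_function_bounded[OF t] by metis
    have mk: "(\<lambda>x. g k x $ i $ j) \<in> borel_measurable borel" if "k \<in> I" for k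
      using g(1)[OF that] by measurable
    have "(LINT x|\<mu>. \<phi> x * \<sigma> x $ i $ j) = (LINT x|\<Lambda>. norm (G x) *\<^sub>R (\<phi> x * \<sigma> x $ i $ j))"
      unfolding \<mu>_def by (subst integral_density) auto
    also have "\<dots> = (LINT x|\<Lambda>. (\<Sum>k\<in>I. h k x *\<^sub>R (\<phi> x * g k x $ i $ j)))"
    proof (rule Bochner_Integration.integral_cong[OF refl])
      fix x
      have "norm (G x) *\<^sub>R (\<phi> x * \<sigma> x $ i $ j) = \<phi> x * (norm (G x) *\<^sub>R \<sigma> x) $ i $ j" by simp
      also have "\<dots> = \<phi> x * G x $ i $ j" by (simp only: G\<sigma>)
      also have "\<dots> = (\<Sum>k\<in>I. h k x *\<^sub>R (\<phi> x * g k x $ i $ j))"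
        by (simp add: G_def sum_distrib_left mult_ac)
      finally show "norm (G x) *\<^sub>R (\<phi> x * \<sigma> x $ i $ j) = (\<Sum>k\<in>I. h k x *\<^sub>R (\<phi> x * g k x $ i $ j))" .
    qed
    also have "\<dots> = (\<Sum>k\<in>I. LINT x|\<Lambda>. h k x *\<^sub>R (\<phi> x * g k x $ i $ j))"
    proof (rule Bochner_Integration.integral_sum)
      fix k assume k: "k \<in> I"
      have nb: "\<bar>v $ i $ j\<bar> \<le> norm v" for v :: "real^3^3"
        using component_le_norm_cart[of "v $ i" j] Finite_Cartesian_Product.norm_nth_le[of v i] by linarith
      show "integrable \<Lambda> (\<lambda>x. h k x *\<^sub>R (\<phi> x * g k x $ i $ j))"
      proof (rule Bochner_Integration.integrable_bound[OF integrable_scaleR_right[OF inthg[OF k], of C]])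
        show "AE x in \<Lambda>. norm (h k x *\<^sub>R (\<phi> x * g k x $ i $ j)) \<le> norm (C *\<^sub>R (h k x *\<^sub>R g k x))"
        proof (rule AE_I2)
          fix x
          have "0 \<le> C" using C[of x] by linarith
          then have "h k x * (\<bar>\<phi> x\<bar> * \<bar>g k x $ i $ j\<bar>) \<le> h k x * (C * norm (g k x))"
            using C[of x] nb[of "g k x"] by (intro mult_left_mono mult_mono) auto
          then show "norm (h k x *\<^sub>R (\<phi> x * g k x $ i $ j)) \<le> norm (C *\<^sub>R (h k x *\<^sub>R g k x))"
            using \<open>0 \<le> C\<close> by (simp add: abs_mult mult_ac)
        qed
      qed (use mk[OF k] in measurable)
    qed
    also have "\<dots> = (\<Sum>k\<in>I. LINT x|M k. \<phi> x * g k x $ i $ j)"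
    proof (rule sum.cong[OF refl])
      fix k assume k: "k \<in> I"
      show "(LINT x|\<Lambda>. h k x *\<^sub>R (\<phi> x * g k x $ i $ j)) = (LINT x|M k. \<phi> x * g k x $ i $ j)"
        unfolding dens[OF k, symmetric] using mk[OF k] by (subst integral_density) auto
    qed
    finally show "(LINT x:U|lebesgue. u x $ i * D\<phi> x $ j) = - (LINT x|\<mu>. \<phi> x * \<sigma> x $ i $ j)"
      using eq[OF t] by simp
  qed
  have Nb [measurable]: "N \<in> sets borel" using N(1) by auto
  have acN: "absolutely_continuous lborel (density \<mu> (indicator (- N)))"
    unfolding absolutely_continuous_density_iff[OF s\<mu> Nb]
  proof
    fix A :: "(real^3) set" assume A: "A \<in> null_sets lborel"
    then have [measurable]: "A \<in> sets borel" by auto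
    have "emeasure (M k) (A - N) = 0" if k: "k \<in> I" for k
      using N(2)[OF k] A absolutely_continuous_density_iff[OF M(2)[OF k] Nb] by blast
    then have "emeasure \<Lambda> (A - N) = 0" by (subst em) auto
    then have "AE x in \<Lambda>. x \<notin> A - N" by (intro AE_not_in) (auto simp: null_sets_def)
    then have "AE x in \<mu>. x \<notin> A - N" unfolding \<mu>_def by (subst AE_density) auto
    then have "A - N \<in> null_sets \<mu>" by (subst AE_iff_null_sets) auto
    then show "emeasure \<mu> (A - N) = 0" by auto
  qed
  have "AE x in \<mu>. x \<in> N \<longrightarrow> x \<in> approx_discontinuity_set u"
  proof -
    have "AE x in \<Lambda>. h k x \<noteq> 0 \<longrightarrow> x \<in> N \<longrightarrow> g k x \<noteq> 0 \<longrightarrow> x \<in> approx_discontinuity_set u" if k: "k \<in> I" for k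
    proof -
      have "AE x in density \<Lambda> (\<lambda>x. ennreal (h k x)). x \<in> N \<longrightarrow> g k x \<noteq> 0 \<longrightarrow> x \<in> approx_discontinuity_set u"
        using N(3)[OF k] unfolding dens[OF k] .
      then show ?thesis
      proof (subst (asm) AE_density)
        assume a: "AE x in \<Lambda>. 0 < ennreal (h k x) \<longrightarrow> x \<in> N \<longrightarrow> g k x \<noteq> 0 \<longrightarrow> x \<in> approx_discontinuity_set u"
        have pos: "0 < h k x" if "h k x \<noteq> 0" for x
          using that h_nn[of k x] by linarith
        show ?thesis using a by eventually_elim (use pos in auto)
      qed auto
    qed
    then have "AE x in \<Lambda>. \<forall>k\<in>I. h k x \<noteq> 0 \<longrightarrow> x \<in> N \<longrightarrow> g k x \<noteq> 0 \<longrightarrow> x \<in> approx_discontinuity_set u"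
      using I by (intro AE_finite_allI) auto
    then have "AE x in \<Lambda>. 0 < ennreal (norm (G x)) \<longrightarrow> x \<in> N \<longrightarrow> x \<in> approx_discontinuity_set u"
    proof eventually_elim
      case (elim x)
      show ?case
      proof (intro impI)
        assume "0 < ennreal (norm (G x))" "x \<in> N"
        then have "G x \<noteq> 0" by auto
        \<comment> \<open>A nonzero sum has a nonzero summand, so \<open>h k x\<close> and
          \<open>g k x\<close> are both nonzero for some \<open>k\<close>, and the condition on
          \<open>N\<close> for that summand applies.\<close>
        then obtain k where "k \<in> I" "h k x *\<^sub>R g k x \<noteq> 0"
          unfolding G_def by (rule sum.not_neutral_contains_not_neutral)
        then show "x \<in> approx_discontinuity_set u" using elim \<open>x \<in> N\<close> by simp
      qed
    qed
    then show ?thesis unfolding \<mu>_def by (subst AE_density) auto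
  qed
  then show ?thesis unfolding SBV_def using u DD N(1) acN by meson
qed

section \<open>Hausdorff measure\<close>

lemma hausdorff_mono: "A \<subseteq> B \<Longrightarrow> hausdorff k A \<le> hausdorff k B"
  unfolding hausdorff_def hausdorff_delta_def
  by (intro SUP_mono' mult_left_mono INF_superset_mono) auto

lemma sum_interleave:
  fixes c d :: "nat \<Rightarrow> 'a::comm_monoid_add"
  shows "(\<Sum>i<2*n. if even i then c (i div 2) else d (i div 2)) = (\<Sum>i<n. c i) + (\<Sum>i<n. d i)"
  by (induction n) (auto simp: ac_simps)

lemma suminf_interleave_le:
  fixes c d :: "nat \<Rightarrow> ennreal"
  shows "(\<Sum>i. if even i then c (i div 2) else d (i div 2)) \<le> (\<Sum>i. c i) + (\<Sum>i. d i)"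
proof (rule suminf_le_const)
  fix n
  let ?h = "\<lambda>i. if even i then c (i div 2) else d (i div 2)"
  have "(\<Sum>i<n. ?h i) \<le> (\<Sum>i<2*n. ?h i)" by (intro sum_mono2) auto
  also have "\<dots> = (\<Sum>i<n. c i) + (\<Sum>i<n. d i)" by (rule sum_interleave)
  also have "\<dots> \<le> (\<Sum>i. c i) + (\<Sum>i. d i)" by (intro add_mono sum_le_suminf) auto
  finally show "(\<Sum>i<n. ?h i) \<le> (\<Sum>i. c i) + (\<Sum>i. d i)" .
qed auto

text \<open>Interleave a cover of \<open>A\<close> (even indices) with a cover of \<open>B\<close>
  (odd indices): the diameters stay below \<delta> and the sums add up.\<close>

lemma hausdorff_delta_Un:
  "hausdorff_delta k \<delta> (A \<union> B) \<le> hausdorff_delta k \<delta> A + hausdorff_delta k \<delta> B"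
proof -
  define cov where "cov E = {C :: nat \<Rightarrow> 'a set. E \<subseteq> (\<Union>i. C i) \<and> (\<forall>i. bounded (C i) \<and> diameter (C i) < \<delta>)}" for E
  define val where "val C = (\<Sum>i. if C i = {} then 0 else ennreal (diameter (C i) ^ k))" for C :: "nat \<Rightarrow> 'a set"
  have le: "(INF C\<in>cov (A \<union> B). val C) \<le> val C + val D" if C: "C \<in> cov A" and D: "D \<in> cov B" for C D
  proof -
    define E where "E i = (if even i then C (i div 2) else D (i div 2))" for i
    have "A \<union> B \<subseteq> (\<Union>i. E i)"
    proof
      fix x assume "x \<in> A \<union> B"
      from this C D consider i where "x \<in> C i" | i where "x \<in> D i" unfolding cov_def by blast
      then show "x \<in> (\<Union>i. E i)"
      proof cases
        case (1 i) then have "x \<in> E (2 * i)" by (simp add: E_def)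
        then show ?thesis by blast
      next
        case (2 i) then have "x \<in> E (2 * i + 1)" by (simp add: E_def)
        then show ?thesis by blast
      qed
    qed
    moreover have "bounded (E i) \<and> diameter (E i) < \<delta>" for i using C D by (simp add: cov_def E_def)
    ultimately have "E \<in> cov (A \<union> B)" by (simp add: cov_def)
    then have "(INF C\<in>cov (A \<union> B). val C) \<le> val E" by (rule INF_lower)
    also have "val E = (\<Sum>i. if even i then (if C (i div 2) = {} then 0 else ennreal (diameter (C (i div 2)) ^ k))
        else (if D (i div 2) = {} then 0 else ennreal (diameter (D (i div 2)) ^ k)))"
      unfolding val_def E_def by (intro suminf_cong) auto
    also have "\<dots> \<le> val C + val D" unfolding val_def by (rule suminf_interleave_le)
    finally show ?thesis .
  qed
  have "(INF C\<in>cov (A \<union> B). val C) \<le> (INF C\<in>cov A. val C) + (INF D\<in>cov B. val D)"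
  proof (rule ennreal_le_epsilon)
    fix e :: real assume e: "e > 0" and fin: "(INF C\<in>cov A. val C) + (INF D\<in>cov B. val D) < top"
    \<comment> \<open>Near-optimal covers come from a strict inequality, which holds only for finite
      infima; \<open>ennreal_le_epsilon\<close> reduces the claim to that case.\<close>
    have lt: "x < x + ennreal (e / 2)" if "x < top" for x :: ennreal
      using e that by (cases x) (auto simp flip: ennreal_plus intro!: ennreal_lessI)
    have "(INF C\<in>cov A. val C) < (INF C\<in>cov A. val C) + ennreal (e / 2)"
      by (rule lt) (use fin in auto)
    then obtain C where C: "C \<in> cov A" "val C < (INF C\<in>cov A. val C) + ennreal (e / 2)"
      unfolding INF_less_iff by blast
    have "(INF C\<in>cov B. val C) < (INF C\<in>cov B. val C) + ennreal (e / 2)"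
      by (rule lt) (use fin in auto)
    then obtain D where D: "D \<in> cov B" "val D < (INF C\<in>cov B. val C) + ennreal (e / 2)"
      unfolding INF_less_iff by blast
    have "(INF C\<in>cov (A \<union> B). val C) \<le> val C + val D" by (rule le[OF C(1) D(1)])
    also have "\<dots> \<le> ((INF C\<in>cov A. val C) + ennreal (e / 2)) + ((INF C\<in>cov B. val C) + ennreal (e / 2))"
      using C D by (intro add_mono) auto
    also have "\<dots> = (INF C\<in>cov A. val C) + (INF C\<in>cov B. val C) + ennreal e"
      using e by (simp add: ac_simps flip: ennreal_plus)
    finally show "(INF C\<in>cov (A \<union> B). val C) \<le> (INF C\<in>cov A. val C) + (INF D\<in>cov B. val D) + ennreal e" .
  qed
  then show ?thesis
    unfolding hausdorff_delta_def cov_def[symmetric] val_def[symmetric]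
    by (simp add: distrib_left[symmetric] mult_left_mono)
qed

lemma hausdorff_Un: "hausdorff k (A \<union> B) \<le> hausdorff k A + hausdorff k B"
  unfolding hausdorff_def
proof (rule SUP_least)
  fix \<delta> :: real assume d: "\<delta> \<in> {0<..}"
  have "hausdorff_delta k \<delta> (A \<union> B) \<le> hausdorff_delta k \<delta> A + hausdorff_delta k \<delta> B"
    by (rule hausdorff_delta_Un)
  also have "\<dots> \<le> (SUP \<delta>\<in>{0<..}. hausdorff_delta k \<delta> A) + (SUP \<delta>\<in>{0<..}. hausdorff_delta k \<delta> B)"
    by (intro add_mono SUP_upper d)
  finally show "hausdorff_delta k \<delta> (A \<union> B) \<le> (SUP \<delta>\<in>{0<..}. hausdorff_delta k \<delta> A) + (SUP \<delta>\<in>{0<..}. hausdorff_delta k \<delta> B)" .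
qed

lemma hausdorff_empty [simp]: "hausdorff k {} = 0"
proof -
  have "hausdorff_delta k \<delta> ({} :: 'a set) = 0" if "\<delta> > 0" for \<delta>
  proof -
    have "(INF C \<in> {C :: nat \<Rightarrow> 'a set. {} \<subseteq> (\<Union>i. C i) \<and> (\<forall>i. bounded (C i) \<and> diameter (C i) < \<delta>)}.
        (\<Sum>i. if C i = {} then 0 else ennreal (diameter (C i) ^ k))) \<le> 0"
      by (rule INF_lower2[of "\<lambda>_. {}"]) (use that in auto)
    then show ?thesis unfolding hausdorff_delta_def by simp
  qed
  then show ?thesis unfolding hausdorff_def by simp
qed

lemma hausdorff_UN:
  assumes "finite I"
  shows "hausdorff k (\<Union>i\<in>I. A i) \<le> (\<Sum>i\<in>I. hausdorff k (A i))"
  using assms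
proof (induction I)
  case (insert i I)
  have "hausdorff k (\<Union>i\<in>insert i I. A i) \<le> hausdorff k (A i) + hausdorff k (\<Union>i\<in>I. A i)"
    using hausdorff_Un[of k "A i"] by simp
  also have "\<dots> \<le> hausdorff k (A i) + (\<Sum>i\<in>I. hausdorff k (A i))" by (intro add_left_mono insert)
  finally show ?case using insert by simp
qed simp

text \<open>A grid of \<open>N * N\<close> cells of side \<open>s / N\<close> has cells of diameter
  at most \<open>2 * s / N\<close>, estimated by the sum norm. With the normalisation
  \<open>pi / 4\<close> the total is \<open>pi / 4 * N^2 * (2 * s / N)^2 = pi * s^2\<close>,
  whatever \<delta> is. A constant multiple of the true area \<open>s^2\<close> is good
  enough.\<close>

lemma hausdorff_square:
  fixes a :: "real^3"
  assumes jk: "\<And>k. k = j \<or> k = k1 \<or> k = k2" and s: "s > 0"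
  shows "hausdorff 2 {p::real^3. p $ j = c \<and> a $ k1 \<le> p $ k1 \<and> p $ k1 \<le> a $ k1 + s \<and>
            a $ k2 \<le> p $ k2 \<and> p $ k2 \<le> a $ k2 + s} \<le> ennreal (pi * s\<^sup>2)" (is "hausdorff 2 ?R \<le> _")
  unfolding hausdorff_def
proof (rule SUP_least)
  fix \<delta> :: real assume "\<delta> \<in> {0<..}"
  then have \<delta>: "\<delta> > 0" by simp
  obtain N :: nat where N: "2 * s / \<delta> < N" using reals_Archimedean2 by blast
  then have N0: "N > 0" using s \<delta> by (metis divide_pos_pos gr0I mult_pos_pos not_less_iff_gr_or_eq of_nat_0 zero_less_numeral order.strict_trans)
  define r where "r = s / N"
  have r: "r > 0" "2 * r < \<delta>" using N N0 s \<delta> by (auto simp: r_def field_simps)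
  have Nr: "N * r = s" using N0 by (simp add: r_def)
  \<comment> \<open>Cell \<open>i < N * N\<close> sits in row \<open>i div N\<close> and column
    \<open>i mod N\<close>; all later sets are empty and cost nothing in
    \<open>hausdorff_delta\<close>.\<close>
  define C where "C i = (if i < N * N then
      {p::real^3. p $ j = c \<and> a $ k1 + (i div N) * r \<le> p $ k1 \<and> p $ k1 \<le> a $ k1 + (i div N) * r + r \<and>
            a $ k2 + (i mod N) * r \<le> p $ k2 \<and> p $ k2 \<le> a $ k2 + (i mod N) * r + r} else {})" for i :: nat
  have dC: "dist p q \<le> 2 * r" if "p \<in> C i" "q \<in> C i" for p q i
  proof -
    have i: "i < N * N" using that unfolding C_def by (auto split: if_splits)
    have d1: "\<bar>p $ k1 - q $ k1\<bar> \<le> r" and d2: "\<bar>p $ k2 - q $ k2\<bar> \<le> r" and d3: "p $ j = q $ j"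
      using that i by (auto simp: C_def)
    have "(UNIV::3 set) = {j, k1, k2}" using jk by blast
    moreover have "(\<Sum>k\<in>{j, k1, k2}. \<bar>(p - q) $ k\<bar>) \<le> \<bar>p $ j - q $ j\<bar> + \<bar>p $ k1 - q $ k1\<bar> + \<bar>p $ k2 - q $ k2\<bar>"
      by (simp add: sum.insert_if)
    ultimately have le: "(\<Sum>k\<in>UNIV. \<bar>(p - q) $ k\<bar>) \<le> \<bar>p $ j - q $ j\<bar> + \<bar>p $ k1 - q $ k1\<bar> + \<bar>p $ k2 - q $ k2\<bar>"
      by metis
    have "dist p q \<le> (\<Sum>k\<in>UNIV. \<bar>(p - q) $ k\<bar>)" unfolding dist_norm by (rule norm_le_l1_cart)
    then show ?thesis using le d1 d2 d3 by linarith
  qed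
  have bC: "bounded (C i)" for i
    unfolding bounded_def using dC by (metis)
  have diam: "diameter (C i) \<le> 2 * r" for i
    using dC r by (intro diameter_le) (auto simp: dist_norm)
  have cov: "?R \<subseteq> (\<Union>i. C i)"
  proof
    fix p assume p: "p \<in> ?R"
    \<comment> \<open>The minimum with \<open>N - 1\<close> puts the far edge \<open>x = s\<close>,
      whose quotient is \<open>N\<close>, into the last cell.\<close>
    define f where "f x = min (nat \<lfloor>x / r\<rfloor>) (N - 1)" for x :: real
    have f: "f x < N" "f x * r \<le> x" "x \<le> f x * r + r" if "0 \<le> x" "x \<le> s" for x
    proof -
      show "f x < N" using N0 by (simp add: f_def min_less_iff_disj)
      have fl: "real (nat \<lfloor>x / r\<rfloor>) \<le> x / r" "x / r < real (nat \<lfloor>x / r\<rfloor>) + 1"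
        using that r by (auto intro: of_int_floor_le simp: divide_nonneg_pos)
      have "real (f x) \<le> x / r" using fl(1) unfolding f_def by (metis min.cobounded1 of_nat_le_iff order_trans)
      then show "f x * r \<le> x" using r by (simp add: field_simps)
      show "x \<le> f x * r + r"
      proof (cases "nat \<lfloor>x / r\<rfloor> \<le> N - 1")
        case True
        then have "f x = nat \<lfloor>x / r\<rfloor>" by (simp add: f_def)
        then have "x / r \<le> real (f x) + 1" using fl(2) by linarith
        then show ?thesis using r by (simp add: field_simps)
      next
        case False
        then have "f x = N - 1" by (simp add: f_def)
        then have "f x * r + r = s" using N0 Nr by (simp add: of_nat_diff algebra_simps)
        then show ?thesis using that by simp
      qed
    qed
    define u v where "u = f (p $ k1 - a $ k1)" and "v = f (p $ k2 - a $ k2)"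
    have uv: "u < N" "v < N" "u * r \<le> p $ k1 - a $ k1" "p $ k1 - a $ k1 \<le> u * r + r"
        "v * r \<le> p $ k2 - a $ k2" "p $ k2 - a $ k2 \<le> v * r + r"
      using f[of "p $ k1 - a $ k1"] f[of "p $ k2 - a $ k2"] p by (auto simp: u_def v_def)
    have lt: "u * N + v < N * N"
    proof -
      have "u * N + v < u * N + N" using uv by simp
      also have "\<dots> = Suc u * N" by simp
      also have "\<dots> \<le> N * N" using uv by (intro mult_right_mono) auto
      finally show ?thesis .
    qed
    have "(u * N + v) div N = u" "(u * N + v) mod N = v" using uv by auto
    then have "p \<in> C (u * N + v)" using lt uv p unfolding C_def by auto
    then show "p \<in> (\<Union>i. C i)" by blast
  qed
  have "(\<Sum>i. if C i = {} then 0 else ennreal (diameter (C i) ^ 2)) =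
        (\<Sum>i<N*N. if C i = {} then 0 else ennreal (diameter (C i) ^ 2))"
    by (rule suminf_finite) (auto simp: C_def)
  also have "\<dots> \<le> (\<Sum>i<N*N. ennreal ((2 * r)\<^sup>2))"
  proof (intro sum_mono)
    fix i
    have "(diameter (C i))\<^sup>2 \<le> (2 * r)\<^sup>2" by (rule power_mono[OF diam diameter_ge_0[OF bC]])
    then show "(if C i = {} then 0 else ennreal (diameter (C i) ^ 2)) \<le> ennreal ((2 * r)\<^sup>2)"
      by (auto intro: ennreal_leI)
  qed
  also have "\<dots> = ennreal (4 * s\<^sup>2)"
    by (simp add: Nr[symmetric] power2_eq_square ennreal_mult'[symmetric] ennreal_of_nat_eq_real_of_nat mult_ac)
  finally have val: "(\<Sum>i. if C i = {} then 0 else ennreal (diameter (C i) ^ 2)) \<le> ennreal (4 * s\<^sup>2)" .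
  have "hausdorff_delta 2 \<delta> ?R \<le> ennreal (unit_ball_vol (real 2) / 2 ^ 2) * ennreal (4 * s\<^sup>2)"
    unfolding hausdorff_delta_def
  proof (intro mult_left_mono INF_lower2[of C])
    show "(\<Sum>i. if C i = {} then 0 else ennreal (diameter (C i) ^ 2)) \<le> ennreal (4 * s\<^sup>2)" by (rule val)
    show "C \<in> {C. ?R \<subseteq> (\<Union>i. C i) \<and> (\<forall>i. bounded (C i) \<and> diameter (C i) < \<delta>)}"
      using cov bC le_less_trans[OF diam r(2)] by auto
  qed auto
  also have "\<dots> = ennreal (pi * s\<^sup>2)"
    by (simp add: unit_ball_vol_2 ennreal_mult'[symmetric])
  finally show "hausdorff_delta 2 \<delta> ?R \<le> ennreal (pi * s\<^sup>2)" .
qed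

text \<open>Each of the six faces lies in a square of side \<open>s\<close> in its plane. This
  bounds the area of the jumps that a replacement in the box can create.\<close>

lemma hausdorff_frontier_box:
  fixes l u :: "real^3"
  assumes s: "s > 0" and lu: "\<And>k. u $ k \<le> l $ k + s"
  shows "hausdorff 2 (cbox l u - box l u) \<le> ennreal (6 * pi * s\<^sup>2)"
proof -
  define R where "R j c = {p::real^3. p $ j = c \<and> (\<forall>k. k \<noteq> j \<longrightarrow> l $ k \<le> p $ k \<and> p $ k \<le> l $ k + s)}" for j c
  have R: "hausdorff 2 (R j c) \<le> ennreal (pi * s\<^sup>2)" for j c
  proof -
    obtain k1 k2 :: 3 where k: "k1 \<noteq> j" "k2 \<noteq> j" "\<And>k. k = j \<or> k = k1 \<or> k = k2"
    proof -
      have "j = 1 \<or> j = 2 \<or> j = 3" by (rule exhaust_3)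
      then show ?thesis
      proof (elim disjE)
        assume "j = 1" then show ?thesis using exhaust_3 by (intro that[of 2 3]) auto
      next
        assume "j = 2" then show ?thesis using exhaust_3 by (intro that[of 1 3]) auto
      next
        assume "j = 3" then show ?thesis using exhaust_3 by (intro that[of 1 2]) auto
      qed
    qed
    have "hausdorff 2 (R j c) \<le> hausdorff 2 {p::real^3. p $ j = c \<and> l $ k1 \<le> p $ k1 \<and> p $ k1 \<le> l $ k1 + s \<and>
            l $ k2 \<le> p $ k2 \<and> p $ k2 \<le> l $ k2 + s}"
      by (rule hausdorff_mono) (use k in \<open>auto simp: R_def\<close>)
    also have "\<dots> \<le> ennreal (pi * s\<^sup>2)" using k(3) s by (rule hausdorff_square)
    finally show ?thesis .
  qed
  have sub: "cbox l u - box l u \<subseteq> (\<Union>j. R j (l $ j)) \<union> (\<Union>j. R j (u $ j))"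
  proof
    fix p assume p: "p \<in> cbox l u - box l u"
    then have b: "l $ k \<le> p $ k" "p $ k \<le> u $ k" for k by (auto simp: mem_box_cart)
    obtain j where "\<not> (l $ j < p $ j \<and> p $ j < u $ j)" using p by (auto simp: mem_box_cart)
    then have "p $ j = l $ j \<or> p $ j = u $ j" using b[of j] by linarith
    moreover have "p $ k \<le> l $ k + s" for k using b(2)[of k] lu[of k] by linarith
    ultimately show "p \<in> (\<Union>j. R j (l $ j)) \<union> (\<Union>j. R j (u $ j))"
      using b by (auto simp: R_def)
  qed
  have "hausdorff 2 (cbox l u - box l u) \<le> hausdorff 2 (\<Union>j. R j (l $ j)) + hausdorff 2 (\<Union>j. R j (u $ j))"
    using hausdorff_mono[OF sub] hausdorff_Un order_trans by blast
  also have "\<dots> \<le> (\<Sum>j\<in>UNIV. hausdorff 2 (R j (l $ j))) + (\<Sum>j\<in>UNIV. hausdorff 2 (R j (u $ j)))"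
    by (intro add_mono hausdorff_UN) auto
  also have "\<dots> \<le> (\<Sum>j\<in>(UNIV::3 set). ennreal (pi * s\<^sup>2)) + (\<Sum>j\<in>(UNIV::3 set). ennreal (pi * s\<^sup>2))"
    by (intro add_mono sum_mono R)
  also have "\<dots> = ennreal (6 * pi * s\<^sup>2)"
    by (simp add: ennreal_mult'[symmetric] ennreal_plus[symmetric] flip: ennreal_numeral del: ennreal_plus)
  finally show ?thesis .
qed

section \<open>Approximate limits and gradients\<close>

definition ball_average :: "(real^3 \<Rightarrow> real) \<Rightarrow> real^3 \<Rightarrow> real \<Rightarrow> real" where
  "ball_average f x r = (LINT y:ball x r|lebesgue. f y) / measure lebesgue (ball x r)"

lemma measure_ball_3:
  fixes x :: "real^3"
  assumes "r > 0"
  shows "measure lebesgue (ball x r) = r^3 * measure lebesgue (ball (0::real^3) 1)"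
    and "measure lebesgue (ball (0::real^3) 1) > 0" and "measure lebesgue (ball x r) > 0"
  using content_ball_conv_unit_ball[of r x] content_ball_pos[of 1 "0::real^3"] content_ball_pos[of r x] assms
  by auto

lemma approx_limit_iff: "approx_limit u x z \<longleftrightarrow> ((\<lambda>r. ball_average (\<lambda>y. norm (u y - z)) x r) \<longlongrightarrow> 0) (at_right 0)"
  by (simp add: approx_limit_def ball_average_def)

lemma has_approx_gradient_iff:
  "has_approx_gradient u x G \<longleftrightarrow> (\<exists>z. approx_limit u x z \<and>
     ((\<lambda>r. ball_average (\<lambda>y. norm (u y - z - G *v (y - x)) / r) x r) \<longlongrightarrow> 0) (at_right 0))"
  by (simp add: has_approx_gradient_def ball_average_def)

lemma ball_average_nonneg:
  assumes "\<And>y. y \<in> ball x r \<Longrightarrow> 0 \<le> f y"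
  shows "0 \<le> ball_average f x r"
  unfolding ball_average_def set_lebesgue_integral_def
  using assms by (intro divide_nonneg_nonneg Bochner_Integration.integral_nonneg) (auto simp: indicator_def)

text \<open>Valid also for a non-integrable \<open>f\<close>, whose Bochner integral is 0; the sign
  condition on \<open>g\<close> covers this case.\<close>

lemma ball_average_mono:
  assumes "set_integrable lebesgue (ball x r) g" "\<And>y. y \<in> ball x r \<Longrightarrow> f y \<le> g y" "\<And>y. y \<in> ball x r \<Longrightarrow> 0 \<le> g y"
  shows "ball_average f x r \<le> ball_average g x r"
  unfolding ball_average_def set_lebesgue_integral_def
  using assms by (intro divide_right_mono integral_mono') (auto simp: set_integrable_def indicator_def)

lemma set_integrable_ball_continuous [intro]:
  fixes f :: "real^3 \<Rightarrow> 'b::euclidean_space"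
  assumes "continuous_on UNIV f"
  shows "set_integrable lebesgue (ball x r) f"
proof (rule set_integrable_subset)
  have "integrable lborel (\<lambda>y. indicator (cball x r) y *\<^sub>R f y)"
    by (rule borel_integrable_compact) (use assms continuous_on_subset in auto)
  then show "set_integrable lebesgue (cball x r) f"
    unfolding set_integrable_def by (subst integrable_completion) auto
qed auto

lemma set_integrable_ball_const [intro]:
  "set_integrable lebesgue (ball x r) (\<lambda>y::real^3. c :: 'b :: euclidean_space)"
  by (intro set_integrable_ball_continuous continuous_intros)

lemma continuous_on_matrix_vector_mult_diff [continuous_intros]:
  fixes G :: "real^3^3"
  shows "continuous_on S (\<lambda>y. G *v (y - x))"
  by (intro bounded_linear.continuous_on[OF matrix_vector_mul_bounded_linear] continuous_intros)

lemma set_integral_mono_set: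
  fixes f :: "'a \<Rightarrow> real"
  assumes "set_integrable M B f" "A \<subseteq> B" "\<And>x. 0 \<le> f x"
  shows "(LINT x:A|M. f x) \<le> (LINT x:B|M. f x)"
  unfolding set_lebesgue_integral_def
  using assms by (intro integral_mono') (auto simp: set_integrable_def indicator_def)

lemma ball_average_const: "r > 0 \<Longrightarrow> ball_average (\<lambda>y. c) x r = c"
  using measure_ball_3(3)[of r x] emeasure_bounded_finite[of "ball x r"]
  by (simp add: ball_average_def set_integral_const less_top)

lemma ball_average_add:
  assumes "set_integrable lebesgue (ball x r) f" "set_integrable lebesgue (ball x r) g"
  shows "ball_average (\<lambda>y. f y + g y) x r = ball_average f x r + ball_average g x r"
  using assms by (simp add: ball_average_def set_integral_add add_divide_distrib)

lemma tendsto_0_at_right_squeeze: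
  fixes f g :: "real \<Rightarrow> real"
  assumes "r0 > 0" "\<And>r. 0 < r \<Longrightarrow> r < r0 \<Longrightarrow> 0 \<le> f r" "\<And>r. 0 < r \<Longrightarrow> r < r0 \<Longrightarrow> f r \<le> g r" "(g \<longlongrightarrow> 0) (at_right 0)"
  shows "(f \<longlongrightarrow> 0) (at_right 0)"
proof (rule tendsto_sandwich[OF _ _ tendsto_const assms(4)])
  have "eventually (\<lambda>r. r \<in> {0<..<r0}) (at_right 0)" using assms(1) by (rule eventually_at_right_real)
  then show "\<forall>\<^sub>F r in at_right 0. 0 \<le> f r" "\<forall>\<^sub>F r in at_right 0. f r \<le> g r"
    using assms(2,3) by (auto elim!: eventually_mono)
qed

text \<open>The integrand may depend on the radius, as the difference quotient in
  \<open>has_approx_gradient\<close> does.\<close>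

lemma ball_average_small:
  assumes "\<And>e. e > 0 \<Longrightarrow> \<exists>r0>0. \<forall>r y. 0 < r \<longrightarrow> r < r0 \<longrightarrow> y \<in> ball x r \<longrightarrow> 0 \<le> f r y \<and> f r y \<le> e"
  shows "((\<lambda>r. ball_average (f r) x r) \<longlongrightarrow> 0) (at_right 0)"
proof (rule tendstoI)
  fix e :: real assume "e > 0"
  then obtain r0 where r0: "r0 > 0" "\<And>r y. 0 < r \<Longrightarrow> r < r0 \<Longrightarrow> y \<in> ball x r \<Longrightarrow> 0 \<le> f r y \<and> f r y \<le> e / 2"
    using assms[of "e / 2"] by fastforce
  have "dist (ball_average (f r) x r) 0 < e" if "0 < r" "r < r0" for r
  proof -
    have "ball_average (f r) x r \<le> ball_average (\<lambda>y. e / 2) x r"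
      using r0(2) that \<open>e > 0\<close> by (intro ball_average_mono) auto
    moreover have "0 \<le> ball_average (f r) x r" using r0(2) that by (intro ball_average_nonneg) auto
    ultimately show ?thesis using \<open>e > 0\<close> that by (simp add: ball_average_const)
  qed
  then show "\<forall>\<^sub>F r in at_right 0. dist (ball_average (f r) x r) 0 < e"
    using eventually_at_right_real[OF r0(1)] by (auto elim!: eventually_mono)
qed

lemma approx_limit_continuous:
  assumes "isCont u x"
  shows "approx_limit u x (u x)"
  unfolding approx_limit_iff
proof (rule ball_average_small)
  fix e :: real assume "e > 0"
  then obtain d where "d > 0" "\<And>y. dist y x < d \<Longrightarrow> dist (u y) (u x) < e"
    using assms unfolding continuous_at_eps_delta by blast
  then show "\<exists>r0>0. \<forall>r y. 0 < r \<longrightarrow> r < r0 \<longrightarrow> y \<in> ball x r \<longrightarrow> 0 \<le> norm (u y - u x) \<and> norm (u y - u x) \<le> e"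
    by (intro exI[of _ d]) (auto simp: dist_norm norm_minus_commute less_imp_le)
qed

lemma has_approx_gradient_derivative:
  assumes "(u has_derivative (\<lambda>h. G *v h)) (at x)"
  shows "has_approx_gradient u x G"
  unfolding has_approx_gradient_iff
proof (intro exI conjI)
  show "approx_limit u x (u x)" by (rule approx_limit_continuous[OF has_derivative_continuous[OF assms]])
  show "((\<lambda>r. ball_average (\<lambda>y. norm (u y - u x - G *v (y - x)) / r) x r) \<longlongrightarrow> 0) (at_right 0)"
  proof (rule ball_average_small)
    fix e :: real assume e: "e > 0"
    then obtain d where d: "d > 0" "\<And>y. norm (y - x) < d \<Longrightarrow> norm (u y - u x - G *v (y - x)) \<le> e * norm (y - x)"
      using assms unfolding has_derivative_at_alt by metis
    have "norm (u y - u x - G *v (y - x)) / r \<le> e" if "0 < r" "r < d" "y \<in> ball x r" for r y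
    proof -
      have n: "norm (y - x) < r" using that by (simp add: dist_norm norm_minus_commute)
      then have "norm (u y - u x - G *v (y - x)) \<le> e * norm (y - x)" using d(2) that by simp
      also have "\<dots> \<le> e * r" using n e by simp
      finally show ?thesis using that by (simp add: divide_le_eq)
    qed
    then show "\<exists>r0>0. \<forall>r y. 0 < r \<longrightarrow> r < r0 \<longrightarrow> y \<in> ball x r \<longrightarrow>
        0 \<le> norm (u y - u x - G *v (y - x)) / r \<and> norm (u y - u x - G *v (y - x)) / r \<le> e"
      using d(1) by (intro exI[of _ d]) auto
  qed
qed

text \<open>Balls of small radius lie in \<open>U\<close>, so limits as the radius tends to 0 only
  see values in \<open>U\<close>.\<close>

lemma ball_average_local:
  assumes "open U" "x \<in> U" "\<And>r y. y \<in> U \<Longrightarrow> f r y = g r y"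
  shows "((\<lambda>r. ball_average (f r) x r) \<longlongrightarrow> 0) (at_right 0) \<longleftrightarrow> ((\<lambda>r. ball_average (g r) x r) \<longlongrightarrow> 0) (at_right 0)"
proof -
  obtain d where d: "d > 0" "ball x d \<subseteq> U" using assms openE by blast
  have "ball_average (f r) x r = ball_average (g r) x r" if "r \<in> {0<..<d}" for r
    unfolding ball_average_def using assms(3) d(2) that
    by (intro arg_cong2[where f = "(/)"] set_lebesgue_integral_cong) (auto simp: subset_iff)
  then show ?thesis
    using eventually_at_right_real[OF d(1)] by (intro tendsto_cong) (auto elim!: eventually_mono)
qed

lemma approx_limit_local:
  assumes "open U" "x \<in> U" "\<And>y. y \<in> U \<Longrightarrow> u y = v y"
  shows "approx_limit u x z \<longleftrightarrow> approx_limit v x z"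
  unfolding approx_limit_iff using assms by (intro ball_average_local) auto

lemma approx_discontinuity_set_local:
  assumes "open U" "x \<in> U" "\<And>y. y \<in> U \<Longrightarrow> u y = v y"
  shows "x \<in> approx_discontinuity_set u \<longleftrightarrow> x \<in> approx_discontinuity_set v"
proof -
  have "approx_limit u x = approx_limit v x" by (rule ext) (rule approx_limit_local[OF assms])
  then show ?thesis by (simp add: approx_discontinuity_set_def)
qed

lemma has_approx_gradient_local:
  assumes "open U" "x \<in> U" "\<And>y. y \<in> U \<Longrightarrow> u y = v y"
  shows "has_approx_gradient u x G \<longleftrightarrow> has_approx_gradient v x G"
proof -
  have al: "approx_limit u x = approx_limit v x" by (rule ext) (rule approx_limit_local[OF assms])
  have "((\<lambda>r. ball_average (\<lambda>y. norm (u y - z - G *v (y - x)) / r) x r) \<longlongrightarrow> 0) (at_right 0) \<longleftrightarrow>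
      ((\<lambda>r. ball_average (\<lambda>y. norm (v y - z - G *v (y - x)) / r) x r) \<longlongrightarrow> 0) (at_right 0)" for z
    by (rule ball_average_local[OF assms(1,2)]) (simp add: assms(3))
  then show ?thesis by (simp add: has_approx_gradient_iff al)
qed

lemma approx_gradient_local:
  assumes "open U" "x \<in> U" "\<And>y. y \<in> U \<Longrightarrow> u y = v y"
  shows "approx_gradient u x = approx_gradient v x"
proof -
  have "has_approx_gradient u x = has_approx_gradient v x" by (rule ext) (rule has_approx_gradient_local[OF assms])
  then show ?thesis by (simp add: approx_gradient_def)
qed

text \<open>The constant \<open>norm (z1 - z2)\<close> is its own average and is bounded by the sum
  of two averages that tend to 0; integrability of \<open>u\<close> near \<open>x\<close> makes
  these averages additive.\<close>

lemma approx_limit_unique: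
  assumes "r0 > 0" "set_integrable lebesgue (ball x r0) u" "approx_limit u x z1" "approx_limit u x z2"
  shows "z1 = z2"
proof -
  let ?a = "\<lambda>z r. ball_average (\<lambda>y. norm (u y - z)) x r"
  have i: "set_integrable lebesgue (ball x r) (\<lambda>y. norm (u y - z))" if "r < r0" for r z
    by (intro set_integrable_norm set_integral_diff set_integrable_subset[OF assms(2)]) (use that in auto)
  have "((\<lambda>r. norm (z1 - z2)) \<longlongrightarrow> 0) (at_right (0::real))"
  proof (rule tendsto_0_at_right_squeeze[OF assms(1)])
    fix r :: real assume r: "0 < r" "r < r0"
    have "norm (z1 - z2) = ball_average (\<lambda>y. norm (z1 - z2)) x r" using r by (simp add: ball_average_const)
    also have "\<dots> \<le> ball_average (\<lambda>y. norm (u y - z1) + norm (u y - z2)) x r"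
    proof (rule ball_average_mono)
      fix y show "norm (z1 - z2) \<le> norm (u y - z1) + norm (u y - z2)"
        using norm_triangle_ineq4[of "u y - z2" "u y - z1"] by (simp add: algebra_simps)
    qed (auto intro!: set_integral_add i r)
    also have "\<dots> = ?a z1 r + ?a z2 r" by (intro ball_average_add i r)
    finally show "norm (z1 - z2) \<le> ?a z1 r + ?a z2 r" .
  next
    show "((\<lambda>r. ?a z1 r + ?a z2 r) \<longlongrightarrow> 0) (at_right 0)"
      using tendsto_add[OF assms(3,4)[unfolded approx_limit_iff]] by simp
  qed simp
  then have "norm (z1 - z2) = 0" by (simp add: tendsto_const_iff)
  then show ?thesis by simp
qed

lemma lebesgue_integral_translation:
  fixes f :: "real^3 \<Rightarrow> real"
  assumes "f \<in> borel_measurable lebesgue"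
  shows "(LINT y|lebesgue. f (a + y)) = (LINT y|lebesgue. f y)"
    and "integrable lebesgue f \<Longrightarrow> integrable lebesgue (\<lambda>y. f (a + y))"
proof -
  have T: "(\<lambda>x. a + (\<Sum>j\<in>Basis. (1 * (x \<bullet> j)) *\<^sub>R j)) = (+) a"
    by (auto simp: euclidean_representation)
  have m: "(+) a \<in> lebesgue \<rightarrow>\<^sub>M lebesgue"
    using lebesgue_affine_measurable[of "\<lambda>_. 1" a] unfolding T by simp
  have d: "lebesgue = distr lebesgue lebesgue ((+) a)"
    using lebesgue_affine_euclidean[of "\<lambda>_. 1" a] unfolding T by (simp add: density_1)
  show "(LINT y|lebesgue. f (a + y)) = (LINT y|lebesgue. f y)"
    by (subst (2) d, subst integral_distr[OF m assms]) simp
  assume "integrable lebesgue f"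
  then show "integrable lebesgue (\<lambda>y. f (a + y))"
    by (subst (asm) d, subst (asm) integrable_distr_eq[OF m assms]) simp
qed

text \<open>Compare the first-order expansions at \<open>y\<close> and at \<open>y + (r / 2) e\<close>. The case \<open>u = 0\<close> also gives
  uniqueness of the approximate gradient.\<close>

lemma approx_gradient_invariant_direction:
  fixes u :: "real^3 \<Rightarrow> real^3"
  assumes U: "open U" "x \<in> U" and u: "set_integrable lebesgue U u"
    and inv: "\<And>s. AE y in lebesgue. y \<in> U \<longrightarrow> y + s *\<^sub>R e \<in> U \<longrightarrow> u (y + s *\<^sub>R e) = u y"
    and e: "norm e = 1" and G: "has_approx_gradient u x G"
  shows "G *v e = 0"
proof -
  obtain z where z: "((\<lambda>r. ball_average (\<lambda>y. norm (u y - z - G *v (y - x)) / r) x r) \<longlongrightarrow> 0) (at_right 0)"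
    using G unfolding has_approx_gradient_iff by blast
  obtain r0 where r0: "r0 > 0" "ball x r0 \<subseteq> U" using U openE by blast
  let ?D = "\<lambda>y. norm (u y - z - G *v (y - x))"
  have contG: "continuous_on UNIV (\<lambda>y. z + G *v (y - x))"
    by (intro continuous_intros)
  have "((\<lambda>r. norm (G *v e)) \<longlongrightarrow> 0) (at_right (0::real))"
  proof (rule tendsto_0_at_right_squeeze[OF r0(1)])
    fix r :: real assume r: "0 < r" "r < r0"
    \<comment> \<open>Half the radius: a shift of \<open>B\<close> by the vector \<open>a\<close> of
      length \<open>r / 2\<close> stays inside \<open>ball x r\<close>.\<close>
    define B where "B = ball x (r / 2)"
    define I where "I = (LINT y:ball x r|lebesgue. ?D y)"
    define a where "a = (r / 2) *\<^sub>R e"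
    have na: "norm a = r / 2" using e r by (simp add: a_def)
    have Di: "set_integrable lebesgue (ball x r) ?D"
    proof -
      have "set_integrable lebesgue (ball x r) u" using u by (rule set_integrable_subset) (use r r0 in auto)
      then have "set_integrable lebesgue (ball x r) (\<lambda>y. norm (u y - (z + G *v (y - x))))"
        by (rule set_integrable_norm[OF set_integral_diff(1)[OF _ set_integrable_ball_continuous[OF contG]]])
      then show ?thesis by (simp add: diff_diff_eq)
    qed
    have DiB: "set_integrable lebesgue B ?D"
      by (rule set_integrable_subset[OF Di]) (use r in \<open>auto simp: B_def\<close>)
    let ?f = "\<lambda>y. indicator (ball x r) y *\<^sub>R ?D y"
    have fi: "integrable lebesgue ?f" using Di by (simp add: set_integrable_def)
    have fi': "integrable lebesgue (\<lambda>y. ?f (a + y))"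
      by (rule lebesgue_integral_translation(2)) (use fi in auto)
    have sub: "a + y \<in> ball x r" "y \<in> ball x r" if "y \<in> B" for y
    proof -
      have "dist x y < r / 2" using that by (simp add: B_def)
      moreover have "dist x (a + y) \<le> dist x y + norm a"
        using norm_triangle_ineq4[of "x - y" a] by (simp add: dist_norm algebra_simps)
      ultimately show "a + y \<in> ball x r" "y \<in> ball x r" using na r by auto
    qed
    have mB: "measure lebesgue (ball x r) = 8 * measure lebesgue B" "measure lebesgue B > 0"
      using measure_ball_3(1,3)[of r x] measure_ball_3(1,3)[of "r/2" x] r by (auto simp: B_def power_divide)
    have "measure lebesgue B * (norm (G *v e) * (r / 2)) = (LINT y|lebesgue. indicator B y *\<^sub>R (norm (G *v e) * (r / 2)))"
      using set_integral_const[of B lebesgue "norm (G *v e) * (r / 2)"] emeasure_bounded_finite[of B]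
      by (simp add: set_lebesgue_integral_def B_def)
    also have "\<dots> \<le> (LINT y|lebesgue. indicator B y *\<^sub>R ?D y + ?f (a + y))"
    proof (rule integral_mono_AE)
      show "integrable lebesgue (\<lambda>y. indicator B y *\<^sub>R (norm (G *v e) * (r / 2)))"
        using set_integrable_ball_const[of x "r/2" "norm (G *v e) * (r / 2)"] by (simp add: B_def set_integrable_def)
      show "integrable lebesgue (\<lambda>y. indicator B y *\<^sub>R ?D y + ?f (a + y))"
        using DiB fi' by (intro Bochner_Integration.integrable_add) (auto simp: set_integrable_def)
      show "AE y in lebesgue. indicator B y *\<^sub>R (norm (G *v e) * (r / 2)) \<le> indicator B y *\<^sub>R ?D y + ?f (a + y)"
        using inv[of "r / 2"]
      proof eventually_elim
        case (elim y)
        show ?case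
        proof (cases "y \<in> B")
          case True
          have "y \<in> U" "y + a \<in> U" using sub[OF True] r0(2) r by (auto simp: subset_iff add.commute)
          then have eq: "u (a + y) = u y" using elim by (simp add: a_def add.commute)
          have "norm (G *v e) * (r / 2) = norm (G *v a)"
            using r by (simp add: a_def matrix_vector_mult_scaleR)
          \<comment> \<open>Since \<open>u\<close> takes the same value at \<open>y\<close> and
            \<open>a + y\<close>, the two expansion errors differ exactly by
            \<open>G *v a\<close>.\<close>
          also have "G *v a = (u y - z - G *v (y - x)) - (u (a + y) - z - G *v (a + y - x))"
            by (simp add: eq matrix_vector_mult_diff_distrib matrix_vector_right_distrib algebra_simps)
          also have "norm \<dots> \<le> ?D y + ?D (a + y)" by (rule norm_triangle_ineq4)
          finally show ?thesis using True sub[OF True] by simp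
        qed simp
      qed
    qed
    also have "\<dots> = (LINT y:B|lebesgue. ?D y) + (LINT y|lebesgue. ?f (a + y))"
      using DiB fi' unfolding set_lebesgue_integral_def
      by (intro Bochner_Integration.integral_add) (auto simp: set_integrable_def)
    also have "(LINT y|lebesgue. ?f (a + y)) = I"
      unfolding I_def set_lebesgue_integral_def by (rule lebesgue_integral_translation(1)) (use fi in auto)
    also have "(LINT y:B|lebesgue. ?D y) \<le> I"
      unfolding I_def by (rule set_integral_mono_set[OF Di]) (use sub(2) in \<open>auto simp: B_def\<close>)
    finally have "measure lebesgue B * (norm (G *v e) * (r / 2)) \<le> 2 * I" by simp
    \<comment> \<open>The half ball has an eighth of the volume of \<open>ball x r\<close>, which
      turns the factor 4 into 32.\<close>
    then have "norm (G *v e) \<le> 4 * (I / r) / measure lebesgue B"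
      using mB(2) r by (simp add: field_simps)
    also have "\<dots> = 32 * ball_average (\<lambda>y. ?D y / r) x r"
      using mB by (simp add: ball_average_def I_def)
    finally show "norm (G *v e) \<le> 32 * ball_average (\<lambda>y. ?D y / r) x r" .
  next
    show "((\<lambda>r. 32 * ball_average (\<lambda>y. ?D y / r) x r) \<longlongrightarrow> 0) (at_right 0)"
      using tendsto_mult_right_zero[OF z] by simp
  qed simp
  then show ?thesis by (simp add: tendsto_const_iff)
qed

lemma has_approx_gradient_unique:
  assumes U: "open U" "x \<in> U" and u: "set_integrable lebesgue U u"
    and "has_approx_gradient u x G1" "has_approx_gradient u x G2"
  shows "G1 = G2"
proof -
  let ?D = "\<lambda>z G y. u y - z - G *v (y - x)"
  obtain r0 where r0: "r0 > 0" "ball x r0 \<subseteq> U" using U openE by blast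
  obtain z1 where z1: "approx_limit u x z1" "((\<lambda>r. ball_average (\<lambda>y. norm (?D z1 G1 y) / r) x r) \<longlongrightarrow> 0) (at_right 0)"
    using assms(4) unfolding has_approx_gradient_iff by blast
  obtain z2 where z2: "approx_limit u x z2" "((\<lambda>r. ball_average (\<lambda>y. norm (?D z2 G2 y) / r) x r) \<longlongrightarrow> 0) (at_right 0)"
    using assms(5) unfolding has_approx_gradient_iff by blast
  have ur: "set_integrable lebesgue (ball x r) u" if "r \<le> r0" for r
    using u by (rule set_integrable_subset) (use that r0 in \<open>auto simp: subset_iff\<close>)
  \<comment> \<open>Both expansions have to be taken around the same value, which uniqueness of the
    approximate limit provides.\<close>
  have zz: "z2 = z1" using approx_limit_unique[OF r0(1) ur z2(1) z1(1)] by simp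
  have Di: "set_integrable lebesgue (ball x r) (\<lambda>y. norm (?D z1 G y) / r)" if "r \<le> r0" for r G
  proof -
    have "set_integrable lebesgue (ball x r) (\<lambda>y. norm (u y - (z1 + G *v (y - x))) / r)"
      by (intro set_integrable_divide set_integrable_norm set_integral_diff(1)[OF ur[OF that]] set_integrable_ball_continuous
          continuous_intros)
    then show ?thesis by (simp add: diff_diff_eq)
  qed
  let ?H = "G1 - G2"
  \<comment> \<open>The errors of the two expansions of \<open>u\<close> differ by
    \<open>?H *v (y - x)\<close>, so \<open>?H\<close> is an approximate gradient of the zero map,
    which is invariant in all directions.\<close>
  have H: "has_approx_gradient (\<lambda>_. 0) x ?H"
    unfolding has_approx_gradient_iff
  proof (intro exI conjI)
    show "approx_limit (\<lambda>_. 0) x 0" using approx_limit_continuous[where u = "\<lambda>_. 0"] by simp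
    show "((\<lambda>r. ball_average (\<lambda>y. norm (0 - 0 - ?H *v (y - x)) / r) x r) \<longlongrightarrow> 0) (at_right 0)"
    proof (rule tendsto_0_at_right_squeeze[OF r0(1)])
      fix r :: real assume r: "0 < r" "r < r0"
      have "ball_average (\<lambda>y. norm (0 - 0 - ?H *v (y - x)) / r) x r
          \<le> ball_average (\<lambda>y. norm (?D z1 G1 y) / r + norm (?D z1 G2 y) / r) x r"
      proof (rule ball_average_mono)
        fix y
        have "0 - 0 - ?H *v (y - x) = ?D z1 G1 y - ?D z1 G2 y"
          by (simp add: matrix_vector_mult_diff_rdistrib)
        then have "norm (0 - 0 - ?H *v (y - x)) \<le> norm (?D z1 G1 y) + norm (?D z1 G2 y)"
          by (metis norm_triangle_ineq4)
        then show "norm (0 - 0 - ?H *v (y - x)) / r \<le> norm (?D z1 G1 y) / r + norm (?D z1 G2 y) / r"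
          using r by (simp add: divide_right_mono flip: add_divide_distrib)
      qed (use r in \<open>auto intro!: set_integral_add Di\<close>)
      also have "\<dots> = ball_average (\<lambda>y. norm (?D z1 G1 y) / r) x r + ball_average (\<lambda>y. norm (?D z1 G2 y) / r) x r"
        using r by (intro ball_average_add Di) auto
      finally show "ball_average (\<lambda>y. norm (0 - 0 - ?H *v (y - x)) / r) x r \<le> \<dots>" .
      show "0 \<le> ball_average (\<lambda>y. norm (0 - 0 - ?H *v (y - x)) / r) x r"
        using r by (intro ball_average_nonneg) auto
    next
      show "((\<lambda>r. ball_average (\<lambda>y. norm (?D z1 G1 y) / r) x r + ball_average (\<lambda>y. norm (?D z1 G2 y) / r) x r) \<longlongrightarrow> 0) (at_right 0)"
        using tendsto_add[OF z1(2) z2(2)[unfolded zz]] by simp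
    qed
  qed
  have "?H *v axis k 1 = 0" for k
    by (rule approx_gradient_invariant_direction[OF open_UNIV UNIV_I _ _ _ H]) (auto simp: set_integrable_def)
  then have "?H *v v = 0" for v
    by (metis (no_types, lifting) matrix_eq matrix_vector_mul_component matrix_vector_mult_0 matrix_vector_mult_basis vec_eq_iff zero_index column_def vec_lambda_beta)
  then have "?H = 0" by (simp add: matrix_eq)
  then show ?thesis by simp
qed

lemma approx_gradient_eqI:
  assumes "open U" "x \<in> U" "set_integrable lebesgue U u" "has_approx_gradient u x G"
  shows "approx_gradient u x = G"
  unfolding approx_gradient_def using assms has_approx_gradient_unique[OF assms(1-3)]
  by (auto intro!: the_equality)

lemma approx_gradient_derivative:
  assumes "continuous_on UNIV u" "(u has_derivative (\<lambda>h. G *v h)) (at x)"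
  shows "approx_gradient u x = G"
  by (rule approx_gradient_eqI[of "ball x 1"])
    (use assms in \<open>auto intro: has_approx_gradient_derivative\<close>)

text \<open>Holds at every point, since \<open>approx_gradient\<close> takes the value 0 where no
  approximate gradient exists; hence the sum-of-squares form of the energy density is available
  everywhere.\<close>

lemma approx_gradient_column_zero:
  assumes "open U" "x \<in> U" "set_integrable lebesgue U u"
    and "\<And>s. AE y in lebesgue. y \<in> U \<longrightarrow> y + s *\<^sub>R axis k 1 \<in> U \<longrightarrow> u (y + s *\<^sub>R axis k 1) = u y"
  shows "approx_gradient u x $ i $ k = 0"
proof (cases "\<exists>G. has_approx_gradient u x G")
  case True
  then obtain G where G: "has_approx_gradient u x G" by blast
  then have eq: "approx_gradient u x = G" by (rule approx_gradient_eqI[OF assms(1-3)])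
  have "G *v axis k 1 = 0"
    by (rule approx_gradient_invariant_direction[OF assms _ G]) simp
  then have "(G *v axis k 1) $ i = 0" by simp
  then show ?thesis by (simp add: eq matrix_vector_mult_basis column_def)
next
  case False
  then show ?thesis by (simp add: approx_gradient_def)
qed

text \<open>The volume of \<open>ball x (2 * h)\<close> is a constant times \<open>h^3\<close>, so
  the integral over a part of that ball, divided by \<open>h^3\<close>, is at most a constant times
  the full average. Applied with corner cubes as \<open>C h\<close>.\<close>

lemma approx_limit_subset_average:
  fixes u :: "real^3 \<Rightarrow> real^3"
  assumes r0: "r0 > 0" "set_integrable lebesgue (ball x r0) u" and z: "approx_limit u x z"
    and C: "\<And>h. h > 0 \<Longrightarrow> C h \<in> sets lebesgue" "\<And>h. h > 0 \<Longrightarrow> C h \<subseteq> ball x (2 * h)"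
  shows "((\<lambda>h. (LINT y:C h|lebesgue. norm (u y - z)) / h^3) \<longlongrightarrow> 0) (at_right 0)"
proof (rule tendsto_0_at_right_squeeze)
  show "r0 / 2 > 0" using r0 by simp
  fix h :: real assume h: "0 < h" "h < r0 / 2"
  let ?m = "8 * measure lebesgue (ball (0::real^3) 1)"
  show "0 \<le> (LINT y:C h|lebesgue. norm (u y - z)) / h^3"
    using h unfolding set_lebesgue_integral_def
    by (intro divide_nonneg_nonneg Bochner_Integration.integral_nonneg) auto
  have i: "set_integrable lebesgue (ball x (2*h)) (\<lambda>y. norm (u y - z))"
    by (intro set_integrable_norm set_integral_diff set_integrable_subset[OF r0(2)]) (use h in auto)
  have "(LINT y:C h|lebesgue. norm (u y - z)) \<le> (LINT y:ball x (2*h)|lebesgue. norm (u y - z))"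
    by (rule set_integral_mono_set[OF i]) (use C h in auto)
  also have "\<dots> = ?m * h^3 * ball_average (\<lambda>y. norm (u y - z)) x (2*h)"
    using measure_ball_3(1,3)[of "2*h" x] h by (simp add: ball_average_def)
  finally show "(LINT y:C h|lebesgue. norm (u y - z)) / h^3 \<le> ?m * ball_average (\<lambda>y. norm (u y - z)) x (2*h)"
    using h by (simp add: divide_le_eq mult_ac)
next
  have "filterlim (\<lambda>h::real. 2 * h) (at_right 0) (at_right 0)"
    unfolding filterlim_at
    by (auto intro!: tendsto_eq_intros intro: eventually_mono[OF eventually_at_right_less])
  then have "((\<lambda>h. ball_average (\<lambda>y. norm (u y - z)) x (2*h)) \<longlongrightarrow> 0) (at_right 0)"
    using z[unfolded approx_limit_iff] by (rule filterlim_compose[rotated])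
  then show "((\<lambda>h. 8 * measure lebesgue (ball (0::real^3) 1) * ball_average (\<lambda>y. norm (u y - z)) x (2*h)) \<longlongrightarrow> 0) (at_right 0)"
    using tendsto_mult_right_zero by blast
qed

section \<open>Slicing by a coordinate\<close>

lemma Basis_cart: "(Basis :: (real^'n) set) = (\<lambda>k. axis k 1) ` UNIV"
  by (auto simp: Basis_vec_def)

lemma borel_measurable_vec_lambda [measurable]:
  fixes f :: "'a \<Rightarrow> 'n::finite \<Rightarrow> real"
  assumes "\<And>k. (\<lambda>x. f x k) \<in> borel_measurable M"
  shows "(\<lambda>x. \<chi> k. f x k) \<in> borel_measurable M"
  unfolding borel_measurable_euclidean_space[of "\<lambda>x. \<chi> k. f x k"] Basis_cart
  using assms by (auto simp: inner_axis)

lemma completion_ex_borel_measurable_vec: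
  fixes f :: "'a \<Rightarrow> real^'n"
  assumes "f \<in> borel_measurable (completion M)"
  shows "\<exists>f'\<in>borel_measurable M. AE x in M. f x = f' x"
proof -
  have "\<exists>g\<in>borel_measurable M. AE x in M. f x $ k = g x" for k
    using assms by (intro completion_ex_borel_measurable_real) measurable
  then obtain g where g: "\<And>k. g k \<in> borel_measurable M" "\<And>k. AE x in M. f x $ k = g k x" by metis
  have "AE x in M. \<forall>k\<in>UNIV. f x $ k = g k x" by (intro AE_finite_allI g(2)) simp
  then have "AE x in M. f x = (\<chi> k. g k x)" by eventually_elim (simp add: vec_eq_iff)
  then show ?thesis using g(1) by (intro bexI[of _ "\<lambda>x. \<chi> k. g k x"]) auto
qed

text \<open>Planar Lebesgue measure on the coordinates other than \<open>j\<close>. Indexing by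
  \<open>UNIV - {j}\<close> treats the three directions uniformly; points are functions, reassembled
  by \<open>join\<close>.\<close>

definition cross_measure :: "3 \<Rightarrow> (3 \<Rightarrow> real) measure" where
  "cross_measure j = PiM (UNIV - {j}) (\<lambda>_. lborel)"

definition join :: "3 \<Rightarrow> (3 \<Rightarrow> real) \<Rightarrow> real \<Rightarrow> real^3" where
  "join j x s = (\<chi> k. if k = j then s else x k)"

lemma join_nth [simp]: "join j x s $ k = (if k = j then s else x k)"
  by (simp add: join_def)

interpretation lborel_product: product_sigma_finite "\<lambda>_::3. lborel :: real measure" ..

lemma sigma_finite_cross_measure: "sigma_finite_measure (cross_measure j)"
  unfolding cross_measure_def by (rule lborel_product.sigma_finite) simp

interpretation cross_pair: pair_sigma_finite "cross_measure j" "lborel :: real measure" for j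
  by (intro pair_sigma_finite.intro sigma_finite_cross_measure sigma_finite_lborel)

lemma measurable_cross_component:
  "k \<noteq> j \<Longrightarrow> (\<lambda>x. x k) \<in> borel_measurable (cross_measure j)"
  unfolding cross_measure_def by (rule measurable_component_singleton[of k _ "\<lambda>_. lborel", simplified]) simp

lemma measurable_join_pair [measurable]:
  "(\<lambda>q. join j (fst q) (snd q)) \<in> borel_measurable (cross_measure j \<Otimes>\<^sub>M lborel)"
  unfolding join_def
proof (rule borel_measurable_vec_lambda)
  fix k
  show "(\<lambda>q. if k = j then snd q else fst q k) \<in> borel_measurable (cross_measure j \<Otimes>\<^sub>M lborel)"
  proof (cases "k = j")
    case False
    then show ?thesis
      using measurable_compose[OF measurable_fst measurable_cross_component[OF False]] by simp
  qed simp
qed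

lemma measurable_join [measurable]:
  "(\<lambda>x. join j x s) \<in> borel_measurable (cross_measure j)"
  "(\<lambda>s. join j x s) \<in> borel_measurable borel"
proof -
  show "(\<lambda>x. join j x s) \<in> borel_measurable (cross_measure j)"
    unfolding join_def
  proof (rule borel_measurable_vec_lambda)
    fix k
    show "(\<lambda>x. if k = j then s else x k) \<in> borel_measurable (cross_measure j)"
      by (cases "k = j") (auto intro: measurable_cross_component)
  qed
  show "(\<lambda>s. join j x s) \<in> borel_measurable borel"
    unfolding join_def
  proof (rule borel_measurable_vec_lambda)
    fix k
    show "(\<lambda>s. if k = j then s else x k) \<in> borel_measurable borel"
      by (cases "k = j") auto
  qed
qed

text \<open>Lebesgue measure is determined by its values on boxes, and the preimage of a box under
  \<open>join\<close> is a planar box times an interval. Fubini in direction \<open>j\<close>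
  follows.\<close>

lemma lborel_eq_join:
  "(lborel :: (real^3) measure) = distr (cross_measure j \<Otimes>\<^sub>M lborel) borel (\<lambda>q. join j (fst q) (snd q))"
proof (rule lborel_eqI)
  fix l u :: "real^3"
  assume le: "\<And>b. b \<in> Basis \<Longrightarrow> l \<bullet> b \<le> u \<bullet> b"
  have lu: "l $ k \<le> u $ k" for k using le[of "axis k 1"] by (simp add: inner_axis Basis_cart)
  let ?Q = "Pi\<^sub>E (UNIV - {j}) (\<lambda>k. {l $ k<..<u $ k})"
  have vim: "(\<lambda>q. join j (fst q) (snd q)) -` box l u \<inter> space (cross_measure j \<Otimes>\<^sub>M lborel) = ?Q \<times> {l $ j<..<u $ j}"
  proof (rule set_eqI)
    fix q :: "(3 \<Rightarrow> real) \<times> real"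
    obtain x s where q: "q = (x, s)" by (cases q)
    have "(\<forall>k. l $ k < join j x s $ k \<and> join j x s $ k < u $ k) \<longleftrightarrow>
        (l $ j < s \<and> s < u $ j) \<and> (\<forall>k\<in>UNIV - {j}. l $ k < x k \<and> x k < u $ k)"
      by auto
    then show "q \<in> (\<lambda>q. join j (fst q) (snd q)) -` box l u \<inter> space (cross_measure j \<Otimes>\<^sub>M lborel) \<longleftrightarrow>
        q \<in> ?Q \<times> {l $ j<..<u $ j}"
      unfolding q by (auto simp: space_pair_measure cross_measure_def space_PiM mem_box_cart PiE_iff)
  qed
  have "emeasure (distr (cross_measure j \<Otimes>\<^sub>M lborel) borel (\<lambda>q. join j (fst q) (snd q))) (box l u)
      = emeasure (cross_measure j \<Otimes>\<^sub>M lborel) (?Q \<times> {l $ j<..<u $ j})"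
    by (subst emeasure_distr) (auto simp: vim)
  also have "\<dots> = emeasure (cross_measure j) ?Q * emeasure lborel {l $ j<..<u $ j}"
    by (rule lborel.emeasure_pair_measure_Times) (auto simp: cross_measure_def intro!: sets_PiM_I_finite)
  also have "emeasure (cross_measure j) ?Q = (\<Prod>k\<in>UNIV - {j}. ennreal (u $ k - l $ k))"
    unfolding cross_measure_def using lu by (subst lborel_product.emeasure_PiM) auto
  also have "\<dots> * emeasure lborel {l $ j<..<u $ j} = (\<Prod>k\<in>UNIV. ennreal (u $ k - l $ k))"
    using lu by (simp add: prod.remove[of UNIV j] mult.commute)
  also have "\<dots> = (\<Prod>b\<in>Basis. (u - l) \<bullet> b)"
    using lu by (simp add: Basis_cart prod_ennreal prod.reindex inj_on_def axis_eq_axis inner_axis)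
  finally show "emeasure (distr (cross_measure j \<Otimes>\<^sub>M lborel) borel (\<lambda>q. join j (fst q) (snd q))) (box l u)
      = ennreal (\<Prod>b\<in>Basis. (u - l) \<bullet> b)" .
qed simp

lemma lborel_integral_join:
  fixes f :: "real^3 \<Rightarrow> 'b::{banach, second_countable_topology}"
  assumes "integrable lborel f"
  shows "(LINT p|lborel. f p) = (LINT x|cross_measure j. LINT s|lborel. f (join j x s))"
    and "integrable (cross_measure j) (\<lambda>x. LINT s|lborel. f (join j x s))"
proof -
  have [measurable]: "f \<in> borel_measurable borel" using assms by auto
  have i: "integrable (cross_measure j \<Otimes>\<^sub>M lborel) (\<lambda>q. f (join j (fst q) (snd q)))"
    using assms unfolding lborel_eq_join[of j] by (subst (asm) integrable_distr_eq) auto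
  have "(LINT p|lborel. f p) = (LINT q|(cross_measure j \<Otimes>\<^sub>M lborel). f (join j (fst q) (snd q)))"
    unfolding lborel_eq_join[of j] by (subst integral_distr) auto
  also have "\<dots> = (LINT x|cross_measure j. LINT s|lborel. f (join j x s))"
    using cross_pair.integral_fst'[OF i] by simp
  finally show "(LINT p|lborel. f p) = (LINT x|cross_measure j. LINT s|lborel. f (join j x s))" .
  show "integrable (cross_measure j) (\<lambda>x. LINT s|lborel. f (join j x s))"
    using cross_pair.integrable_fst'[OF i] by simp
qed

lemma AE_lborel_joinD:
  assumes "AE p in lborel. P p"
  shows "AE s in lborel. AE x in cross_measure j. P (join j x s)"
proof -
  obtain N where N: "N \<in> null_sets lborel" "{p. \<not> P p} \<subseteq> N"
    using assms by (auto elim!: AE_E simp: null_sets_def)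
  then have [measurable]: "N \<in> sets borel" by auto
  have "AE p in distr (cross_measure j \<Otimes>\<^sub>M lborel) borel (\<lambda>q. join j (fst q) (snd q)). p \<notin> N"
    by (subst lborel_eq_join[symmetric]) (rule AE_not_in[OF N(1)])
  moreover have "Measurable.pred (cross_measure j \<Otimes>\<^sub>M lborel) (\<lambda>q. join j (fst q) (snd q) \<notin> N)"
    by (rule measurable_compose[OF measurable_join_pair]) measurable
  then have P: "{q \<in> space (cross_measure j \<Otimes>\<^sub>M lborel). join j (fst q) (snd q) \<notin> N} \<in> sets (cross_measure j \<Otimes>\<^sub>M lborel)"
    by (simp add: pred_def)
  ultimately have "AE q in cross_measure j \<Otimes>\<^sub>M lborel. join j (fst q) (snd q) \<notin> N"
    by (subst (asm) AE_distr_iff[OF measurable_join_pair]) simp_all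
  then have "AE x in cross_measure j. AE s in lborel. join j x s \<notin> N"
    using cross_pair.AE_pair by fastforce
  then have "AE s in lborel. AE x in cross_measure j. join j x s \<notin> N"
    by (subst (asm) cross_pair.AE_commute[OF P])
  then show ?thesis using N(2) by (auto elim!: eventually_mono)
qed

text \<open>Tonelli's theorem turns null slices into a null set for a measurable set, hence the
  Borel premise.\<close>

lemma AE_lborel_joinI:
  assumes "{p. P p} \<in> sets borel" "AE s in lborel. AE x in cross_measure j. P (join j x s)"
  shows "AE p in lborel. P p"
proof -
  have [measurable]: "Measurable.pred borel P" using assms(1) by (simp add: pred_def)
  have "Measurable.pred (cross_measure j \<Otimes>\<^sub>M lborel) (\<lambda>q. P (join j (fst q) (snd q)))"
    by (rule measurable_compose[OF measurable_join_pair]) measurable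
  then have P: "{q \<in> space (cross_measure j \<Otimes>\<^sub>M lborel). P (join j (fst q) (snd q))} \<in> sets (cross_measure j \<Otimes>\<^sub>M lborel)"
    by (simp add: pred_def)
  have "AE x in cross_measure j. AE s in lborel. P (join j x s)"
    using assms(2) by (subst cross_pair.AE_commute[OF P])
  then have "AE q in cross_measure j \<Otimes>\<^sub>M lborel. P (join j (fst q) (snd q))"
    by (intro cross_pair.AE_pair_measure[OF P]) simp
  then show ?thesis
    unfolding lborel_eq_join[of j] by (subst AE_distr_iff[OF measurable_join_pair]) (use assms(1) in simp_all)
qed

text \<open>Fubini in direction \<open>j\<close> and the fundamental theorem of calculus on each
  line: the support is compact, so the boundary values vanish.\<close>

lemma integral_partial_derivative_zero:
  assumes t: "test_function_on UNIV \<psi> D\<psi>"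
  shows "(LINT p|lborel. D\<psi> p $ j) = 0" and "integrable lborel (\<lambda>p. D\<psi> p $ j)"
proof -
  obtain C where C: "compact C" "\<And>x. x \<notin> C \<Longrightarrow> \<psi> x = 0" "\<And>x. x \<notin> C \<Longrightarrow> D\<psi> x = 0"
    using test_function_support[OF t] by metis
  have cont: "continuous_on UNIV D\<psi>" using t by (simp add: test_function_on_def)
  have "integrable lborel (\<lambda>p. indicator C p *\<^sub>R (D\<psi> p $ j))"
    by (rule borel_integrable_compact[OF C(1)]) (intro continuous_on_component continuous_on_subset[OF cont] subset_UNIV)
  also have "(\<lambda>p. indicator C p *\<^sub>R (D\<psi> p $ j)) = (\<lambda>p. D\<psi> p $ j)"
    using C(3) by (auto simp: indicator_def fun_eq_iff)
  finally show i: "integrable lborel (\<lambda>p. D\<psi> p $ j)" .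
  obtain R where R: "R > 0" "\<And>x. x \<in> C \<Longrightarrow> norm x < R"
    using compact_imp_bounded[OF C(1)] bounded_pos_less[of C] by auto
  have "(LINT s|lborel. D\<psi> (join j x s) $ j) = 0" for x
  proof -
    have out: "join j x s \<notin> C" if "\<bar>s\<bar> \<ge> R" for s
      using R(2)[of "join j x s"] component_le_norm_cart[of "join j x s" j] that by auto
    have "(LINT s|lborel. D\<psi> (join j x s) $ j) = (LINT s|lborel. D\<psi> (join j x s) $ j * indicator {-R..R} s)"
    proof (rule Bochner_Integration.integral_cong[OF refl])
      fix s show "D\<psi> (join j x s) $ j = D\<psi> (join j x s) $ j * indicator {-R..R} s"
        using out[of s] C(3)[of "join j x s"] by (cases "R \<le> \<bar>s\<bar>") (auto simp: indicator_def)
    qed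
    also have "\<dots> = \<psi> (join j x R) - \<psi> (join j x (-R))"
    proof (rule integral_FTC_Icc_real)
      show "- R \<le> R" using R by simp
      fix s
      have jd: "(join j x has_derivative (\<lambda>h. h *\<^sub>R axis j 1)) (at s)"
      proof -
        have eq: "join j x = (\<lambda>s. join j x 0 + s *\<^sub>R axis j 1)"
          by (auto simp: fun_eq_iff vec_eq_iff axis_def)
        show ?thesis by (subst eq) (auto intro!: derivative_eq_intros)
      qed
      have "(\<psi> has_derivative (\<lambda>h. inner h (D\<psi> (join j x s)))) (at (join j x s))"
        using t by (simp add: test_function_on_def gderiv_def)
      from has_derivative_compose[OF jd this]
      show "((\<lambda>s. \<psi> (join j x s)) has_real_derivative D\<psi> (join j x s) $ j) (at s)"
        by (simp add: has_field_derivative_def inner_axis' mult_commute_abs)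
      have "isCont D\<psi> (join j x s)" using cont by (simp add: continuous_on_eq_continuous_at)
      from isCont_o2[OF has_derivative_continuous[OF jd] this]
      show "isCont (\<lambda>s. D\<psi> (join j x s) $ j) s" by (rule isCont_vec_nth)
    qed
    also have "\<dots> = 0" using out[of R] out[of "-R"] C(2) R by simp
    finally show ?thesis .
  qed
  then show "(LINT p|lborel. D\<psi> p $ j) = 0"
    using lborel_integral_join(1)[OF i, of j] by simp
qed

lemma AE_lebesgue_translation:
  assumes "AE y in lebesgue. P y"
  shows "AE y in lebesgue. P (y + a :: real^3)"
proof -
  have "AE y in lborel. P y" using assms by (simp add: AE_completion_iff)
  then obtain N where N: "N \<in> null_sets lborel" "{y. \<not> P y} \<subseteq> N"
    by (auto elim!: AE_E simp: null_sets_def)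
  have "{x. x - (- a) \<in> N} \<in> null_sets lborel" by (rule null_sets_translation[OF N(1)])
  then have "AE x in lborel. x + a \<notin> N" by (auto dest: AE_not_in)
  then have "AE x in lborel. P (x + a)" by eventually_elim (use N(2) in auto)
  then show ?thesis by (rule AE_completion)
qed

text \<open>Nothing is known about the measurability of \<open>f\<close>. By Fubini, almost every
  slice of \<open>n\<close> equals the constant \<open>f s\<close> almost everywhere, so the average
  over the cross-section \<open>Q\<close> recovers \<open>f s\<close> and depends measurably on
  \<open>s\<close>. Kernels and Lebesgue points call for such a bounded Borel profile.\<close>

lemma slice_function:
  fixes n :: "real^3 \<Rightarrow> real^3" and f :: "real \<Rightarrow> real^3"
  assumes ab: "\<And>k. a $ k < b $ k" and n: "set_integrable lebesgue (box a b) n"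
    and bd: "AE p in lebesgue. p \<in> box a b \<longrightarrow> norm (n p) \<le> 1"
    and f: "AE p in lebesgue. p \<in> box a b \<longrightarrow> n p = f (p $ j)"
  obtains F where "F \<in> borel_measurable borel" "\<And>s. norm (F s) \<le> 1"
    "AE p in lebesgue. p \<in> box a b \<longrightarrow> n p = F (p $ j)"
proof -
  \<comment> \<open>Fubini is applied to a Borel representative, because \<open>n\<close> is only
    Lebesgue measurable.\<close>
  obtain n' where n' [measurable]: "n' \<in> borel_measurable borel" and eq: "AE p in lborel. indicator (box a b) p *\<^sub>R n p = n' p"
    using completion_ex_borel_measurable_vec[of "\<lambda>p. indicator (box a b) p *\<^sub>R n p" lborel] n
    by (auto simp: set_integrable_def)
  define Q where "Q = Pi\<^sub>E (UNIV - {j}) (\<lambda>k. {a $ k<..<b $ k})"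
  have Qs [measurable]: "Q \<in> sets (cross_measure j)"
    unfolding Q_def cross_measure_def by (intro sets_PiM_I_finite) auto
  have "emeasure (cross_measure j) Q = (\<Prod>k\<in>UNIV - {j}. ennreal (b $ k - a $ k))"
    unfolding cross_measure_def Q_def using ab by (subst lborel_product.emeasure_PiM) (auto simp: less_imp_le)
  also have "\<dots> = ennreal (\<Prod>k\<in>UNIV - {j}. (b $ k - a $ k))"
    using ab by (intro prod_ennreal) (auto simp: less_imp_le)
  finally have em: "emeasure (cross_measure j) Q = ennreal (\<Prod>k\<in>UNIV - {j}. (b $ k - a $ k))" .
  have pos: "(\<Prod>k\<in>UNIV - {j}. (b $ k - a $ k)) > 0" using ab by (intro prod_pos) auto
  have mQ: "measure (cross_measure j) Q > 0" "emeasure (cross_measure j) Q \<noteq> 0" "emeasure (cross_measure j) Q \<noteq> \<infinity>"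
    unfolding measure_def em using pos by (simp_all add: ennreal_eq_0_iff)
  have box: "join j x s \<in> box a b \<longleftrightarrow> s \<in> {a $ j<..<b $ j}" if "x \<in> Q" for x s
    using that by (auto simp: mem_box_cart Q_def PiE_iff split: if_splits)
  have boxQ: "x \<in> Q" if "x \<in> space (cross_measure j)" "join j x s \<in> box a b" for x s
    using that by (auto simp: mem_box_cart Q_def PiE_iff cross_measure_def space_PiM split: if_splits)
  define F0 where "F0 s = (1 / measure (cross_measure j) Q) *\<^sub>R (LINT x|cross_measure j. indicator Q x *\<^sub>R n' (join j x s))" for s
  \<comment> \<open>Cutting off large values makes the bound hold for all \<open>s\<close>; by the
    bound on \<open>n\<close> only a null set of heights in the interval is affected.\<close>
  define F where "F s = (if norm (F0 s) \<le> 1 then F0 s else 0)" for s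
  have "(\<lambda>s. LINT x|cross_measure j. indicator Q x *\<^sub>R n' (join j x s)) \<in> borel_measurable borel"
  proof -
    have sw: "(\<lambda>q. join j (snd q) (fst q)) \<in> borel_measurable (lborel \<Otimes>\<^sub>M cross_measure j)"
      using measurable_compose[OF measurable_pair_swap' measurable_join_pair[of j]] by (simp add: split_beta)
    have "(\<lambda>(s, x). indicator Q x *\<^sub>R n' (join j x s)) \<in> borel_measurable (lborel \<Otimes>\<^sub>M cross_measure j)"
      unfolding split_beta using sw by measurable
    from sigma_finite_measure.borel_measurable_lebesgue_integral[OF sigma_finite_cross_measure this] show ?thesis by simp
  qed
  then have F0 [measurable]: "F0 \<in> borel_measurable borel" unfolding F0_def by measurable
  have Fm [measurable]: "F \<in> borel_measurable borel" unfolding F_def by measurable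
  have "AE p in lborel. p \<in> box a b \<longrightarrow> n p = f (p $ j)" "AE p in lborel. p \<in> box a b \<longrightarrow> norm (n p) \<le> 1"
    using f bd by (simp_all add: AE_completion_iff)
  with eq have "AE p in lborel. p \<in> box a b \<longrightarrow> n' p = f (p $ j) \<and> norm (n' p) \<le> 1"
  proof eventually_elim
    case (elim p) then show ?case by (cases "p \<in> box a b") auto
  qed
  from AE_lborel_joinD[OF this, of j]
  have ae: "AE s in lborel. AE x in cross_measure j. join j x s \<in> box a b \<longrightarrow> n' (join j x s) = f s \<and> norm (n' (join j x s)) \<le> 1"
    by simp
  have "AE s in lborel. AE x in cross_measure j. join j x s \<in> box a b \<longrightarrow> n' (join j x s) = F s"
    using ae
  proof eventually_elim
    case (elim s)
    show ?case
    proof (cases "s \<in> {a $ j<..<b $ j}")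
      case True
      have "AE x in cross_measure j. indicator Q x *\<^sub>R n' (join j x s) = indicator Q x *\<^sub>R f s"
        using elim by eventually_elim (use box True in \<open>auto simp: indicator_def\<close>)
      then have "(LINT x|cross_measure j. indicator Q x *\<^sub>R n' (join j x s)) = (LINT x|cross_measure j. indicator Q x *\<^sub>R f s)"
        by (intro integral_cong_AE) auto
      also have "\<dots> = measure (cross_measure j) Q *\<^sub>R f s"
        using set_integral_const[OF Qs mQ(3)] by (simp add: set_lebesgue_integral_def)
      finally have F0s: "F0 s = f s" using mQ(1) by (simp add: F0_def)
      have "norm (f s) \<le> 1"
      proof (rule ccontr)
        \<comment> \<open>Otherwise almost all of \<open>Q\<close> would be excluded, although
          \<open>Q\<close> has positive area.\<close>
        assume n: "\<not> norm (f s) \<le> 1"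
        have "AE x in cross_measure j. x \<notin> Q"
          using elim by eventually_elim (use n box True in auto)
        then have "Q \<in> null_sets (cross_measure j)" using Qs AE_iff_null_sets by blast
        then show False using mQ(2) by auto
      qed
      then have Fs: "F s = f s" by (simp add: F_def F0s)
      show ?thesis using elim by eventually_elim (simp add: Fs)
    next
      case False
      then show ?thesis using boxQ box by (intro AE_I2) (auto simp: mem_box_cart)
    qed
  qed
  then have "AE s in lborel. AE x in cross_measure j. join j x s \<in> box a b \<longrightarrow> n' (join j x s) = F (join j x s $ j)"
    by simp
  then have "AE p in lborel. p \<in> box a b \<longrightarrow> n' p = F (p $ j)"
    by (rule AE_lborel_joinI[rotated]) measurable
  with eq have "AE p in lborel. p \<in> box a b \<longrightarrow> n p = F (p $ j)"
    by eventually_elim auto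
  then have "AE p in lebesgue. p \<in> box a b \<longrightarrow> n p = F (p $ j)" by (rule AE_completion)
  moreover have "norm (F s) \<le> 1" for s by (simp add: F_def)
  ultimately show ?thesis using that Fm by blast
qed

section \<open>One-sided Lebesgue points\<close>

text \<open>One-sided, because the kernels \<open>step_kernel h c\<close> live on
  \<open>{c..c+h}\<close>.\<close>

definition right_lebesgue_point :: "(real \<Rightarrow> 'b::euclidean_space) \<Rightarrow> real \<Rightarrow> bool" where
  "right_lebesgue_point F c \<longleftrightarrow>
     ((\<lambda>h. (LINT s:{c..c+h}|lborel. norm (F s - F c)) / h) \<longlongrightarrow> 0) (at_right 0)"

text \<open>The left-hand condition is expressed by reflection, so that estimates are made for
  right-hand intervals only.\<close>

definition lebesgue_point :: "(real \<Rightarrow> 'b::euclidean_space) \<Rightarrow> real \<Rightarrow> bool" where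
  "lebesgue_point F c \<longleftrightarrow> right_lebesgue_point F c \<and> right_lebesgue_point (\<lambda>s. F (- s)) (- c)"

lemma set_integrable_interval_bounded:
  fixes F :: "real \<Rightarrow> 'b::euclidean_space"
  assumes [measurable]: "F \<in> borel_measurable borel" and "\<And>s. s \<in> {a..b} \<Longrightarrow> norm (F s) \<le> M"
  shows "set_integrable lborel {a..b} F"
  unfolding set_integrable_def
proof (rule Bochner_Integration.integrable_bound)
  show "integrable lborel (\<lambda>s. indicator {a..b} s *\<^sub>R \<bar>M\<bar>)"
    by (rule borel_integrable_compact) auto
  show "AE s in lborel. norm (indicator {a..b} s *\<^sub>R F s) \<le> norm (indicator {a..b} s *\<^sub>R \<bar>M\<bar>)"
    using assms(2) by (intro AE_I2) (force simp: indicator_def)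
qed measurable

lemma set_integral_interval_const: "h \<ge> 0 \<Longrightarrow> (LINT s:{c..c+h}|lborel. k) = h * (k::real)"
  by (subst set_integral_const) auto

text \<open>Averages of \<open>|F - F c|\<^sup>2\<close> are controlled by those of \<open>F\<close> and of \<open>|F|\<^sup>2\<close>, so it suffices to differentiate
  the integral of the pair \<open>(F, |F|\<^sup>2)\<close>.\<close>

lemma AE_right_lebesgue_point:
  fixes F :: "real \<Rightarrow> 'b::euclidean_space"
  assumes [measurable]: "F \<in> borel_measurable borel" and F: "\<And>s. norm (F s) \<le> M"
  shows "\<exists>N. negligible N \<and> (\<forall>c. c \<notin> N \<longrightarrow> right_lebesgue_point F c)"
proof -
  define f where "f s = (F s, F s \<bullet> F s)" for s
  have [measurable]: "f \<in> borel_measurable borel" unfolding f_def by measurable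
  have M: "0 \<le> M" using F[of 0] norm_ge_zero order_trans by blast
  have FM: "F s \<bullet> F s \<le> M\<^sup>2" for s using F[of s] by (simp add: dot_square_norm power_mono)
  have fb: "norm (f s) \<le> M + M\<^sup>2" for s
  proof -
    have "norm (f s) \<le> norm (F s) + norm (F s \<bullet> F s)" unfolding f_def by (rule norm_Pair_le)
    then show ?thesis using F[of s] FM[of s] by simp
  qed
  have fi: "set_integrable lborel {a..b} f" for a b
    by (rule set_integrable_interval_bounded[OF _ fb]) measurable
  then have "f integrable_on cbox a b" for a b
    using set_borel_integral_eq_integral(1)[OF fi] by (simp add: cbox_interval)
  from integrable_ccontinuous_explicit[OF this] obtain N where N: "negligible N"
    "\<And>x e. \<lbrakk>x \<notin> N; 0 < e\<rbrakk> \<Longrightarrow> \<exists>d>0. \<forall>h. 0 < h \<and> h < d \<longrightarrow>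
       norm (integral (cbox x (x + h *\<^sub>R One)) f /\<^sub>R h ^ DIM(real) - f x) < e"
    by metis
  have "right_lebesgue_point F c" if c: "c \<notin> N" for c
    unfolding right_lebesgue_point_def
  proof (rule tendstoI)
    fix e :: real assume e: "e > 0"
    \<comment> \<open>Chosen so that the mean square deviation, which will be at most
      \<open>\<epsilon> * (1 + 2 * M)\<close>, is at most \<open>e\<^sup>2 / 4\<close>.\<close>
    define \<epsilon> where "\<epsilon> = e\<^sup>2 / 4 / (1 + 2 * M)"
    have \<epsilon>: "\<epsilon> > 0" using e M by (simp add: \<epsilon>_def)
    obtain d where d: "d > 0" "\<And>h. 0 < h \<Longrightarrow> h < d \<Longrightarrow> norm (integral {c..c+h} f /\<^sub>R h - f c) < \<epsilon>"
      using N(2)[OF c \<epsilon>] by (auto simp: cbox_interval)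
    have "dist ((LINT s:{c..c+h}|lborel. norm (F s - F c)) / h) 0 < e" if h: "0 < h" "h < d" for h
    proof -
      let ?I = "{c..c+h}"
      have iF: "set_integrable lborel ?I F" by (rule set_integrable_interval_bounded[OF _ F]) measurable
      have iS: "set_integrable lborel ?I (\<lambda>s. F s \<bullet> F s)"
        by (rule set_integrable_interval_bounded[of _ _ _ "M\<^sup>2"]) (use FM in auto)
      have i1: "set_integrable lborel ?I (\<lambda>s. (norm (F s - F c))\<^sup>2)"
      proof (rule set_integrable_interval_bounded)
        fix s
        have "norm (F s - F c) \<le> 2 * M" using norm_triangle_ineq4[of "F s" "F c"] F[of s] F[of c] by linarith
        then show "norm ((norm (F s - F c))\<^sup>2) \<le> (2 * M)\<^sup>2"
          using power_mono[of "norm (F s - F c)" "2 * M" 2] by simp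
      qed measurable
      have i2: "set_integrable lborel ?I (\<lambda>s. norm (F s - F c))"
        by (intro set_integrable_norm set_integral_diff(1)[OF iF] set_integrable_interval_bounded[of _ _ _ "norm (F c)"]) auto
      have iC: "set_integrable lborel ?I (\<lambda>s. F c \<bullet> F c)"
        by (rule set_integrable_interval_bounded[of _ _ _ "norm (F c \<bullet> F c)"]) auto
      have "integrable lborel (\<lambda>s. 2 * ((indicator ?I s *\<^sub>R F s) \<bullet> F c))"
        using iF by (intro integrable_mult_right integrable_inner_left) (simp add: set_integrable_def)
      then have iX: "set_integrable lborel ?I (\<lambda>s. 2 * (F s \<bullet> F c))"
        by (simp add: set_integrable_def mult.left_commute)
      have iE: "set_integrable lborel ?I (\<lambda>s. e / 4)"
        by (rule set_integrable_interval_bounded[of _ _ _ "norm (e / 4)"]) auto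
      have iQ: "set_integrable lborel ?I (\<lambda>s. (norm (F s - F c))\<^sup>2 / e)"
        by (rule set_integrable_divide) (use i1 in simp)
      define J where "J = (LINT s:?I|lborel. F s) /\<^sub>R h"
      define S where "S = (LINT s:?I|lborel. F s \<bullet> F s) / h"
      have "integral ?I f = (LINT s:?I|lborel. f s)"
        using set_borel_integral_eq_integral(2)[OF fi] by simp
      also have "\<dots> = (LINT s:?I|lborel. F s, LINT s:?I|lborel. F s \<bullet> F s)"
        using integral_bounded_linear[OF bounded_linear_fst fi[unfolded set_integrable_def], of c "c+h"]
          integral_bounded_linear[OF bounded_linear_snd fi[unfolded set_integrable_def], of c "c+h"]
        by (simp add: set_lebesgue_integral_def f_def prod_eq_iff)
      finally have eq: "integral ?I f /\<^sub>R h - f c = (J - F c, S - F c \<bullet> F c)"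
        by (simp add: J_def S_def f_def divide_inverse mult.commute)
      have J: "norm (J - F c) < \<epsilon>" and S: "\<bar>S - F c \<bullet> F c\<bar> < \<epsilon>"
        using d(2)[OF h] norm_fst_le[of "J - F c" "S - F c \<bullet> F c"] norm_snd_le[of "S - F c \<bullet> F c" "J - F c"]
        unfolding eq by auto
      \<comment> \<open>Expanding the square leaves only the averages \<open>J\<close> and
        \<open>S\<close> of the differentiated pair.\<close>
      have "(LINT s:?I|lborel. (norm (F s - F c))\<^sup>2) = (LINT s:?I|lborel. F s \<bullet> F s - (2 * (F s \<bullet> F c) - F c \<bullet> F c))"
        by (intro set_lebesgue_integral_cong) (auto simp: power2_norm_eq_inner inner_diff_left inner_diff_right inner_commute)
      also have "\<dots> = (LINT s:?I|lborel. F s \<bullet> F s) - (LINT s:?I|lborel. 2 * (F s \<bullet> F c) - F c \<bullet> F c)"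
        by (rule set_integral_diff(2)[OF iS set_integral_diff(1)[OF iX iC]])
      also have "(LINT s:?I|lborel. 2 * (F s \<bullet> F c) - F c \<bullet> F c) = (LINT s:?I|lborel. 2 * (F s \<bullet> F c)) - h * (F c \<bullet> F c)"
        using h set_integral_diff(2)[OF iX iC] by (simp add: set_integral_interval_const)
      also have "(LINT s:?I|lborel. 2 * (F s \<bullet> F c)) = 2 * ((LINT s:?I|lborel. F s) \<bullet> F c)"
        using iF by (simp add: set_lebesgue_integral_def set_integrable_def flip: integral_inner_left)
      finally have "(LINT s:?I|lborel. (norm (F s - F c))\<^sup>2) / h = S - 2 * (J \<bullet> F c) + F c \<bullet> F c"
        using h by (simp add: S_def J_def field_simps)
      also have "\<dots> = (S - F c \<bullet> F c) - 2 * ((J - F c) \<bullet> F c)" by (simp add: inner_diff_left)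
      also have "\<dots> \<le> \<epsilon> + 2 * (\<epsilon> * M)"
      proof -
        have "\<bar>(J - F c) \<bullet> F c\<bar> \<le> norm (J - F c) * norm (F c)" by (rule Cauchy_Schwarz_ineq2)
        also have "\<dots> \<le> \<epsilon> * M" using J F[of c] \<epsilon> by (intro mult_mono) auto
        finally show ?thesis using S by linarith
      qed
      also have "\<dots> = \<epsilon> * (1 + 2 * M)" by (simp add: algebra_simps)
      also have "\<dots> = e\<^sup>2 / 4" using nonzero_eq_divide_eq[of "1 + 2 * M" \<epsilon> "e\<^sup>2 / 4"] M by (simp add: \<epsilon>_def)
      finally have sq: "(LINT s:?I|lborel. (norm (F s - F c))\<^sup>2) / h \<le> e\<^sup>2 / 4" .
      \<comment> \<open>From mean square to mean by \<open>x \<le> e / 4 + x\<^sup>2 / e\<close>, a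
        substitute for Cauchy-Schwarz; both contributions are then at most
        \<open>e / 4\<close>.\<close>
      have "(LINT s:?I|lborel. norm (F s - F c)) \<le> (LINT s:?I|lborel. e / 4 + (norm (F s - F c))\<^sup>2 / e)"
      proof (rule set_integral_mono[OF i2])
        show "set_integrable lborel ?I (\<lambda>s. e / 4 + (norm (F s - F c))\<^sup>2 / e)"
          by (rule set_integral_add(1)[OF iE iQ])
        fix s
        have "0 \<le> (norm (F s - F c) - e / 2)\<^sup>2" by simp
        then have "norm (F s - F c) * e \<le> e\<^sup>2 / 4 + (norm (F s - F c))\<^sup>2" by (simp add: power2_eq_square algebra_simps)
        then show "norm (F s - F c) \<le> e / 4 + (norm (F s - F c))\<^sup>2 / e"
          using e by (simp add: field_simps power2_eq_square)
      qed
      also have "\<dots> = h * (e / 4) + (LINT s:?I|lborel. (norm (F s - F c))\<^sup>2) / e"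
        using h set_integral_add(2)[OF iE iQ] by (simp add: set_integral_interval_const)
      finally have "(LINT s:?I|lborel. norm (F s - F c)) / h \<le> e / 4 + ((LINT s:?I|lborel. (norm (F s - F c))\<^sup>2) / h) / e"
        using h by (simp add: field_simps)
      also have "\<dots> \<le> e / 4 + (e\<^sup>2 / 4) / e" using sq e by (intro add_left_mono divide_right_mono) auto
      also have "\<dots> < e" using e by (simp add: power2_eq_square)
      finally have "(LINT s:?I|lborel. norm (F s - F c)) / h < e" .
      moreover have "0 \<le> (LINT s:?I|lborel. norm (F s - F c)) / h"
        using h unfolding set_lebesgue_integral_def
        by (intro divide_nonneg_nonneg Bochner_Integration.integral_nonneg) auto
      ultimately show ?thesis by simp
    qed
    then show "\<forall>\<^sub>F h in at_right 0. dist ((LINT s:{c..c+h}|lborel. norm (F s - F c)) / h) 0 < e"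
      using eventually_at_right_real[OF d(1)] by (auto elim!: eventually_mono)
  qed
  then show ?thesis using N(1) by blast
qed

text \<open>Left-hand Lebesgue points of \<open>F\<close> are right-hand ones of the reflected
  function, and reflection preserves negligible sets.\<close>

lemma negligible_not_lebesgue_point:
  fixes F :: "real \<Rightarrow> 'b::euclidean_space"
  assumes [measurable]: "F \<in> borel_measurable borel" and F: "\<And>s. norm (F s) \<le> M"
  shows "negligible {c. \<not> lebesgue_point F c}"
proof -
  obtain N1 where N1: "negligible N1" "\<And>c. c \<notin> N1 \<Longrightarrow> right_lebesgue_point F c"
    using AE_right_lebesgue_point[OF assms] by blast
  obtain N2 where N2: "negligible N2" "\<And>c. c \<notin> N2 \<Longrightarrow> right_lebesgue_point (\<lambda>s. F (- s)) c"
    using AE_right_lebesgue_point[of "\<lambda>s. F (- s)" M] F by auto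
  have "negligible (uminus ` N2)"
    by (rule negligible_differentiable_image_negligible[OF _ N2(1)])
      (auto intro!: linear_imp_differentiable_on linear_uminus)
  then have "negligible (N1 \<union> uminus ` N2)" using N1(1) by simp
  moreover have "{c. \<not> lebesgue_point F c} \<subseteq> N1 \<union> uminus ` N2"
  proof
    fix c assume "c \<in> {c. \<not> lebesgue_point F c}"
    then have "c \<in> N1 \<or> - c \<in> N2" using N1(2)[of c] N2(2)[of "- c"] unfolding lebesgue_point_def by auto
    then show "c \<in> N1 \<union> uminus ` N2" using image_eqI[of c uminus "- c" N2] by auto
  qed
  ultimately show ?thesis by (rule negligible_subset)
qed

text \<open>The intervals \<open>{c+h/2..c+h}\<close> are the shadows of the corner cubes, which
  stay away from the face. Being half of \<open>{c..c+h}\<close>, they inherit the Lebesgue point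
  property up to a factor 2.\<close>

lemma right_lebesgue_point_unique:
  fixes F :: "real \<Rightarrow> 'b::euclidean_space"
  assumes [measurable]: "F \<in> borel_measurable borel" and F: "\<And>s. norm (F s) \<le> M"
    and c: "right_lebesgue_point F c"
    and \<zeta>: "((\<lambda>h. (LINT s:{c+h/2..c+h}|lborel. norm (F s - \<zeta>)) / h) \<longlongrightarrow> 0) (at_right 0)"
  shows "F c = \<zeta>"
proof -
  have i: "set_integrable lborel {p..q} (\<lambda>s. norm (F s - z))" for p q z
  proof (rule set_integrable_interval_bounded)
    fix s show "norm (norm (F s - z)) \<le> M + norm z"
      using norm_triangle_ineq4[of "F s" z] F[of s] by simp
  qed measurable
  have "((\<lambda>h. norm (F c - \<zeta>)) \<longlongrightarrow> 0) (at_right (0::real))"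
  proof (rule tendsto_0_at_right_squeeze[of 1])
    fix h :: real assume h: "0 < h"
    let ?I = "{c+h/2..c+h}"
    have "(h / 2) * norm (F c - \<zeta>) = (LINT s:?I|lborel. norm (F c - \<zeta>))"
      using h by (subst set_integral_const) auto
    also have "\<dots> \<le> (LINT s:?I|lborel. norm (F s - F c) + norm (F s - \<zeta>))"
    proof (rule set_integral_mono)
      show "set_integrable lborel ?I (\<lambda>s. norm (F c - \<zeta>))"
        by (rule set_integrable_interval_bounded[of _ _ _ "norm (F c - \<zeta>)"]) auto
      fix s show "norm (F c - \<zeta>) \<le> norm (F s - F c) + norm (F s - \<zeta>)"
        using norm_triangle_ineq4[of "F s - \<zeta>" "F s - F c"] by (simp add: algebra_simps)
    qed (intro set_integral_add(1) i)
    also have "\<dots> = (LINT s:?I|lborel. norm (F s - F c)) + (LINT s:?I|lborel. norm (F s - \<zeta>))"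
      by (intro set_integral_add(2) i)
    also have "(LINT s:?I|lborel. norm (F s - F c)) \<le> (LINT s:{c..c+h}|lborel. norm (F s - F c))"
      by (rule set_integral_mono_set[OF i]) (use h in auto)
    finally show "norm (F c - \<zeta>) \<le> 2 * ((LINT s:{c..c+h}|lborel. norm (F s - F c)) / h + (LINT s:?I|lborel. norm (F s - \<zeta>)) / h)"
      using h by (simp add: field_simps)
  next
    show "((\<lambda>h. 2 * ((LINT s:{c..c+h}|lborel. norm (F s - F c)) / h + (LINT s:{c+h/2..c+h}|lborel. norm (F s - \<zeta>)) / h)) \<longlongrightarrow> 0) (at_right 0)"
      using tendsto_mult_right_zero[OF tendsto_add_zero[OF c[unfolded right_lebesgue_point_def] \<zeta>], of 2] by simp
  qed simp_all
  then show ?thesis by (simp add: tendsto_const_iff)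
qed

text \<open>Continuous \<open>A\<close> and \<open>B\<close> only add an error that vanishes at
  \<open>c\<close>. Applied along a line normal to a face, with \<open>A\<close> the test function
  and \<open>B\<close> minus its product with a component of \<open>v\<close>.\<close>

lemma right_lebesgue_point_mult_add:
  fixes F A B :: "real \<Rightarrow> real"
  assumes [measurable]: "F \<in> borel_measurable borel" and F: "\<And>s. \<bar>F s\<bar> \<le> M"
    and c: "right_lebesgue_point F c" and A: "continuous_on UNIV A" and B: "continuous_on UNIV B"
  shows "right_lebesgue_point (\<lambda>s. F s * A s + B s) c"
proof -
  have [measurable]: "A \<in> borel_measurable borel" "B \<in> borel_measurable borel"
    using A B by (auto intro: borel_measurable_continuous_onI)
  have M: "0 \<le> M" using F[of 0] by linarith
  have "bounded (A ` {c..c+1})"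
    by (intro compact_imp_bounded compact_continuous_image continuous_on_subset[OF A]) auto
  then obtain a where "\<forall>s\<in>{c..c+1}. \<bar>A s\<bar> \<le> a" unfolding bounded_iff by auto
  then have a: "\<And>s. s \<in> {c..c+1} \<Longrightarrow> \<bar>A s\<bar> \<le> a" by blast
  have a0: "0 \<le> a" using a[of c] by simp
  \<comment> \<open>The part of the error due to \<open>A\<close> and \<open>B\<close>: continuous
    with \<open>K c = 0\<close>, so its averages tend to 0.\<close>
  define K where "K s = M * \<bar>A s - A c\<bar> + \<bar>B s - B c\<bar>" for s
  have Kc: "continuous_on UNIV K" unfolding K_def by (intro continuous_intros A B)
  have K0: "((\<lambda>h. (LINT s:{c..c+h}|lborel. K s) / h) \<longlongrightarrow> 0) (at_right 0)"
  proof (rule tendstoI)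
    fix e :: real assume e: "e > 0"
    have "isCont K c" using Kc by (simp add: continuous_on_eq_continuous_at)
    then obtain d where d: "d > 0" "\<And>s. dist s c < d \<Longrightarrow> dist (K s) (K c) < e / 2"
      using e unfolding continuous_at_eps_delta by (meson half_gt_zero)
    have "dist ((LINT s:{c..c+h}|lborel. K s) / h) 0 < e" if h: "0 < h" "h < d" for h
    proof -
      have K: "0 \<le> K s" "K s \<le> e / 2" if "s \<in> {c..c+h}" for s
        using d(2)[of s] that h M by (auto simp: K_def dist_real_def)
      have "(LINT s:{c..c+h}|lborel. K s) \<le> (LINT s:{c..c+h}|lborel. e / 2)"
        using K by (intro set_integral_mono set_integrable_interval_bounded[of _ _ _ "e / 2"]) (use e in \<open>auto simp: K_def\<close>)
      then have "(LINT s:{c..c+h}|lborel. K s) / h \<le> e / 2"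
        using h by (simp add: set_integral_interval_const field_simps)
      moreover have "0 \<le> (LINT s:{c..c+h}|lborel. K s) / h"
        using h K unfolding set_lebesgue_integral_def
        by (intro divide_nonneg_nonneg Bochner_Integration.integral_nonneg) (auto simp: indicator_def)
      ultimately show ?thesis using e unfolding dist_real_def by linarith
    qed
    then show "\<forall>\<^sub>F h in at_right 0. dist ((LINT s:{c..c+h}|lborel. K s) / h) 0 < e"
      using eventually_at_right_real[OF d(1)] by (auto elim!: eventually_mono)
  qed
  show ?thesis
    unfolding right_lebesgue_point_def
  proof (rule tendsto_0_at_right_squeeze[of 1])
    fix h :: real assume h: "0 < h" "h < 1"
    show "0 \<le> (LINT s:{c..c+h}|lborel. norm (F s * A s + B s - (F c * A c + B c))) / h"
      using h unfolding set_lebesgue_integral_def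
      by (intro divide_nonneg_nonneg Bochner_Integration.integral_nonneg) auto
    have iF: "set_integrable lborel {c..c+h} (\<lambda>s. a * norm (F s - F c))"
    proof (rule set_integrable_interval_bounded)
      fix s show "norm (a * norm (F s - F c)) \<le> a * (2 * M)"
        using a0 F[of s] F[of c] by (auto simp: abs_mult intro!: mult_left_mono)
    qed measurable
    have iK: "set_integrable lborel {c..c+h} K"
      unfolding set_integrable_def by (rule borel_integrable_compact) (auto intro: continuous_on_subset[OF Kc])
    have bd: "norm (F s * A s + B s - (F c * A c + B c)) \<le> a * norm (F s - F c) + K s" if s: "s \<in> {c..c+h}" for s
    proof -
      have "F s * A s + B s - (F c * A c + B c) = A s * (F s - F c) + (F c * (A s - A c) + (B s - B c))"
        by (simp add: algebra_simps)
      then have "norm (F s * A s + B s - (F c * A c + B c)) \<le> \<bar>A s\<bar> * \<bar>F s - F c\<bar> + (\<bar>F c\<bar> * \<bar>A s - A c\<bar> + \<bar>B s - B c\<bar>)"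
        by (metis (no_types, opaque_lifting) abs_mult abs_triangle_ineq add_left_mono order_trans real_norm_def)
      also have "\<dots> \<le> a * \<bar>F s - F c\<bar> + (M * \<bar>A s - A c\<bar> + \<bar>B s - B c\<bar>)"
        using a[of s] F[of c] s h by (intro add_mono mult_right_mono) auto
      finally show ?thesis by (simp add: K_def)
    qed
    have "(LINT s:{c..c+h}|lborel. norm (F s * A s + B s - (F c * A c + B c))) \<le> (LINT s:{c..c+h}|lborel. a * norm (F s - F c) + K s)"
      unfolding set_lebesgue_integral_def
    proof (rule integral_mono')
      show "integrable lborel (\<lambda>s. indicator {c..c+h} s *\<^sub>R (a * norm (F s - F c) + K s))"
        using set_integral_add(1)[OF iF iK] by (simp add: set_integrable_def)
      fix s
      show "indicator {c..c+h} s *\<^sub>R norm (F s * A s + B s - (F c * A c + B c)) \<le> indicator {c..c+h} s *\<^sub>R (a * norm (F s - F c) + K s)"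
        using bd[of s] by (cases "s \<in> {c..c+h}") auto
      show "0 \<le> indicator {c..c+h} s *\<^sub>R (a * norm (F s - F c) + K s)"
        using a0 M by (auto simp: K_def)
    qed
    also have "\<dots> = a * (LINT s:{c..c+h}|lborel. norm (F s - F c)) + (LINT s:{c..c+h}|lborel. K s)"
      using set_integral_add(2)[OF iF iK] by simp
    finally show "(LINT s:{c..c+h}|lborel. norm (F s * A s + B s - (F c * A c + B c))) / h
        \<le> a * ((LINT s:{c..c+h}|lborel. norm (F s - F c)) / h) + (LINT s:{c..c+h}|lborel. K s) / h"
      using h by (simp add: field_simps)
  next
    show "((\<lambda>h. a * ((LINT s:{c..c+h}|lborel. norm (F s - F c)) / h) + (LINT s:{c..c+h}|lborel. K s) / h) \<longlongrightarrow> 0) (at_right 0)"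
      using tendsto_add[OF tendsto_mult_right_zero[OF c[unfolded right_lebesgue_point_def], of a] K0] by simp
  qed simp
qed

section \<open>Cutoff functions\<close>

text \<open>The cubic Hermite step, extended by constants. It is continuously differentiable, which
  is the regularity that \<open>test_function_on\<close> demands.\<close>

definition smoothstep :: "real \<Rightarrow> real" where
  "smoothstep x = (let c = max 0 (min 1 x) in 3 * c^2 - 2 * c^3)"

definition smoothstep_deriv :: "real \<Rightarrow> real" where
  "smoothstep_deriv x = (let c = max 0 (min 1 x) in 6 * c * (1 - c))"

lemma smoothstep_simps [simp]:
  "x \<le> 0 \<Longrightarrow> smoothstep x = 0" "1 \<le> x \<Longrightarrow> smoothstep x = 1"
  "x \<le> 0 \<Longrightarrow> smoothstep_deriv x = 0" "1 \<le> x \<Longrightarrow> smoothstep_deriv x = 0"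
  by (auto simp: smoothstep_def smoothstep_deriv_def)

lemma smoothstep_mid:
  "0 \<le> x \<Longrightarrow> x \<le> 1 \<Longrightarrow> smoothstep x = 3 * x^2 - 2 * x^3"
  "0 \<le> x \<Longrightarrow> x \<le> 1 \<Longrightarrow> smoothstep_deriv x = 6 * x * (1 - x)"
  by (auto simp: smoothstep_def smoothstep_deriv_def)

lemma smoothstep_bounds: "0 \<le> smoothstep x" "smoothstep x \<le> 1"
  "0 \<le> smoothstep_deriv x" "smoothstep_deriv x \<le> 6"
proof -
  define c where "c = max 0 (min 1 x)"
  have c: "0 \<le> c" "c \<le> 1" by (auto simp: c_def)
  have "3 * c^2 - 2 * c^3 = c^2 * (3 - 2 * c)" "1 - (3 * c^2 - 2 * c^3) = (1 - c)^2 * (1 + 2 * c)"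
    by (simp_all add: power2_eq_square power3_eq_cube algebra_simps)
  moreover have "c^2 * (3 - 2 * c) \<ge> 0" "(1 - c)^2 * (1 + 2 * c) \<ge> 0" using c by (auto intro!: mult_nonneg_nonneg)
  moreover have "smoothstep x = 3 * c^2 - 2 * c^3" by (simp add: smoothstep_def Let_def c_def)
  ultimately show "0 \<le> smoothstep x" "smoothstep x \<le> 1" by linarith+
  have "c * (1 - c) \<ge> 0" using c by (intro mult_nonneg_nonneg) auto
  moreover have "c * (1 - c) \<le> 1" using c by (intro mult_le_one) auto
  moreover have "smoothstep_deriv x = 6 * (c * (1 - c))" by (simp add: smoothstep_deriv_def Let_def c_def)
  ultimately show "0 \<le> smoothstep_deriv x" "smoothstep_deriv x \<le> 6" by linarith+
qed

lemma continuous_smoothstep_deriv: "continuous_on UNIV smoothstep_deriv"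
  unfolding smoothstep_deriv_def Let_def by (intro continuous_intros)

text \<open>Serves the two gluing points of \<open>smoothstep\<close>, where the function departs
  from its constant value only quadratically.\<close>

lemma DERIV_zero_of_quadratic:
  fixes f :: "real \<Rightarrow> real"
  assumes "\<And>y. \<bar>f y - f x\<bar> \<le> C * (y - x)^2"
  shows "(f has_real_derivative 0) (at x)"
proof -
  have "((\<lambda>y. (f y - f x) / (y - x)) \<longlongrightarrow> 0) (at x)"
  proof (rule Lim_null_comparison)
    show "\<forall>\<^sub>F y in at x. norm ((f y - f x) / (y - x)) \<le> C * \<bar>y - x\<bar>"
      unfolding eventually_at_filter
    proof (intro always_eventually allI impI)
      fix y assume "y \<noteq> x"
      then show "norm ((f y - f x) / (y - x)) \<le> C * \<bar>y - x\<bar>"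
        using assms[of y] by (simp add: divide_le_eq power2_eq_square abs_mult_self mult.assoc)
    qed
    show "((\<lambda>y. C * \<bar>y - x\<bar>) \<longlongrightarrow> 0) (at x)" by (auto intro!: tendsto_eq_intros)
  qed
  then show ?thesis by (simp add: has_field_derivative_iff)
qed

lemma DERIV_smoothstep: "(smoothstep has_real_derivative smoothstep_deriv x) (at x)"
proof -
  have sq: "smoothstep y \<le> 3 * y^2" for y
  proof (cases "0 \<le> y \<and> y \<le> 1")
    case False
    show ?thesis
    proof (cases "y \<le> 0")
      case False
      then have "1 \<le> y^2" using \<open>\<not> (0 \<le> y \<and> y \<le> 1)\<close> by simp
      then show ?thesis using smoothstep_bounds(2)[of y] by linarith
    qed simp
  qed (simp add: smoothstep_mid)
  \<comment> \<open>This symmetry carries the quadratic estimate from the gluing point 0 to the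
    gluing point 1.\<close>
  have sym: "smoothstep (1 - y) = 1 - smoothstep y" for y
  proof (cases "0 \<le> y \<and> y \<le> 1")
    case True
    then show ?thesis by (simp add: smoothstep_mid power2_eq_square power3_eq_cube algebra_simps)
  qed (auto simp: not_le)
  consider "x < 0" | "x = 0" | "0 < x" "x < 1" | "x = 1" | "x > 1" by linarith
  then show ?thesis
  proof cases
    case 1
    have "((\<lambda>_. 0) has_real_derivative 0) (at x)" by simp
    then show ?thesis
      by (rule has_field_derivative_transform_within_open[of _ _ _ "{..<0}", THEN DERIV_cong]) (use 1 in auto)
  next
    case 2
    show ?thesis unfolding 2 using DERIV_zero_of_quadratic[of smoothstep 0 3] sq smoothstep_bounds(1) by simp
  next
    case 3
    have "((\<lambda>x. 3 * x^2 - 2 * x^3) has_real_derivative 6 * x * (1 - x)) (at x)"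
      by (auto intro!: derivative_eq_intros simp: algebra_simps power2_eq_square)
    then show ?thesis
      by (rule has_field_derivative_transform_within_open[of _ _ _ "{0<..<1}", THEN DERIV_cong])
        (use 3 in \<open>auto simp: smoothstep_mid\<close>)
  next
    case 4
    have "\<bar>smoothstep y - smoothstep 1\<bar> \<le> 3 * (y - 1)^2" for y
      using sq[of "1 - y"] sym[of y] smoothstep_bounds(2)[of y] by (simp add: power2_commute)
    then show ?thesis unfolding 4 using DERIV_zero_of_quadratic[of smoothstep 1 3] by simp
  next
    case 5
    have "((\<lambda>_. 1) has_real_derivative 0) (at x)" by simp
    then show ?thesis
      by (rule has_field_derivative_transform_within_open[of _ _ _ "{1<..}", THEN DERIV_cong]) (use 5 in auto)
  qed
qed

text \<open>An approximate identity with mass 1 and support in \<open>{c..c+h}\<close>. Through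
  these kernels the derivative of a cutoff concentrates on the faces.\<close>

definition step_kernel :: "real \<Rightarrow> real \<Rightarrow> real \<Rightarrow> real" where
  "step_kernel h c s = smoothstep_deriv ((s - c) / h) / h"

lemma DERIV_scaled_smoothstep:
  assumes "h > 0"
  shows "((\<lambda>s. smoothstep ((s - c) / h)) has_real_derivative step_kernel h c s) (at s)"
  unfolding step_kernel_def using assms
  by (auto intro!: DERIV_chain2[OF DERIV_smoothstep, THEN DERIV_cong] derivative_eq_intros)

lemma continuous_kernel: "h > 0 \<Longrightarrow> continuous_on UNIV (step_kernel h c)"
  unfolding step_kernel_def
  by (intro continuous_intros continuous_on_compose2[OF continuous_smoothstep_deriv]) auto

lemma borel_measurable_kernel [measurable]: "step_kernel h c \<in> borel_measurable borel"
proof -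
  have [measurable]: "smoothstep_deriv \<in> borel_measurable borel"
    using continuous_smoothstep_deriv by (rule borel_measurable_continuous_onI)
  show ?thesis unfolding step_kernel_def by measurable
qed

lemma kernel_bounds:
  assumes "h > 0"
  shows "0 \<le> step_kernel h c s" "step_kernel h c s \<le> 6 / h" "s \<notin> {c..c+h} \<Longrightarrow> step_kernel h c s = 0"
  using smoothstep_bounds(3,4)[of "(s - c) / h"] assms
  by (auto simp: step_kernel_def divide_right_mono field_simps not_le)

lemma kernel_integral:
  assumes "h > 0"
  shows "integrable lborel (step_kernel h c)" "(LINT s|lborel. step_kernel h c s) = 1"
proof -
  have kI: "step_kernel h c s = step_kernel h c s * indicator {c..c+h} s" for s
    using kernel_bounds(3)[OF assms, where c = c and s = s] by (auto simp: indicator_def)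
  have "(LINT s|lborel. step_kernel h c s * indicator {c..c+h} s) = smoothstep ((c + h - c) / h) - smoothstep ((c - c) / h)"
    by (rule integral_FTC_Icc_real[OF _ DERIV_scaled_smoothstep[OF assms]])
      (use assms continuous_kernel[OF assms, of c] in \<open>auto simp: continuous_on_eq_continuous_at\<close>)
  then show "(LINT s|lborel. step_kernel h c s) = 1" using kI assms by simp
  \<comment> \<open>A non-integrable function would have integral 0 instead of 1.\<close>
  then show "integrable lborel (step_kernel h c)" using not_integrable_integral_eq by fastforce
qed

lemma integrable_mult_kernel:
  assumes h: "h > 0" and [measurable]: "f \<in> borel_measurable borel" and f: "\<And>s. \<bar>f s\<bar> \<le> B"
  shows "integrable lborel (\<lambda>s. f s * step_kernel h c s)" "\<bar>LINT s|lborel. f s * step_kernel h c s\<bar> \<le> B"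
proof -
  have le: "norm (f s * step_kernel h c s) \<le> B * step_kernel h c s" for s
    using f[of s] kernel_bounds(1)[OF h, where c = c and s = s] by (simp add: abs_mult mult_right_mono)
  show i: "integrable lborel (\<lambda>s. f s * step_kernel h c s)"
  proof (rule Bochner_Integration.integrable_bound[OF integrable_mult_right[OF kernel_integral(1)[OF h, of c], of B]])
    show "AE s in lborel. norm (f s * step_kernel h c s) \<le> norm (B * step_kernel h c s)"
      by (intro AE_I2 order_trans[OF le]) simp
  qed measurable
  have "norm (LINT s|lborel. f s * step_kernel h c s) \<le> (LINT s|lborel. norm (f s * step_kernel h c s))"
    by (rule integral_norm_bound)
  also have "\<dots> \<le> (LINT s|lborel. B * step_kernel h c s)"
    by (rule integral_mono[OF integrable_norm[OF i] integrable_mult_right[OF kernel_integral(1)[OF h]] le])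
  finally show "\<bar>LINT s|lborel. f s * step_kernel h c s\<bar> \<le> B" using kernel_integral(2)[OF h] by simp
qed

text \<open>Since the kernel has mass 1, height at most \<open>6 / h\<close> and support in
  \<open>{c..c+h}\<close>, the error is at most 6 times the average of
  \<open>|g - g c|\<close>.\<close>

lemma kernel_limit:
  fixes g :: "real \<Rightarrow> real"
  assumes [measurable]: "g \<in> borel_measurable borel" and g: "\<And>s. \<bar>g s\<bar> \<le> M"
    and c: "right_lebesgue_point g c"
  shows "((\<lambda>h. LINT s|lborel. g s * step_kernel h c s) \<longlongrightarrow> g c) (at_right 0)"
proof -
  have "((\<lambda>h. \<bar>(LINT s|lborel. g s * step_kernel h c s) - g c\<bar>) \<longlongrightarrow> 0) (at_right 0)"
  proof (rule tendsto_0_at_right_squeeze[of 1])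
    fix h :: real assume h: "0 < h" "h < 1"
    note k = kernel_bounds[OF h(1), where c = c]
    have "(LINT s|lborel. g s * step_kernel h c s) - g c = (LINT s|lborel. g s * step_kernel h c s) - (LINT s|lborel. g c * step_kernel h c s)"
      using kernel_integral(2)[OF h(1)] by simp
    also have "\<dots> = (LINT s|lborel. (g s - g c) * step_kernel h c s)"
      using integrable_mult_kernel(1)[OF h(1), of g M] integrable_mult_kernel(1)[OF h(1), of "\<lambda>_. g c" "\<bar>g c\<bar>"] g
      by (subst Bochner_Integration.integral_diff[symmetric]) (auto simp: left_diff_distrib)
    finally have "\<bar>(LINT s|lborel. g s * step_kernel h c s) - g c\<bar> = norm (LINT s|lborel. (g s - g c) * step_kernel h c s)" by simp
    also have "\<dots> \<le> (LINT s|lborel. norm ((g s - g c) * step_kernel h c s))" by (rule integral_norm_bound)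
    also have "\<dots> \<le> (LINT s|lborel. (6 / h) * (indicator {c..c+h} s *\<^sub>R norm (g s - g c)))"
    proof (rule integral_mono')
      have "set_integrable lborel {c..c+h} (\<lambda>s. norm (g s - g c))"
      proof (rule set_integrable_interval_bounded)
        fix s show "norm (norm (g s - g c)) \<le> 2 * M" using g[of s] g[of c] by simp
      qed measurable
      then show "integrable lborel (\<lambda>s. (6 / h) * (indicator {c..c+h} s *\<^sub>R norm (g s - g c)))"
        by (simp add: set_integrable_def)
      fix s
      have "\<bar>g s - g c\<bar> * step_kernel h c s \<le> \<bar>g s - g c\<bar> * (6 / h)" using k(2)[of s] by (intro mult_left_mono) auto
      then show "norm ((g s - g c) * step_kernel h c s) \<le> (6 / h) * (indicator {c..c+h} s *\<^sub>R norm (g s - g c))"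
        using k(1)[of s] k(3)[of s] by (auto simp: indicator_def abs_mult mult.commute)
      show "0 \<le> (6 / h) * (indicator {c..c+h} s *\<^sub>R norm (g s - g c))" using h by auto
    qed
    also have "\<dots> = 6 * ((LINT s:{c..c+h}|lborel. norm (g s - g c)) / h)"
      by (simp add: set_lebesgue_integral_def)
    finally show "\<bar>(LINT s|lborel. g s * step_kernel h c s) - g c\<bar> \<le> 6 * ((LINT s:{c..c+h}|lborel. norm (g s - g c)) / h)" .
  next
    show "((\<lambda>h. 6 * ((LINT s:{c..c+h}|lborel. norm (g s - g c)) / h)) \<longlongrightarrow> 0) (at_right 0)"
      using tendsto_mult_right_zero[OF c[unfolded right_lebesgue_point_def], of 6] by simp
  qed simp_all
  then show ?thesis by (simp add: tendsto_rabs_zero_iff LIM_zero_iff)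
qed

definition window :: "real \<Rightarrow> real \<Rightarrow> real \<Rightarrow> real \<Rightarrow> real" where
  "window h a b s = smoothstep ((s - a) / h) - smoothstep ((s - b) / h)"

text \<open>A sequence of widths, since dominated convergence is used along sequences. All widths
  are at most 1, which keeps the supports in a fixed box.\<close>

definition mesh :: "nat \<Rightarrow> real" where "mesh n = inverse (real (Suc n))"

lemma mesh_bounds: "0 < mesh n" "mesh n \<le> 1"
  by (simp_all add: mesh_def inverse_le_1_iff)

lemma mesh_tendsto: "mesh \<longlonglongrightarrow> 0"
  unfolding mesh_def by (rule LIMSEQ_inverse_real_of_nat)

lemma filterlim_mesh: "filterlim mesh (at_right 0) sequentially"
  unfolding filterlim_at using mesh_tendsto mesh_bounds(1) by (auto simp: less_imp_neq[THEN not_sym])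

lemma borel_measurable_smoothstep [measurable]: "smoothstep \<in> borel_measurable borel"
  by (intro borel_measurable_continuous_onI continuous_at_imp_continuous_on ballI DERIV_isCont[OF DERIV_smoothstep])

lemma borel_measurable_window [measurable]: "window h a b \<in> borel_measurable borel"
  unfolding window_def by measurable

lemma DERIV_window:
  "h > 0 \<Longrightarrow> (window h a b has_real_derivative (step_kernel h a s - step_kernel h b s)) (at s)"
  unfolding window_def by (intro DERIV_diff DERIV_scaled_smoothstep)

lemma continuous_on_window: "h > 0 \<Longrightarrow> continuous_on S (window h a b)"
  by (intro continuous_at_imp_continuous_on ballI DERIV_isCont[OF DERIV_window])

lemma window_abs_le: "\<bar>window h a b s\<bar> \<le> 1"
  using smoothstep_bounds(1,2)[of "(s - a) / h"] smoothstep_bounds(1,2)[of "(s - b) / h"]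
  unfolding window_def by linarith

lemma window_eq_0: "h > 0 \<Longrightarrow> a \<le> b \<Longrightarrow> s \<le> a \<or> b + h \<le> s \<Longrightarrow> window h a b s = 0"
  by (auto simp: window_def divide_nonpos_pos pos_le_divide_eq)

lemma smoothstep_mesh_tendsto: "(\<lambda>n. smoothstep ((s - a) / mesh n)) \<longlonglongrightarrow> (if a < s then 1 else 0)"
proof (cases "a < s")
  case True
  then have "eventually (\<lambda>n. mesh n < s - a) sequentially"
    using order_tendstoD(2)[OF mesh_tendsto, of "s - a"] by simp
  then have "eventually (\<lambda>n. smoothstep ((s - a) / mesh n) = 1) sequentially"
  proof eventually_elim
    case (elim n)
    then show ?case using mesh_bounds(1)[of n] by (simp add: pos_le_divide_eq)
  qed
  then show ?thesis using True by (simp add: tendsto_eventually)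
next
  case False
  then have "smoothstep ((s - a) / mesh n) = 0" for n
    using mesh_bounds(1)[of n] by (simp add: divide_nonpos_pos)
  then show ?thesis using False by simp
qed

text \<open>The limit exists at every point because \<open>smoothstep 0 = 0\<close>: at
  \<open>s = a\<close> the first step vanishes, and at \<open>s = b\<close> the second one does.
  This singles out the half-open interval.\<close>

lemma window_mesh_tendsto:
  assumes "a < b"
  shows "(\<lambda>n. window (mesh n) a b s) \<longlonglongrightarrow> (if a < s \<and> s \<le> b then 1 else 0)"
proof -
  have "(\<lambda>n. window (mesh n) a b s) \<longlonglongrightarrow> (if a < s then 1 else 0) - (if b < s then 1 else 0)"
    unfolding window_def by (intro tendsto_diff smoothstep_mesh_tendsto)
  then show ?thesis using assms by (auto split: if_splits)
qed

section \<open>Product cutoffs of a box and their gradients\<close>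

lemma prod_if_one_zero:
  "finite A \<Longrightarrow> (\<Prod>k\<in>A. if P k then 1 else (0::real)) = (if \<forall>k\<in>A. P k then 1 else 0)"
  by (induction A rule: finite_induct) auto

lemma prod_abs_le_1:
  fixes f :: "'a \<Rightarrow> real"
  assumes "\<And>k. k \<in> A \<Longrightarrow> \<bar>f k\<bar> \<le> 1"
  shows "\<bar>\<Prod>k\<in>A. f k\<bar> \<le> 1"
  unfolding abs_prod by (rule prod_le_1) (use assms in auto)

text \<open>Half-open because the cutoffs converge to its indicator at every point. Dominated
  convergence is applied to \<mu> as well, which may charge Lebesgue null sets.\<close>

definition half_open_box :: "real^3 \<Rightarrow> real^3 \<Rightarrow> (real^3) set" where
  "half_open_box l u = {p. \<forall>k. l $ k < p $ k \<and> p $ k \<le> u $ k}"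

lemma half_open_box_borel [measurable]: "half_open_box l u \<in> sets borel"
proof -
  have "half_open_box l u = (\<Inter>k. {p. l $ k < p $ k \<and> p $ k \<le> u $ k})"
    by (auto simp: half_open_box_def)
  moreover have "{p::real^3. l $ k < p $ k \<and> p $ k \<le> u $ k} \<in> sets borel" for k by measurable
  ultimately show ?thesis by auto
qed

lemma half_open_box_subset: "box l u \<subseteq> half_open_box l u" "half_open_box l u \<subseteq> cbox l u"
  by (auto simp: half_open_box_def mem_box_cart less_imp_le)

definition cutoff :: "real^3 \<Rightarrow> real^3 \<Rightarrow> real \<Rightarrow> real^3 \<Rightarrow> real" where
  "cutoff l u h p = (\<Prod>k\<in>UNIV. window h (l $ k) (u $ k) (p $ k))"

text \<open>Component \<open>j\<close> by the product rule: kernels at the two faces normal to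
  \<open>j\<close>, times the windows of the other directions. In the limit it becomes the surface
  measure of the lower face minus that of the upper one.\<close>

definition cutoff_grad :: "real^3 \<Rightarrow> real^3 \<Rightarrow> real \<Rightarrow> real^3 \<Rightarrow> real^3" where
  "cutoff_grad l u h p = (\<chi> j. (step_kernel h (l $ j) (p $ j) - step_kernel h (u $ j) (p $ j)) *
      (\<Prod>k\<in>UNIV-{j}. window h (l $ k) (u $ k) (p $ k)))"

lemma borel_measurable_cutoff [measurable]: "cutoff l u h \<in> borel_measurable borel"
  unfolding cutoff_def by measurable

lemma cutoff_abs_le: "\<bar>cutoff l u h p\<bar> \<le> 1"
  unfolding cutoff_def by (intro prod_abs_le_1 window_abs_le)

lemma cutoff_tendsto:
  assumes "\<And>k. l $ k < u $ k"
  shows "(\<lambda>n. cutoff l u (mesh n) p) \<longlonglongrightarrow> indicator (half_open_box l u) p"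
proof -
  have "(\<lambda>n. cutoff l u (mesh n) p) \<longlonglongrightarrow> (\<Prod>k\<in>UNIV. if l $ k < p $ k \<and> p $ k \<le> u $ k then 1 else 0)"
    unfolding cutoff_def by (intro tendsto_prod window_mesh_tendsto assms)
  then show ?thesis by (simp add: prod_if_one_zero half_open_box_def indicator_def of_bool_def)
qed

lemma GDERIV_cutoff:
  assumes "h > 0"
  shows "GDERIV (cutoff l u h) p :> cutoff_grad l u h p"
proof -
  have "((\<lambda>p. \<Prod>k\<in>UNIV. window h (l $ k) (u $ k) (p $ k)) has_derivative
      (\<lambda>y. \<Sum>i\<in>UNIV. (y $ i * (step_kernel h (l $ i) (p $ i) - step_kernel h (u $ i) (p $ i))) *
         (\<Prod>k\<in>UNIV-{i}. window h (l $ k) (u $ k) (p $ k)))) (at p)"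
  proof (rule has_derivative_prod)
    fix i :: 3
    have "((\<lambda>p::real^3. p $ i) has_derivative (\<lambda>y. y $ i)) (at p)"
      by (rule bounded_linear_imp_has_derivative) (rule bounded_linear_vec_nth)
    from has_derivative_compose[OF this DERIV_window[OF assms, unfolded has_field_derivative_def]]
    show "((\<lambda>p. window h (l $ i) (u $ i) (p $ i)) has_derivative
        (\<lambda>y. y $ i * (step_kernel h (l $ i) (p $ i) - step_kernel h (u $ i) (p $ i)))) (at p)"
      by (simp add: mult.commute)
  qed
  then show ?thesis
    unfolding gderiv_def cutoff_def[abs_def] cutoff_grad_def by (simp add: inner_vec_def mult.assoc)
qed

lemma continuous_cutoff_grad: "h > 0 \<Longrightarrow> continuous_on UNIV (cutoff_grad l u h)"
  unfolding cutoff_grad_def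
  by (intro continuous_intros continuous_on_compose2[OF continuous_kernel] continuous_on_compose2[OF continuous_on_window])
    auto

lemma GDERIV_continuous_on:
  assumes "\<And>x. GDERIV \<psi> x :> D\<psi> x"
  shows "continuous_on UNIV \<psi>"
  using assms unfolding gderiv_def
  by (intro continuous_at_imp_continuous_on ballI) (rule has_derivative_continuous)

lemma test_function_on_mult:
  assumes t: "test_function_on U \<phi> D\<phi>" and \<psi>: "\<And>x. GDERIV \<psi> x :> D\<psi> x" "continuous_on UNIV D\<psi>"
  shows "test_function_on U (\<lambda>x. \<phi> x * \<psi> x) (\<lambda>x. \<phi> x *\<^sub>R D\<psi> x + \<psi> x *\<^sub>R D\<phi> x)"
proof -
  obtain C where C: "compact C" "C \<subseteq> U" "\<And>x. x \<notin> C \<Longrightarrow> \<phi> x = 0" "\<And>x. x \<notin> C \<Longrightarrow> D\<phi> x = 0"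
    using test_function_support[OF t] by metis
  show ?thesis
    unfolding test_function_on_def
  proof (intro conjI allI exI[of _ C] impI)
    fix x
    have "(\<phi> has_derivative (\<lambda>h. inner h (D\<phi> x))) (at x)" "(\<psi> has_derivative (\<lambda>h. inner h (D\<psi> x))) (at x)"
      using t \<psi>(1) by (auto simp: test_function_on_def gderiv_def)
    from has_derivative_mult[OF this]
    show "GDERIV (\<lambda>x. \<phi> x * \<psi> x) x :> \<phi> x *\<^sub>R D\<psi> x + \<psi> x *\<^sub>R D\<phi> x"
      by (simp add: gderiv_def inner_add_right mult.commute)
  next
    show "continuous_on UNIV (\<lambda>x. \<phi> x *\<^sub>R D\<psi> x + \<psi> x *\<^sub>R D\<phi> x)"
      using t by (intro continuous_intros test_function_continuous[OF t] GDERIV_continuous_on[OF \<psi>(1)] \<psi>(2))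
        (simp add: test_function_on_def)
  qed (use C in auto)
qed

lemma integrable_bounded_support:
  fixes f :: "real^3 \<Rightarrow> real"
  assumes [measurable]: "f \<in> borel_measurable borel" and "\<And>x. \<bar>f x\<bar> \<le> B" "bounded S" "\<And>x. x \<notin> S \<Longrightarrow> f x = 0"
  shows "integrable lborel f"
proof -
  obtain a b where ab: "S \<subseteq> cbox a b" using bounded_subset_cbox_symmetric[OF assms(3)] by metis
  show ?thesis
  proof (rule Bochner_Integration.integrable_bound)
    show "integrable lborel (\<lambda>x. indicator (cbox a b) x *\<^sub>R B)" by (rule borel_integrable_compact) auto
    show "AE x in lborel. norm (f x) \<le> norm (indicator (cbox a b) x *\<^sub>R B)"
    proof (intro AE_I2)
      fix x show "norm (f x) \<le> norm (indicator (cbox a b) x *\<^sub>R B)"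
        using assms(2)[of x] assms(4)[of x] ab by (cases "x \<in> cbox a b") auto
    qed
  qed measurable
qed

section \<open>Surface measure on the faces of a box\<close>

definition face_section :: "real^3 \<Rightarrow> real^3 \<Rightarrow> 3 \<Rightarrow> (3 \<Rightarrow> real) set" where
  "face_section l u j = Pi\<^sub>E (UNIV - {j}) (\<lambda>k. {l $ k<..<u $ k})"

text \<open>Planar Lebesgue measure on a face relatively open in the plane \<open>p $ j = c\<close>,
  pushed into space. Surface integrals thus come from Fubini, while \<open>hausdorff 2\<close>
  enters only through the area estimate.\<close>

definition face_measure :: "real^3 \<Rightarrow> real^3 \<Rightarrow> 3 \<Rightarrow> real \<Rightarrow> (real^3) measure" where
  "face_measure l u j c = distr (density (cross_measure j) (indicator (face_section l u j))) borel (\<lambda>x. join j x c)"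

lemma sets_PiE_cross [measurable]:
  "(\<And>k. A k \<in> sets borel) \<Longrightarrow> Pi\<^sub>E (UNIV - {j}) A \<in> sets (cross_measure j)"
  unfolding cross_measure_def by (intro sets_PiM_I_finite) auto

lemma face_section_sets [measurable]: "face_section l u j \<in> sets (cross_measure j)"
  unfolding face_section_def by (rule sets_PiE_cross) simp

lemma emeasure_cross_PiE:
  "(\<And>k. A k \<in> sets borel) \<Longrightarrow> emeasure (cross_measure j) (Pi\<^sub>E (UNIV - {j}) A) = (\<Prod>k\<in>UNIV-{j}. emeasure lborel (A k))"
  unfolding cross_measure_def by (subst lborel_product.emeasure_PiM) auto

lemma emeasure_cross_PiE_bounded:
  assumes "\<And>k. A k \<in> sets borel" "\<And>k. bounded (A k)"
  shows "emeasure (cross_measure j) (Pi\<^sub>E (UNIV - {j}) A) < \<infinity>"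
proof -
  have "emeasure lborel (A k) = ennreal (measure lborel (A k))" for k
    using emeasure_bounded_finite[OF assms(2)[of k]] by (intro emeasure_eq_ennreal_measure) simp
  then show ?thesis using assms(1) by (simp add: emeasure_cross_PiE prod_ennreal)
qed

lemma sets_face_measure [simp, measurable_cong]: "sets (face_measure l u j c) = sets borel"
  by (simp add: face_measure_def)

lemma finite_measure_face: "finite_measure (face_measure l u j c)"
proof (rule finite_measureI)
  have "emeasure (face_measure l u j c) (space (face_measure l u j c)) =
      emeasure (density (cross_measure j) (indicator (face_section l u j))) (space (cross_measure j))"
    unfolding face_measure_def by (subst emeasure_distr) (auto intro: measurable_join)
  also have "\<dots> = emeasure (cross_measure j) (face_section l u j)"
    using sets.sets_into_space[OF face_section_sets, of l u j]
    by (subst emeasure_density) (auto intro!: borel_measurable_indicator simp: nn_integral_indicator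
        cong: nn_integral_cong_simp)
  also have "\<dots> < \<infinity>" unfolding face_section_def by (rule emeasure_cross_PiE_bounded) auto
  finally show "emeasure (face_measure l u j c) (space (face_measure l u j c)) \<noteq> \<infinity>" by simp
qed

lemma integral_face_measure:
  fixes f :: "real^3 \<Rightarrow> real"
  assumes [measurable]: "f \<in> borel_measurable borel"
  shows "(LINT p|face_measure l u j c. f p) = (LINT x|cross_measure j. indicator (face_section l u j) x * f (join j x c))"
proof -
  have m: "(\<lambda>x. join j x c) \<in> density (cross_measure j) (indicator (face_section l u j)) \<rightarrow>\<^sub>M borel"
    using measurable_join(1) by simp
  have "(LINT p|face_measure l u j c. f p) =
      (LINT x|density (cross_measure j) (\<lambda>x. ennreal (indicator (face_section l u j) x)). f (join j x c))"
    unfolding face_measure_def using m by (subst integral_distr) (auto simp: ennreal_indicator)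
  also have "\<dots> = (LINT x|cross_measure j. indicator (face_section l u j) x *\<^sub>R f (join j x c))"
    by (rule integral_density) (auto intro: measurable_compose[OF measurable_join(1)])
  finally show ?thesis by simp
qed

lemma AE_face_measure:
  "AE p in face_measure l u j c. p $ j = c \<and> (\<forall>k. k \<noteq> j \<longrightarrow> l $ k < p $ k \<and> p $ k < u $ k)"
proof -
  have m: "(\<lambda>x. join j x c) \<in> density (cross_measure j) (indicator (face_section l u j)) \<rightarrow>\<^sub>M borel"
    using measurable_join(1) by simp
  have P: "{p \<in> space borel. p $ j = c \<and> (\<forall>k. k \<noteq> j \<longrightarrow> l $ k < p $ k \<and> p $ k < u $ k)} \<in> sets borel"
    by measurable
  show ?thesis
    unfolding face_measure_def
    by (subst AE_distr_iff[OF m P], subst AE_density)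
      (auto simp: indicator_def face_section_def PiE_iff intro!: borel_measurable_indicator face_section_sets)
qed

text \<open>In a product, one coordinate in a null set costs a factor 0, even though the other
  factor is infinite.\<close>

lemma AE_cross_notin:
  assumes k: "k \<noteq> j" and N: "N \<in> null_sets lborel"
  shows "AE x in cross_measure j. x k \<notin> N"
proof -
  let ?A = "\<lambda>i. if i = k then N else (UNIV :: real set)"
  have "emeasure (cross_measure j) (Pi\<^sub>E (UNIV - {j}) ?A) = (\<Prod>i\<in>UNIV-{j}. emeasure lborel (?A i))"
    using N by (intro emeasure_cross_PiE) auto
  also have "\<dots> = 0" using k N by (intro prod_zero bexI[of _ k]) auto
  finally have "Pi\<^sub>E (UNIV - {j}) ?A \<in> null_sets (cross_measure j)"
    using N by (auto simp: null_sets_def intro!: sets_PiE_cross)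
  then show ?thesis
    by (rule AE_I') (use k in \<open>auto simp: cross_measure_def space_PiM PiE_iff extensional_def split: if_splits\<close>)
qed

lemma AE_cross_neq: "k \<noteq> j \<Longrightarrow> AE x in cross_measure j. x k \<noteq> a"
  using AE_cross_notin[of k j "{a}"] by (simp add: null_sets_def)

text \<open>By Fubini, the kernel integral along the normal tends to the value of \<open>G\<close>
  on the face, by the Lebesgue point premise, while the remaining windows tend to the indicator of
  the face section. Dominated convergence in the cross-section combines the two limits.\<close>

lemma face_limit:
  fixes G :: "real^3 \<Rightarrow> real"
  assumes [measurable]: "G \<in> borel_measurable borel" and G: "\<And>p. \<bar>G p\<bar> \<le> M"
    and lu: "\<And>k. l $ k < u $ k" and c: "\<And>x. right_lebesgue_point (\<lambda>s. G (join j x s)) c"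
  shows "(\<lambda>n. LINT p|lborel. G p * step_kernel (mesh n) c (p $ j) * (\<Prod>k\<in>UNIV-{j}. window (mesh n) (l $ k) (u $ k) (p $ k)))
      \<longlonglongrightarrow> (LINT p|face_measure l u j c. G p)"
    and "integrable lborel (\<lambda>p. G p * step_kernel (mesh n) c (p $ j) * (\<Prod>k\<in>UNIV-{j}. window (mesh n) (l $ k) (u $ k) (p $ k)))"
proof -
  define X where "X n p = (\<Prod>k\<in>UNIV-{j}. window (mesh n) (l $ k) (u $ k) (p k))" for n p
  define f where "f n p = G p * step_kernel (mesh n) c (p $ j) * (\<Prod>k\<in>UNIV-{j}. window (mesh n) (l $ k) (u $ k) (p $ k))" for n p
  define A where "A n x = (LINT s|lborel. G (join j x s) * step_kernel (mesh n) c s)" for n x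
  have M: "0 \<le> M" using G[of 0] by linarith
  have X1: "\<bar>X n x\<bar> \<le> 1" for n x unfolding X_def by (intro prod_abs_le_1 window_abs_le)
  have X0: "X n x = 0" if "k \<noteq> j" "x k \<notin> {l $ k..u $ k + 1}" for n x k
    unfolding X_def using that lu[of k] mesh_bounds[of n]
    by (intro prod_zero bexI[of _ k] window_eq_0) auto
  have fi: "integrable lborel (f n)" for n
  proof (rule integrable_bounded_support)
    show "f n \<in> borel_measurable borel" unfolding f_def by measurable
    fix p
    have "\<bar>f n p\<bar> = \<bar>G p\<bar> * \<bar>step_kernel (mesh n) c (p $ j)\<bar> * \<bar>X n (\<lambda>k. p $ k)\<bar>" by (simp add: f_def X_def abs_mult)
    also have "\<dots> \<le> M * (6 / mesh n) * 1"
      using G[of p] X1[of n "\<lambda>k. p $ k"] M mesh_bounds(1)[of n] kernel_bounds(1,2)[OF mesh_bounds(1), of n c "p $ j"]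
      by (intro mult_mono) auto
    finally show "\<bar>f n p\<bar> \<le> M * (6 / mesh n) * 1" .
    show "f n p = 0" if "p \<notin> cbox (\<chi> k. min (l $ k) c) (\<chi> k. max (u $ k) c + 1)"
    proof -
      obtain k where k: "p $ k < min (l $ k) c \<or> max (u $ k) c + 1 < p $ k"
        using \<open>p \<notin> _\<close> by (auto simp: mem_box_cart not_le)
      show ?thesis
      proof (cases "k = j")
        case True
        then have "step_kernel (mesh n) c (p $ j) = 0"
          using k mesh_bounds[of n] by (intro kernel_bounds(3)) auto
        then show ?thesis by (simp add: f_def)
      next
        case False
        then have "X n (\<lambda>k. p $ k) = 0" using k by (intro X0) auto
        then show ?thesis by (simp add: f_def X_def)
      qed
    qed
  qed (rule bounded_cbox)
  then show "integrable lborel (\<lambda>p. G p * step_kernel (mesh n) c (p $ j) * (\<Prod>k\<in>UNIV-{j}. window (mesh n) (l $ k) (u $ k) (p $ k)))"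
    by (simp add: f_def[abs_def])
  have inner: "(LINT s|lborel. f n (join j x s)) = A n x * X n x" for n x
  proof -
    have "f n (join j x s) = (G (join j x s) * step_kernel (mesh n) c s) * X n x" for s
      by (simp add: f_def X_def)
    then show ?thesis by (simp add: A_def)
  qed
  have mA: "(\<lambda>x. A n x * X n x) \<in> borel_measurable (cross_measure j)" for n
    using borel_measurable_integrable[OF lborel_integral_join(2)[OF fi[of n], of j]] by (simp add: inner)
  have mG: "(\<lambda>s. G (join j x s)) \<in> borel_measurable borel" for x
    by (rule measurable_compose[OF measurable_join(2)]) measurable
  \<comment> \<open>The room of size 1 beyond \<open>u\<close> contains the supports of all windows,
    as every \<open>mesh n\<close> is at most 1.\<close>
  define Q1 where "Q1 = Pi\<^sub>E (UNIV - {j}) (\<lambda>k. {l $ k..u $ k + 1})"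
  have Q1 [measurable]: "Q1 \<in> sets (cross_measure j)" unfolding Q1_def by (rule sets_PiE_cross) simp
  have Q1f: "emeasure (cross_measure j) Q1 < \<infinity>" unfolding Q1_def by (rule emeasure_cross_PiE_bounded) auto
  have "(\<lambda>n. LINT x|cross_measure j. A n x * X n x) \<longlonglongrightarrow>
      (LINT x|cross_measure j. indicator (face_section l u j) x * G (join j x c))"
  proof (rule integral_dominated_convergence[where w = "\<lambda>x. indicator Q1 x * M"])
    show "(\<lambda>x. indicator (face_section l u j) x * G (join j x c)) \<in> borel_measurable (cross_measure j)"
      by (intro borel_measurable_times borel_measurable_indicator face_section_sets measurable_compose[OF measurable_join(1)]) measurable
    show "integrable (cross_measure j) (\<lambda>x. indicator Q1 x * M)"
      using Q1f by (intro integrable_mult_left) (auto simp: integrable_indicator_iff)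
    \<comment> \<open>The windows converge to indicators of half-open intervals whereas the face
      section is open; the difference is null in the cross-section.\<close>
    have "AE x in cross_measure j. \<forall>k\<in>UNIV - {j}. x k \<noteq> u $ k"
      by (intro AE_finite_allI AE_cross_neq) auto
    then show "AE x in cross_measure j. (\<lambda>n. A n x * X n x) \<longlonglongrightarrow> indicator (face_section l u j) x * G (join j x c)"
      using AE_space
    proof eventually_elim
      case (elim x)
      have "(\<lambda>n. X n x) \<longlonglongrightarrow> (\<Prod>k\<in>UNIV-{j}. if l $ k < x k \<and> x k \<le> u $ k then 1 else 0)"
        unfolding X_def by (intro tendsto_prod window_mesh_tendsto lu)
      also have "(\<Prod>k\<in>UNIV-{j}. if l $ k < x k \<and> x k \<le> u $ k then 1 else (0::real)) = indicator (face_section l u j) x"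
      proof -
        have "(\<forall>k\<in>UNIV-{j}. l $ k < x k \<and> x k \<le> u $ k) \<longleftrightarrow> x \<in> face_section l u j"
          using elim by (auto simp: face_section_def PiE_iff cross_measure_def space_PiM less_le)
        then show ?thesis by (simp add: prod_if_one_zero indicator_def of_bool_def)
      qed
      finally have X: "(\<lambda>n. X n x) \<longlonglongrightarrow> indicator (face_section l u j) x" .
      have "(\<lambda>n. A n x) \<longlonglongrightarrow> G (join j x c)"
        unfolding A_def
        by (rule filterlim_compose[OF kernel_limit[OF mG G c] filterlim_mesh])
      from tendsto_mult[OF this X] show ?case by (simp add: mult.commute)
    qed
    show "AE x in cross_measure j. norm (A n x * X n x) \<le> indicator Q1 x * M" for n
    proof (rule AE_I2)
      fix x assume x: "x \<in> space (cross_measure j)"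
      have A: "\<bar>A n x\<bar> \<le> M" unfolding A_def by (rule integrable_mult_kernel(2)[OF mesh_bounds(1) mG G])
      show "norm (A n x * X n x) \<le> indicator Q1 x * M"
      proof (cases "x \<in> Q1")
        case True
        have "\<bar>A n x\<bar> * \<bar>X n x\<bar> \<le> M * 1" using A X1[of n x] M by (intro mult_mono) auto
        then show ?thesis using True by (simp add: abs_mult)
      next
        case False
        then obtain k where "k \<noteq> j" "x k \<notin> {l $ k..u $ k + 1}"
          using x by (auto simp: Q1_def PiE_iff cross_measure_def space_PiM)
        then show ?thesis using False by (simp add: X0)
      qed
    qed
  qed (rule mA)
  then have "(\<lambda>n. LINT p|lborel. f n p) \<longlonglongrightarrow> (LINT p|face_measure l u j c. G p)"
    by (simp add: lborel_integral_join(1)[OF fi, of _ j] inner integral_face_measure)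
  then show "(\<lambda>n. LINT p|lborel. G p * step_kernel (mesh n) c (p $ j) * (\<Prod>k\<in>UNIV-{j}. window (mesh n) (l $ k) (u $ k) (p $ k)))
      \<longlonglongrightarrow> (LINT p|face_measure l u j c. G p)"
    by (simp add: f_def)
qed

section \<open>The divergence theorem on a box for a slice function\<close>

lemma right_lebesgue_point_const: "right_lebesgue_point (\<lambda>s. k) c"
  by (simp add: right_lebesgue_point_def set_lebesgue_integral_def)

lemma right_lebesgue_point_component:
  fixes F :: "real \<Rightarrow> real^3"
  assumes [measurable]: "F \<in> borel_measurable borel" and F: "\<And>s. norm (F s) \<le> M" and c: "right_lebesgue_point F c"
  shows "right_lebesgue_point (\<lambda>s. F s $ i) c"
  unfolding right_lebesgue_point_def
proof (rule tendsto_0_at_right_squeeze[OF zero_less_one _ _ c[unfolded right_lebesgue_point_def]])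
  fix h :: real assume h: "0 < h"
  show "0 \<le> (LINT s:{c..c+h}|lborel. norm (F s $ i - F c $ i)) / h"
    using h unfolding set_lebesgue_integral_def
    by (intro divide_nonneg_nonneg Bochner_Integration.integral_nonneg) auto
  have i: "set_integrable lborel {c..c+h} (\<lambda>s. norm (F s - F c))"
  proof (rule set_integrable_interval_bounded)
    fix s show "norm (norm (F s - F c)) \<le> 2 * M"
      using norm_triangle_ineq4[of "F s" "F c"] F[of s] F[of c] by simp
  qed measurable
  have "(LINT s:{c..c+h}|lborel. norm (F s $ i - F c $ i)) \<le> (LINT s:{c..c+h}|lborel. norm (F s - F c))"
    unfolding set_lebesgue_integral_def
  proof (rule integral_mono')
    fix s show "indicator {c..c+h} s *\<^sub>R norm (F s $ i - F c $ i) \<le> indicator {c..c+h} s *\<^sub>R norm (F s - F c)"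
      using Finite_Cartesian_Product.norm_nth_le[of "F s - F c" i] by (intro scaleR_left_mono) auto
  qed (use i in \<open>auto simp: set_integrable_def\<close>)
  then show "(LINT s:{c..c+h}|lborel. norm (F s $ i - F c $ i)) / h \<le> (LINT s:{c..c+h}|lborel. norm (F s - F c)) / h"
    using h by (simp add: divide_right_mono)
qed

lemma integrable_bounded_mult_continuous:
  fixes A K :: "real^3 \<Rightarrow> real"
  assumes [measurable]: "A \<in> borel_measurable borel" and A: "\<And>p. \<bar>A p\<bar> \<le> B"
    and K: "continuous_on UNIV K" "compact C" "\<And>p. p \<notin> C \<Longrightarrow> K p = 0"
  shows "integrable lborel (\<lambda>p. A p * K p)"
proof -
  have [measurable]: "K \<in> borel_measurable borel" by (rule borel_measurable_continuous_onI[OF K(1)])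
  obtain B' where B': "\<And>p. norm (K p) \<le> B'" using bounded_of_compact_support[OF K] by metis
  show ?thesis
  proof (rule integrable_bounded_support[OF _ _ compact_imp_bounded[OF K(2)]])
    fix p
    have "0 \<le> B" using A[of p] by linarith
    then have "\<bar>A p\<bar> * \<bar>K p\<bar> \<le> B * B'" using A[of p] B'[of p] by (intro mult_mono) auto
    then show "\<bar>A p * K p\<bar> \<le> B * B'" by (simp add: abs_mult)
  qed (use K(3) in auto)
qed

text \<open>Used both for Lebesgue measure and for \<open>|Dn|\<close>: convergence of the cutoffs
  at every point makes dominated convergence work for any Borel measure.\<close>

lemma cutoff_integral_limit:
  assumes M: "sets M = sets borel" and K: "integrable M K" and lu: "\<And>k. l $ k < u $ k"
  shows "(\<lambda>n. LINT p|M. cutoff l u (mesh n) p * K p) \<longlonglongrightarrow> (LINT p|M. indicator (half_open_box l u) p * K p)"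
proof (rule integral_dominated_convergence[where w = "\<lambda>p. \<bar>K p\<bar>"])
  note [measurable_cong] = M
  have [measurable]: "K \<in> borel_measurable M" using K by auto
  show "(\<lambda>p. indicator (half_open_box l u) p * K p) \<in> borel_measurable M" by measurable
  show "(\<lambda>p. cutoff l u (mesh n) p * K p) \<in> borel_measurable M" for n by measurable
  show "integrable M (\<lambda>p. \<bar>K p\<bar>)" using K by auto
  show "AE p in M. (\<lambda>n. cutoff l u (mesh n) p * K p) \<longlonglongrightarrow> indicator (half_open_box l u) p * K p"
    by (intro AE_I2 tendsto_mult tendsto_const cutoff_tendsto lu)
  show "AE p in M. norm (cutoff l u (mesh n) p * K p) \<le> \<bar>K p\<bar>" for n
    using cutoff_abs_le[of l u "mesh n"] by (intro AE_I2) (simp add: abs_mult mult_left_le_one_le)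
qed

text \<open>Trades \<open>n\<close>, which is only Lebesgue measurable and a slice function almost
  everywhere, for the Borel function \<open>F\<close>. As \<open>W\<close> vanishes off
  \<open>U\<close>, the integral may run over the whole space.\<close>

lemma set_integral_slice:
  fixes n :: "real^3 \<Rightarrow> real^3" and F :: "real \<Rightarrow> real^3"
  assumes n: "set_integrable lebesgue U n" and eq: "AE p in lebesgue. p \<in> U \<longrightarrow> n p = F (p $ j0)"
    and [measurable]: "F \<in> borel_measurable borel" "W \<in> borel_measurable borel" and W: "\<And>p. p \<notin> U \<Longrightarrow> W p = 0"
  shows "(LINT p:U|lebesgue. n p $ i * W p) = (LINT p|lborel. F (p $ j0) $ i * W p)"
proof -
  have [measurable]: "(\<lambda>p. indicator U p *\<^sub>R n p) \<in> borel_measurable lebesgue"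
    using n by (auto simp: set_integrable_def)
  have m: "(\<lambda>p. F (p $ j0) $ i * W p) \<in> borel_measurable borel" by measurable
  have "(LINT p:U|lebesgue. n p $ i * W p) = (LINT p|lebesgue. (indicator U p *\<^sub>R n p) $ i * W p)"
    by (simp add: set_lebesgue_integral_def mult.assoc)
  also have "\<dots> = (LINT p|lebesgue. F (p $ j0) $ i * W p)"
  proof (rule integral_cong_AE)
    have "W \<in> borel_measurable lebesgue" by (rule measurable_completion) simp
    then show "(\<lambda>p. (indicator U p *\<^sub>R n p) $ i * W p) \<in> borel_measurable lebesgue" by measurable
    show "(\<lambda>p. F (p $ j0) $ i * W p) \<in> borel_measurable lebesgue"
      by (rule measurable_completion) (use m in simp)
    show "AE p in lebesgue. (indicator U p *\<^sub>R n p) $ i * W p = F (p $ j0) $ i * W p"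
      using eq
    proof eventually_elim
      case (elim p)
      then show ?case using W[of p] by (cases "p \<in> U") auto
    qed
  qed
  also have "\<dots> = (LINT p|lborel. F (p $ j0) $ i * W p)"
    by (rule integral_completion) (use m in simp)
  finally show ?thesis .
qed

lemma GDERIV_component:
  fixes v :: "real^3 \<Rightarrow> real^3"
  assumes "(v has_derivative (\<lambda>h. Dv *v h)) (at x)"
  shows "GDERIV (\<lambda>x. v x $ i) x :> Dv $ i"
proof -
  have "((\<lambda>x. v x $ i) has_derivative (\<lambda>h. (Dv *v h) $ i)) (at x)"
    by (rule bounded_linear.has_derivative[OF bounded_linear_vec_nth assms])
  then show ?thesis by (simp add: gderiv_def matrix_vector_mul_component inner_commute)
qed

lemma integrable_distributional_component:
  assumes D: "distributional_derivative U n \<mu> \<sigma>" and t: "test_function_on U \<phi> D\<phi>"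
  shows "integrable \<mu> (\<lambda>p. \<phi> p * \<sigma> p $ i $ j)"
proof -
  have "finite_measure \<mu>" and s\<mu> [measurable_cong]: "sets \<mu> = sets borel"
    and [measurable]: "\<sigma> \<in> borel_measurable borel" and \<sigma>1: "AE x in \<mu>. norm (\<sigma> x) = 1"
    using D unfolding distributional_derivative_def by auto
  note [measurable] = test_function_measurable[OF t]
  obtain B where B: "\<And>x. \<bar>\<phi> x\<bar> \<le> B" using test_function_bounded(1)[OF t] by metis
  interpret finite_measure \<mu> by fact
  show ?thesis
  proof (rule integrable_const_bound[of _ B])
    show "AE x in \<mu>. norm (\<phi> x * \<sigma> x $ i $ j) \<le> B"
      using \<sigma>1
    proof eventually_elim
      case (elim x)
      have "\<bar>\<sigma> x $ i $ j\<bar> \<le> 1"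
        using component_le_norm_cart[of "\<sigma> x $ i" j] Finite_Cartesian_Product.norm_nth_le[of "\<sigma> x" i] elim by linarith
      then have "\<bar>\<phi> x\<bar> * \<bar>\<sigma> x $ i $ j\<bar> \<le> B * 1" using B[of x] by (intro mult_mono) auto
      then show ?case by (simp add: abs_mult)
    qed
  qed measurable
qed

text \<open>Test \<open>Dn\<close> with \<phi> times a cutoff, integrate \<open>v\<close> by parts
  against the same function, and subtract. The derivative of the cutoff then meets only
  \<open>F - v\<close> and converges to the surface measures of the two faces normal to
  \<open>j\<close>; all other terms converge to integrals over the half-open box.\<close>

lemma box_divergence:
  fixes n v :: "real^3 \<Rightarrow> real^3" and F :: "real \<Rightarrow> real^3" and Dv :: "real^3 \<Rightarrow> real^3^3"
  assumes D: "distributional_derivative U n \<mu> \<sigma>" and n: "set_integrable lebesgue U n"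
    and eq: "AE p in lebesgue. p \<in> U \<longrightarrow> n p = F (p $ 3)"
    and Fm [measurable]: "F \<in> borel_measurable borel" and F: "\<And>s. norm (F s) \<le> 1"
    and lu: "\<And>k. l $ k < u $ k"
    and LF: "right_lebesgue_point F (l $ 3)" "right_lebesgue_point F (u $ 3)"
    and v: "\<And>x. (v has_derivative (\<lambda>h. Dv x *v h)) (at x)" and Dv: "continuous_on UNIV Dv"
    and t: "test_function_on U \<phi> D\<phi>"
  shows "(LINT p|face_measure l u j (l $ j). (F (p $ 3) - v p) $ i * \<phi> p) - (LINT p|face_measure l u j (u $ j). (F (p $ 3) - v p) $ i * \<phi> p)
    = - (LINT p|\<mu>. indicator (half_open_box l u) p * (\<phi> p * \<sigma> p $ i $ j))
      + (LINT p|lborel. indicator (half_open_box l u) p * (\<phi> p * Dv p $ i $ j))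
      - (LINT p|lborel. indicator (half_open_box l u) p * ((F (p $ 3) - v p) $ i * D\<phi> p $ j))"
proof -
  define \<eta> where "\<eta> m = cutoff l u (mesh m)" for m
  define D\<eta> where "D\<eta> m = cutoff_grad l u (mesh m)" for m
  have \<eta>: "\<And>x. GDERIV (\<eta> m) x :> D\<eta> m x" "continuous_on UNIV (D\<eta> m)" for m
    unfolding \<eta>_def D\<eta>_def by (intro GDERIV_cutoff continuous_cutoff_grad mesh_bounds(1))+
  have \<eta>c: "continuous_on UNIV (\<eta> m)" for m using GDERIV_continuous_on[OF \<eta>(1)] .
  obtain C where C: "compact C" "C \<subseteq> U" "\<And>x. x \<notin> C \<Longrightarrow> \<phi> x = 0" "\<And>x. x \<notin> C \<Longrightarrow> D\<phi> x = 0"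
    using test_function_support[OF t] by metis
  have \<phi>c: "continuous_on UNIV \<phi>" "continuous_on UNIV D\<phi>"
    using test_function_continuous[OF t] t by (auto simp: test_function_on_def)
  have [measurable]: "\<phi> \<in> borel_measurable borel" "D\<phi> \<in> borel_measurable borel" "\<And>m. D\<eta> m \<in> borel_measurable borel"
    "\<And>m. \<eta> m \<in> borel_measurable borel"
    using \<phi>c \<eta>(2) \<eta>c by (auto intro: borel_measurable_continuous_onI)
  have vc: "continuous_on UNIV v"
    by (intro continuous_at_imp_continuous_on ballI has_derivative_continuous[OF v])
  have [measurable]: "v \<in> borel_measurable borel" using vc by (rule borel_measurable_continuous_onI)
  have vi: "\<And>x. GDERIV (\<lambda>x. v x $ i) x :> Dv x $ i" "continuous_on UNIV (\<lambda>x. Dv x $ i)"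
    using GDERIV_component[OF v] Dv by (auto intro: continuous_on_component)
  have Fi: "\<bar>F s $ i\<bar> \<le> 1" for s using component_le_norm_cart[of "F s" i] F[of s] by linarith
  have finite: "finite_measure \<mu>" and s\<mu> [measurable_cong]: "sets \<mu> = sets borel"
    and \<sigma>m [measurable]: "\<sigma> \<in> borel_measurable borel" and \<sigma>1: "AE x in \<mu>. norm (\<sigma> x) = 1"
    and test: "\<And>\<phi> D\<phi> i j. test_function_on U \<phi> D\<phi> \<Longrightarrow>
        (LINT x:U|lebesgue. n x $ i * D\<phi> x $ j) = - (LINT x|\<mu>. \<phi> x * \<sigma> x $ i $ j)"
    using D unfolding distributional_derivative_def by auto
  let ?Fi = "\<lambda>p::real^3. F (p $ 3) $ i"
  let ?v = "\<lambda>p. v p $ i"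
  let ?\<sigma> = "\<lambda>p. \<phi> p * \<sigma> p $ i $ j"
  have I1: "integrable lborel (\<lambda>p. ?Fi p * (\<phi> p * D\<eta> m p $ j))" for m
    by (rule integrable_bounded_mult_continuous[OF _ Fi _ C(1)])
      (auto intro!: continuous_intros \<phi>c \<eta> simp: C)
  have I2: "integrable lborel (\<lambda>p. ?Fi p * (\<eta> m p * D\<phi> p $ j))" for m
    by (rule integrable_bounded_mult_continuous[OF _ Fi _ C(1)])
      (auto intro!: continuous_intros \<phi>c \<eta>c simp: C)
  \<comment> \<open>The factor 1 fills the place of the bounded function in
    \<open>integrable_bounded_mult_continuous\<close>; the rest is continuous with compact
    support.\<close>
  have I3: "integrable lborel (\<lambda>p. 1 * (?v p * (\<phi> p * D\<eta> m p $ j)))" for m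
    by (rule integrable_bounded_mult_continuous[of _ 1, OF _ _ _ C(1)])
      (auto intro!: continuous_intros \<phi>c \<eta> vc simp: C)
  have I4: "integrable lborel (\<lambda>p. 1 * (\<eta> m p * (\<phi> p * Dv p $ i $ j)))" for m
    by (rule integrable_bounded_mult_continuous[of _ 1, OF _ _ _ C(1)])
      (auto intro!: continuous_intros \<phi>c \<eta>c Dv simp: C)
  have I5: "integrable lborel (\<lambda>p. 1 * (\<eta> m p * (?v p * D\<phi> p $ j)))" for m
    by (rule integrable_bounded_mult_continuous[of _ 1, OF _ _ _ C(1)])
      (auto intro!: continuous_intros \<phi>c \<eta>c vc simp: C)
  have J4: "integrable lborel (\<lambda>p. 1 * (\<phi> p * Dv p $ i $ j))"
    by (rule integrable_bounded_mult_continuous[of _ 1, OF _ _ _ C(1)])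
      (auto intro!: continuous_intros \<phi>c Dv simp: C)
  have J5: "integrable lborel (\<lambda>p. 1 * (?v p * D\<phi> p $ j))"
    by (rule integrable_bounded_mult_continuous[of _ 1, OF _ _ _ C(1)])
      (auto intro!: continuous_intros \<phi>c vc simp: C)
  have J2: "integrable lborel (\<lambda>p. ?Fi p * D\<phi> p $ j)"
    by (rule integrable_bounded_mult_continuous[OF _ Fi _ C(1)])
      (auto intro!: continuous_intros \<phi>c simp: C)
  have J25: "integrable lborel (\<lambda>p. (F (p $ 3) - v p) $ i * D\<phi> p $ j)"
    using Bochner_Integration.integrable_diff[OF J2 J5] by (simp add: left_diff_distrib)
  have J\<sigma>: "integrable \<mu> ?\<sigma>" by (rule integrable_distributional_component[OF D t])
  \<comment> \<open>Weak integration by parts for \<open>n\<close>: \<phi> times the cutoff is again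
    a test function on \<open>U\<close>.\<close>
  have E1: "(LINT p|lborel. ?Fi p * (\<phi> p * D\<eta> m p $ j)) + (LINT p|lborel. ?Fi p * (\<eta> m p * D\<phi> p $ j))
      = - (LINT p|\<mu>. \<eta> m p * ?\<sigma> p)" for m
  proof -
    let ?W = "\<lambda>p. (\<phi> p *\<^sub>R D\<eta> m p + \<eta> m p *\<^sub>R D\<phi> p) $ j"
    have "(LINT p:U|lebesgue. n p $ i * ?W p) = - (LINT x|\<mu>. (\<phi> x * \<eta> m x) * \<sigma> x $ i $ j)"
      by (rule test[OF test_function_on_mult[OF t \<eta>]])
    moreover have "(LINT p:U|lebesgue. n p $ i * ?W p) = (LINT p|lborel. ?Fi p * ?W p)"
    proof (rule set_integral_slice[OF n eq])
      fix p assume "p \<notin> U"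
      then have "p \<notin> C" using C(2) by blast
      then show "?W p = 0" using C(3,4) by simp
    qed measurable
    moreover have "(LINT p|lborel. ?Fi p * ?W p) = (LINT p|lborel. ?Fi p * (\<phi> p * D\<eta> m p $ j)) + (LINT p|lborel. ?Fi p * (\<eta> m p * D\<phi> p $ j))"
      by (subst Bochner_Integration.integral_add[OF I1 I2, symmetric]) (simp add: distrib_left)
    moreover have "(LINT x|\<mu>. (\<phi> x * \<eta> m x) * \<sigma> x $ i $ j) = (LINT p|\<mu>. \<eta> m p * ?\<sigma> p)"
      by (simp add: mult_ac)
    ultimately show ?thesis by simp
  qed
  \<comment> \<open>Classical counterpart for \<open>v\<close>: the integral of a partial derivative
    of the compactly supported product of \<phi>, \<open>v $ i\<close> and \<open>\<eta> m\<close>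
    is 0.\<close>
  have E2: "(LINT p|lborel. ?v p * (\<phi> p * D\<eta> m p $ j)) + (LINT p|lborel. \<eta> m p * (\<phi> p * Dv p $ i $ j))
      + (LINT p|lborel. \<eta> m p * (?v p * D\<phi> p $ j)) = 0" for m
  proof -
    have t': "test_function_on UNIV \<phi> D\<phi>" using t unfolding test_function_on_def by blast
    have "(LINT p|lborel. ((\<phi> p * ?v p) *\<^sub>R D\<eta> m p + \<eta> m p *\<^sub>R (\<phi> p *\<^sub>R Dv p $ i + ?v p *\<^sub>R D\<phi> p)) $ j) = 0"
      by (rule integral_partial_derivative_zero(1)[OF test_function_on_mult[OF test_function_on_mult[OF t' vi] \<eta>]])
    also have "(\<lambda>p. ((\<phi> p * ?v p) *\<^sub>R D\<eta> m p + \<eta> m p *\<^sub>R (\<phi> p *\<^sub>R Dv p $ i + ?v p *\<^sub>R D\<phi> p)) $ j)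
        = (\<lambda>p. ?v p * (\<phi> p * D\<eta> m p $ j) + \<eta> m p * (\<phi> p * Dv p $ i $ j) + \<eta> m p * (?v p * D\<phi> p $ j))"
      by (auto simp: fun_eq_iff algebra_simps)
    finally show ?thesis
      using I3[of m] I4[of m] I5[of m]
      by (simp add: Bochner_Integration.integral_add Bochner_Integration.integrable_add)
  qed
  define G where "G p = (F (p $ 3) - v p) $ i * \<phi> p" for p
  have Gm [measurable]: "G \<in> borel_measurable borel" unfolding G_def by measurable
  have vphi: "continuous_on UNIV (\<lambda>p. - (?v p * \<phi> p))" by (intro continuous_intros vc \<phi>c)
  obtain B1 where B1: "\<And>x. \<bar>\<phi> x\<bar> \<le> B1" using test_function_bounded(1)[OF t] by metis
  obtain B2 where B2: "\<And>x. norm (- (?v x * \<phi> x)) \<le> B2" using bounded_of_compact_support[OF vphi C(1)] C(3) by auto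
  have GB: "\<bar>G p\<bar> \<le> B1 + B2" for p
  proof -
    have "\<bar>?Fi p\<bar> * \<bar>\<phi> p\<bar> \<le> 1 * B1" using Fi[of "p $ 3"] B1[of p] by (intro mult_mono) auto
    then have "\<bar>?Fi p * \<phi> p\<bar> \<le> B1" by (simp add: abs_mult)
    moreover have "G p = ?Fi p * \<phi> p + - (?v p * \<phi> p)" by (simp add: G_def left_diff_distrib)
    ultimately show ?thesis using B2[of p] by (simp only: real_norm_def)
  qed
  \<comment> \<open>On horizontal faces the premises on \<open>F\<close> apply. On vertical ones
    \<open>F\<close> does not vary along the normal, so only the continuity of \<open>v\<close> and
    \<phi> matters.\<close>
  have rlp: "right_lebesgue_point (\<lambda>s. G (join j x s)) c" if c: "c = l $ j \<or> c = u $ j" for x c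
  proof -
    have jc: "continuous_on UNIV (join j x)"
    proof -
      have eq: "join j x = (\<lambda>s. join j x 0 + s *\<^sub>R axis j 1)" by (auto simp: fun_eq_iff vec_eq_iff axis_def)
      show ?thesis by (subst eq) (intro continuous_intros)
    qed
    have "right_lebesgue_point (\<lambda>s. F (join j x s $ 3) $ i) c"
    proof (cases "j = 3")
      case True
      then have "right_lebesgue_point F c" using c LF by auto
      then show ?thesis using right_lebesgue_point_component[OF Fm F] True by simp
    next
      case False
      then show ?thesis using right_lebesgue_point_const by simp
    qed
    moreover have "(\<lambda>s. F (join j x s $ 3) $ i) \<in> borel_measurable borel"
      by (rule measurable_compose[OF measurable_join(2)]) measurable
    ultimately have "right_lebesgue_point (\<lambda>s. F (join j x s $ 3) $ i * \<phi> (join j x s) + - (?v (join j x s) * \<phi> (join j x s))) c"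
      using Fi by (intro right_lebesgue_point_mult_add[of _ 1] continuous_on_compose2[OF \<phi>c(1) jc]
          continuous_on_compose2[OF vphi jc]) auto
    then show ?thesis by (simp add: G_def left_diff_distrib)
  qed
  let ?P = "\<lambda>m p. \<Prod>k\<in>UNIV-{j}. window (mesh m) (l $ k) (u $ k) (p $ k)"
  note fl = face_limit[OF Gm GB lu rlp[of "l $ j"], simplified]
  note fu = face_limit[OF Gm GB lu rlp[of "u $ j"], simplified]
  have T: "(LINT p|lborel. ?Fi p * (\<phi> p * D\<eta> m p $ j)) - (LINT p|lborel. ?v p * (\<phi> p * D\<eta> m p $ j))
      = (LINT p|lborel. G p * step_kernel (mesh m) (l $ j) (p $ j) * ?P m p) - (LINT p|lborel. G p * step_kernel (mesh m) (u $ j) (p $ j) * ?P m p)" for m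
  proof -
    have "(LINT p|lborel. ?Fi p * (\<phi> p * D\<eta> m p $ j)) - (LINT p|lborel. ?v p * (\<phi> p * D\<eta> m p $ j))
        = (LINT p|lborel. ?Fi p * (\<phi> p * D\<eta> m p $ j) - ?v p * (\<phi> p * D\<eta> m p $ j))"
      using I1[of m] I3[of m] by simp
    also have "\<dots> = (LINT p|lborel. G p * step_kernel (mesh m) (l $ j) (p $ j) * ?P m p - G p * step_kernel (mesh m) (u $ j) (p $ j) * ?P m p)"
      by (intro Bochner_Integration.integral_cong) (auto simp: G_def D\<eta>_def cutoff_grad_def algebra_simps)
    also have "\<dots> = (LINT p|lborel. G p * step_kernel (mesh m) (l $ j) (p $ j) * ?P m p) - (LINT p|lborel. G p * step_kernel (mesh m) (u $ j) (p $ j) * ?P m p)"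
      by (rule Bochner_Integration.integral_diff[OF fl(2) fu(2)])
    finally show ?thesis .
  qed
  have lim1: "(\<lambda>m. (LINT p|lborel. ?Fi p * (\<phi> p * D\<eta> m p $ j)) - (LINT p|lborel. ?v p * (\<phi> p * D\<eta> m p $ j)))
      \<longlonglongrightarrow> (LINT p|face_measure l u j (l $ j). G p) - (LINT p|face_measure l u j (u $ j). G p)"
    unfolding T by (rule tendsto_diff[OF fl(1) fu(1)])
  \<comment> \<open>\<open>E1\<close> minus \<open>E2\<close>, with the terms free of
    \<open>D\<eta>\<close> collected on the right.\<close>
  have E: "(LINT p|lborel. ?Fi p * (\<phi> p * D\<eta> m p $ j)) - (LINT p|lborel. ?v p * (\<phi> p * D\<eta> m p $ j))
     = - (LINT p|\<mu>. \<eta> m p * ?\<sigma> p) + (LINT p|lborel. \<eta> m p * (\<phi> p * Dv p $ i $ j))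
       - (LINT p|lborel. \<eta> m p * ((F (p $ 3) - v p) $ i * D\<phi> p $ j))" for m
  proof -
    have "(LINT p|lborel. \<eta> m p * ((F (p $ 3) - v p) $ i * D\<phi> p $ j)) =
        (LINT p|lborel. ?Fi p * (\<eta> m p * D\<phi> p $ j) - \<eta> m p * (?v p * D\<phi> p $ j))"
      by (intro Bochner_Integration.integral_cong) (auto simp: algebra_simps)
    also have "\<dots> = (LINT p|lborel. ?Fi p * (\<eta> m p * D\<phi> p $ j)) - (LINT p|lborel. \<eta> m p * (?v p * D\<phi> p $ j))"
      using I2[of m] I5[of m] by simp
    finally show ?thesis using E1[of m] E2[of m] by linarith
  qed
  have "(\<lambda>m. - (LINT p|\<mu>. \<eta> m p * ?\<sigma> p) + (LINT p|lborel. \<eta> m p * (\<phi> p * Dv p $ i $ j))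
       - (LINT p|lborel. \<eta> m p * ((F (p $ 3) - v p) $ i * D\<phi> p $ j)))
    \<longlonglongrightarrow> - (LINT p|\<mu>. indicator (half_open_box l u) p * ?\<sigma> p)
      + (LINT p|lborel. indicator (half_open_box l u) p * (\<phi> p * Dv p $ i $ j))
      - (LINT p|lborel. indicator (half_open_box l u) p * ((F (p $ 3) - v p) $ i * D\<phi> p $ j))"
    unfolding \<eta>_def using J4 J25
    by (intro tendsto_diff tendsto_add tendsto_minus cutoff_integral_limit J\<sigma> s\<mu> lu) auto
  then have "(LINT p|face_measure l u j (l $ j). G p) - (LINT p|face_measure l u j (u $ j). G p)
     = - (LINT p|\<mu>. indicator (half_open_box l u) p * ?\<sigma> p)
      + (LINT p|lborel. indicator (half_open_box l u) p * (\<phi> p * Dv p $ i $ j))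
      - (LINT p|lborel. indicator (half_open_box l u) p * ((F (p $ 3) - v p) $ i * D\<phi> p $ j))"
    using LIMSEQ_unique[OF lim1] E by simp
  then show ?thesis by (simp add: G_def)
qed

section \<open>Jumps across a face\<close>

text \<open>The cubes touch \<open>p\<close> only in the limit \<open>h \<longlonglongrightarrow> 0\<close>: a cube in an octant at \<open>p\<close>, kept away from the
  coordinate planes through \<open>p\<close>, lies strictly on one side of a face containing \<open>p\<close>.\<close>

definition corner_cube :: "(3 \<Rightarrow> bool) \<Rightarrow> real^3 \<Rightarrow> real \<Rightarrow> (real^3) set" where
  "corner_cube e p h = cbox (\<chi> k. if e k then p $ k + h / 2 else p $ k - h) (\<chi> k. if e k then p $ k + h else p $ k - h / 2)"

lemma mem_corner_cube:
  "y \<in> corner_cube e p h \<longleftrightarrow> (\<forall>k. if e k then p $ k + h / 2 \<le> y $ k \<and> y $ k \<le> p $ k + h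
     else p $ k - h \<le> y $ k \<and> y $ k \<le> p $ k - h / 2)"
  by (auto simp: corner_cube_def mem_box_cart split: if_splits)

lemma corner_cube_lebesgue [simp]: "corner_cube e p h \<in> sets borel" "corner_cube e p h \<in> sets lebesgue"
  by (simp_all add: corner_cube_def)

lemma corner_cube_subset_ball:
  assumes "h > 0"
  shows "corner_cube e p h \<subseteq> ball p (2 * h)"
proof
  fix y assume y: "y \<in> corner_cube e p h"
  have k: "\<bar>(y - p) $ k\<bar> \<le> h" for k
    using y assms unfolding mem_corner_cube by (auto dest: spec[of _ k] split: if_splits)
  have "(norm (y - p))\<^sup>2 = (\<Sum>k\<in>UNIV. ((y - p) $ k)\<^sup>2)"
    unfolding power2_norm_eq_inner inner_vec_def by (simp add: power2_eq_square)
  also have "\<dots> \<le> (\<Sum>k\<in>(UNIV::3 set). h\<^sup>2)"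
    by (intro sum_mono) (metis k abs_le_square_iff abs_of_pos assms)
  also have "\<dots> < (2 * h)\<^sup>2" using assms by (simp add: power2_eq_square)
  finally have "norm (y - p) < 2 * h" by (rule power2_less_imp_less) (use assms in simp)
  then show "y \<in> ball p (2 * h)" by (simp add: dist_norm norm_minus_commute)
qed

lemma measure_corner_cube:
  assumes "h > 0"
  shows "measure lebesgue (corner_cube e p h) = (h / 2) ^ 3"
proof -
  have ne: "corner_cube e p h \<noteq> {}"
    using assms by (auto simp: corner_cube_def box_ne_empty Basis_cart inner_axis)
  have "measure lebesgue (corner_cube e p h) = (\<Prod>k\<in>UNIV. (if e k then p $ k + h else p $ k - h / 2) - (if e k then p $ k + h / 2 else p $ k - h))"
    using content_cbox_cart[OF ne[unfolded corner_cube_def]] by (simp add: corner_cube_def)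
  also have "\<dots> = (\<Prod>k\<in>(UNIV::3 set). h / 2)" by (intro prod.cong) auto
  finally show ?thesis by simp
qed

text \<open>Fubini: the cross-section has area \<open>(h / 2)\<^sup>2\<close>, and the shadow on
  axis \<open>j\<close> lies on the side of \<open>p\<close> chosen by \<open>e j\<close>.\<close>

lemma integral_corner_cube_slice:
  fixes f :: "real \<Rightarrow> real"
  assumes [measurable]: "f \<in> borel_measurable borel" and f: "\<And>s. \<bar>f s\<bar> \<le> B" and h: "h > 0"
  shows "(LINT y:corner_cube e p h|lborel. f (y $ j)) =
      (h / 2)^2 * (LINT s:(if e j then {p $ j + h / 2..p $ j + h} else {p $ j - h..p $ j - h / 2})|lborel. f s)"
proof -
  define I where "I k = (if e k then {p $ k + h / 2..p $ k + h} else {p $ k - h..p $ k - h / 2})" for k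
  define Q where "Q = Pi\<^sub>E (UNIV - {j}) I"
  have I: "I k \<in> sets borel" "emeasure lborel (I k) = ennreal (h / 2)" for k
    using h by (auto simp: I_def)
  have "integrable lborel (\<lambda>y. indicator (corner_cube e p h) y *\<^sub>R f (y $ j))"
  proof (rule integrable_bounded_support)
    show "\<bar>indicator (corner_cube e p h) y *\<^sub>R f (y $ j)\<bar> \<le> B" for y
      using f[of "y $ j"] by (auto simp: indicator_def)
    show "bounded (corner_cube e p h)" by (simp add: corner_cube_def)
    show "(\<lambda>y. indicator (corner_cube e p h) y *\<^sub>R f (y $ j)) \<in> borel_measurable borel"
      by (intro borel_measurable_scaleR borel_measurable_indicator) (simp, measurable)
  qed auto
  then have "(LINT y:corner_cube e p h|lborel. f (y $ j)) =
      (LINT x|cross_measure j. LINT s|lborel. indicator (corner_cube e p h) (join j x s) *\<^sub>R f s)"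
    unfolding set_lebesgue_integral_def by (subst lborel_integral_join(1)[of _ j]) auto
  also have "\<dots> = (LINT x|cross_measure j. indicator Q x *\<^sub>R (LINT s:I j|lborel. f s))"
  proof (rule Bochner_Integration.integral_cong[OF refl])
    fix x assume x: "x \<in> space (cross_measure j)"
    have "join j x s \<in> corner_cube e p h \<longleftrightarrow> x \<in> Q \<and> s \<in> I j" for s
    proof -
      have "join j x s \<in> corner_cube e p h \<longleftrightarrow> (\<forall>k. join j x s $ k \<in> I k)"
        by (simp add: mem_corner_cube I_def)
      also have "\<dots> \<longleftrightarrow> (\<forall>k\<in>UNIV - {j}. x k \<in> I k) \<and> s \<in> I j" by auto
      also have "\<dots> \<longleftrightarrow> x \<in> Q \<and> s \<in> I j" using x by (simp add: Q_def PiE_iff cross_measure_def space_PiM)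
      finally show ?thesis .
    qed
    then have "indicator (corner_cube e p h) (join j x s) = (indicator Q x * indicator (I j) s :: real)" for s
      by (simp add: indicator_def)
    then show "(LINT s|lborel. indicator (corner_cube e p h) (join j x s) *\<^sub>R f s) = indicator Q x *\<^sub>R (LINT s:I j|lborel. f s)"
      by (simp add: set_lebesgue_integral_def mult.assoc)
  qed
  also have "\<dots> = measure (cross_measure j) Q * (LINT s:I j|lborel. f s)"
  proof -
    have "Q \<in> sets (cross_measure j)" unfolding Q_def using I by (intro sets_PiE_cross)
    moreover have "emeasure (cross_measure j) Q < \<infinity>"
      unfolding Q_def by (rule emeasure_cross_PiE_bounded[OF I(1)]) (simp add: I_def)
    ultimately show ?thesis by simp
  qed
  also have "measure (cross_measure j) Q = (h / 2)^2"
  proof -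
    have "card (UNIV - {j} :: 3 set) = 2" by (simp add: card_Diff_singleton)
    then have "emeasure (cross_measure j) Q = ennreal ((h / 2)^2)"
      unfolding Q_def using h by (subst emeasure_cross_PiE[OF I(1)]) (simp add: I(2) ennreal_power)
    then show ?thesis by (simp add: measure_def)
  qed
  finally show ?thesis by (simp add: I_def)
qed

text \<open>An approximate limit of \<open>m\<close> at \<open>p\<close> would govern the averages
  over every family of corner cubes. The inner cubes force it to be \<open>v p\<close> by
  continuity, the outer ones force it to be \<open>F (p $ j)\<close> by the Lebesgue point property,
  and these values differ. Here \<open>j\<close> is the coordinate on which \<open>n\<close>
  depends; the face may have any normal.\<close>

lemma jump_at_face:
  fixes m n v :: "real^3 \<Rightarrow> real^3" and F :: "real \<Rightarrow> real^3"
  assumes U: "open U" "p \<in> U" and m: "set_integrable lebesgue U m" and n: "set_integrable lebesgue U n"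
    and eq: "AE y in lebesgue. y \<in> U \<longrightarrow> n y = F (y $ j)"
    and Fm [measurable]: "F \<in> borel_measurable borel" and F: "\<And>s. norm (F s) \<le> 1"
    and LF: "lebesgue_point F (p $ j)" and vc: "isCont v p" and r: "r > 0"
    and inside: "\<And>h y. 0 < h \<Longrightarrow> h < r \<Longrightarrow> y \<in> corner_cube e p h \<Longrightarrow> m y = v y"
    and outside: "\<And>h y. 0 < h \<Longrightarrow> h < r \<Longrightarrow> y \<in> corner_cube e' p h \<Longrightarrow> y \<in> U \<and> m y = n y"
    and jump: "F (p $ j) \<noteq> v p"
  shows "p \<in> approx_discontinuity_set m"
proof (rule ccontr)
  assume "p \<notin> approx_discontinuity_set m"
  then obtain \<zeta> where \<zeta>: "approx_limit m p \<zeta>" by (auto simp: approx_discontinuity_set_def)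
  obtain r0 where r0: "r0 > 0" "ball p r0 \<subseteq> U" using U openE by blast
  have mb: "set_integrable lebesgue (ball p r0) m" using m by (rule set_integrable_subset) (use r0 in auto)
  have lim: "((\<lambda>h. (LINT y:corner_cube e p h|lebesgue. norm (m y - \<zeta>)) / h^3) \<longlongrightarrow> 0) (at_right 0)" for e
    by (rule approx_limit_subset_average[OF r0(1) mb \<zeta>]) (simp_all add: corner_cube_subset_ball)
  have "v p = \<zeta>"
  proof (rule ccontr)
    assume ne: "v p \<noteq> \<zeta>"
    \<comment> \<open>On small inner cubes \<open>m = v\<close> stays at distance at least
      \<open>d\<close> from \<zeta>; the volume \<open>(h / 2)^3\<close> then gives the lower bound
      \<open>d / 8\<close>.\<close>
    define d where "d = norm (v p - \<zeta>) / 2"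
    have d: "d > 0" using ne by (simp add: d_def)
    obtain r1 where r1: "r1 > 0" "\<And>y. dist y p < r1 \<Longrightarrow> dist (v y) (v p) < d"
      using vc d unfolding continuous_at_eps_delta by blast
    define r2 where "r2 = min r (min (r1 / 2) (r0 / 2))"
    have r2: "r2 > 0" using r r1 r0 by (simp add: r2_def)
    have ge: "d / 8 \<le> (LINT y:corner_cube e p h|lebesgue. norm (m y - \<zeta>)) / h^3" if h: "0 < h" "h < r2" for h
    proof -
      have hs: "h < r" "2 * h < r1" "2 * h < r0" using h by (auto simp: r2_def)
      have "(h / 2)^3 * d = (LINT y:corner_cube e p h|lebesgue. d)"
        using measure_corner_cube[OF h(1)] by (subst set_integral_const) (auto simp: corner_cube_def emeasure_lborel_cbox_eq)
      also have "\<dots> \<le> (LINT y:corner_cube e p h|lebesgue. norm (m y - \<zeta>))"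
        unfolding set_lebesgue_integral_def
      proof (rule integral_mono')
        have "set_integrable lebesgue (corner_cube e p h) (\<lambda>y. norm (m y - \<zeta>))"
        proof (rule set_integrable_subset)
          show "set_integrable lebesgue (ball p r0) (\<lambda>y. norm (m y - \<zeta>))"
            by (intro set_integrable_norm set_integral_diff(1)[OF mb] set_integrable_ball_const)
          show "corner_cube e p h \<subseteq> ball p r0" using corner_cube_subset_ball[OF h(1)] hs(3) by fastforce
        qed simp
        then show "integrable lebesgue (\<lambda>y. indicator (corner_cube e p h) y *\<^sub>R norm (m y - \<zeta>))"
          by (simp add: set_integrable_def)
        fix y
        have "d \<le> norm (m y - \<zeta>)" if y: "y \<in> corner_cube e p h"
        proof -
          have "y \<in> ball p (2 * h)" using corner_cube_subset_ball[OF h(1)] y by blast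
          then have "dist (v y) (v p) < d" using hs by (intro r1(2)) (simp add: dist_commute)
          moreover have "norm (v p - \<zeta>) \<le> norm (v y - v p) + norm (v y - \<zeta>)"
            using norm_triangle_ineq4[of "v y - \<zeta>" "v y - v p"] by (simp add: algebra_simps)
          ultimately show ?thesis using inside[OF h(1) hs(1) y] by (simp add: dist_norm d_def)
        qed
        then show "indicator (corner_cube e p h) y *\<^sub>R d \<le> indicator (corner_cube e p h) y *\<^sub>R norm (m y - \<zeta>)"
          by (auto simp: indicator_def)
      qed simp
      finally show ?thesis using h by (simp add: field_simps power_divide)
    qed
    have "eventually (\<lambda>h. h \<in> {0<..<r2}) (at_right 0)" by (rule eventually_at_right_real[OF r2])
    then have "eventually (\<lambda>h. d / 8 \<le> (LINT y:corner_cube e p h|lebesgue. norm (m y - \<zeta>)) / h^3) (at_right 0)"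
      by eventually_elim (use ge in auto)
    from tendsto_lowerbound[OF lim this] show False using d by simp
  qed
  moreover have "F (p $ j) = \<zeta>"
  proof -
    define I where "I h = (if e' j then {p $ j + h / 2..p $ j + h} else {p $ j - h..p $ j - h / 2})" for h
    \<comment> \<open>The factor 4 is \<open>h^2\<close> divided by the area
      \<open>(h / 2)^2\<close> of the cross-section.\<close>
    have eqI: "(LINT s:I h|lborel. norm (F s - \<zeta>)) / h = 4 * ((LINT y:corner_cube e' p h|lebesgue. norm (m y - \<zeta>)) / h^3)"
      if h: "0 < h" "h < r" for h
    proof -
      have Fz: "\<bar>norm (F s - \<zeta>)\<bar> \<le> 1 + norm \<zeta>" for s
        using norm_triangle_ineq4[of "F s" \<zeta>] F[of s] by simp
      have mm: "(\<lambda>y. indicator (corner_cube e' p h) y *\<^sub>R norm (F (y $ j) - \<zeta>)) \<in> borel_measurable borel"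
        by (intro borel_measurable_scaleR borel_measurable_indicator) (simp, measurable)
      have "(LINT y:corner_cube e' p h|lebesgue. norm (m y - \<zeta>)) = (LINT y|lebesgue. indicator (corner_cube e' p h) y *\<^sub>R norm (F (y $ j) - \<zeta>))"
        unfolding set_lebesgue_integral_def
      proof (rule integral_cong_AE)
        have [measurable]: "(\<lambda>y. indicator U y *\<^sub>R n y) \<in> borel_measurable lebesgue"
          using n by (auto simp: set_integrable_def)
        have "(\<lambda>y. indicator (corner_cube e' p h) y *\<^sub>R norm (indicator U y *\<^sub>R n y - \<zeta>)) \<in> borel_measurable lebesgue"
          by (intro borel_measurable_scaleR borel_measurable_indicator) (simp, measurable)
        also have "(\<lambda>y. indicator (corner_cube e' p h) y *\<^sub>R norm (indicator U y *\<^sub>R n y - \<zeta>))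
            = (\<lambda>y. indicator (corner_cube e' p h) y *\<^sub>R norm (m y - \<zeta>))"
          using outside[OF h] by (auto simp: fun_eq_iff indicator_def)
        finally show "(\<lambda>y. indicator (corner_cube e' p h) y *\<^sub>R norm (m y - \<zeta>)) \<in> borel_measurable lebesgue" .
        show "(\<lambda>y. indicator (corner_cube e' p h) y *\<^sub>R norm (F (y $ j) - \<zeta>)) \<in> borel_measurable lebesgue"
          by (rule measurable_completion) (use mm in simp)
        show "AE y in lebesgue. indicator (corner_cube e' p h) y *\<^sub>R norm (m y - \<zeta>) = indicator (corner_cube e' p h) y *\<^sub>R norm (F (y $ j) - \<zeta>)"
          using eq by eventually_elim (use outside[OF h] in \<open>auto simp: indicator_def\<close>)
      qed
      also have "\<dots> = (LINT y:corner_cube e' p h|lborel. norm (F (y $ j) - \<zeta>))"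
        unfolding set_lebesgue_integral_def by (rule integral_completion) (use mm in simp)
      also have "\<dots> = (h / 2)^2 * (LINT s:I h|lborel. norm (F s - \<zeta>))"
        unfolding I_def by (rule integral_corner_cube_slice[OF _ Fz h(1)]) measurable
      finally show ?thesis using h by (simp add: field_simps power2_eq_square power3_eq_cube)
    qed
    have "((\<lambda>h. (LINT s:I h|lborel. norm (F s - \<zeta>)) / h) \<longlongrightarrow> 0) (at_right 0)"
    proof (rule Lim_transform_eventually[OF tendsto_mult_right_zero[OF lim[of e'], of 4]])
      show "\<forall>\<^sub>F h in at_right 0. 4 * ((LINT y:corner_cube e' p h|lebesgue. norm (m y - \<zeta>)) / h^3) = (LINT s:I h|lborel. norm (F s - \<zeta>)) / h"
        using eventually_at_right_real[OF r] by eventually_elim (use eqI in auto)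
    qed
    \<comment> \<open>If the outer cube lies below \<open>p\<close> in direction \<open>j\<close>,
      reflection reduces to right-hand intervals.\<close>
    moreover have "(LINT s:I h|lborel. norm (F s - \<zeta>)) = (LINT s:{- (p $ j) + h/2..- (p $ j) + h}|lborel. norm (F (- s) - \<zeta>))"
      if "\<not> e' j" for h
    proof -
      have "(LINT s:I h|lborel. norm (F s - \<zeta>)) = \<bar>- 1\<bar> *\<^sub>R (LINT s|lborel. indicator (I h) (0 + (- 1) * s) *\<^sub>R norm (F (0 + (- 1) * s) - \<zeta>))"
        unfolding set_lebesgue_integral_def by (rule lborel_integral_real_affine) simp
      also have "\<dots> = (LINT s:{- (p $ j) + h/2..- (p $ j) + h}|lborel. norm (F (- s) - \<zeta>))"
        unfolding set_lebesgue_integral_def using that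
        by (auto intro!: Bochner_Integration.integral_cong simp: I_def indicator_def)
      finally show ?thesis .
    qed
    ultimately show ?thesis
      using LF right_lebesgue_point_unique[OF Fm F, of "p $ j" \<zeta>]
        right_lebesgue_point_unique[of "\<lambda>s. F (- s)" 1 "- (p $ j)" \<zeta>] F
      unfolding lebesgue_point_def by (cases "e' j") (auto simp: I_def)
  qed
  ultimately show False using jump by simp
qed

section \<open>Replacing a map in a box\<close>

text \<open>The tensor product of \<open>q\<close> with the \<open>j\<close>-th unit vector, the
  form of a jump across a face with normal \<open>j\<close>.\<close>

definition column_matrix :: "3 \<Rightarrow> real^3 \<Rightarrow> real^3^3" where
  "column_matrix j q = (\<chi> i. q $ i *\<^sub>R axis j 1)"

lemma column_matrix_nth [simp]: "column_matrix j q $ i $ k = (if k = j then q $ i else 0)"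
  by (simp add: column_matrix_def axis_def)

lemma bounded_linear_column_matrix: "bounded_linear (column_matrix j)"
  by (rule linear_conv_bounded_linear[THEN iffD1]) (auto intro!: linearI simp: column_matrix_def vec_eq_iff algebra_simps)

lemma null_sets_box_frontier: "cbox l u - box l u \<in> null_sets (lborel :: (real^3) measure)"
proof -
  have "cbox l u - box l u \<in> null_sets lebesgue"
    using negligible_frontier_interval by (simp add: negligible_iff_null_sets)
  then show ?thesis by (subst (asm) null_sets_completion_iff) auto
qed

text \<open>Used on vertical faces, where it makes almost every height a Lebesgue point of
  \<open>F\<close>.\<close>

lemma AE_face_measure_component:
  assumes k: "k \<noteq> j" and N: "N \<in> null_sets lborel"
  shows "AE p in face_measure l u j c. p $ k \<notin> N"
proof -
  have [measurable]: "N \<in> sets borel" using N by auto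
  have m: "(\<lambda>x. join j x c) \<in> density (cross_measure j) (indicator (face_section l u j)) \<rightarrow>\<^sub>M borel"
    using measurable_join(1) by simp
  have P: "{p \<in> space borel. p $ k \<notin> N} \<in> sets borel" by measurable
  show ?thesis
    unfolding face_measure_def
    using AE_cross_notin[OF k N] k
    by (subst AE_distr_iff[OF m P], subst AE_density)
      (auto intro!: borel_measurable_indicator face_section_sets elim!: eventually_mono)
qed

text \<open>The derivative of \<open>m\<close> is a sum of eight vector measures: \<open>Dv\<close>
  on the box, \<open>Dn\<close> off the box, and a jump \<open>F - v\<close> with sign on each of
  the six faces. The identity comes from \<open>box_divergence\<close>; \<open>SBV_intro\<close>
  then asks that the singular contributions lie on discontinuity points of \<open>m\<close>. For the
  faces this is \<open>jump_at_face\<close>, and for \<open>Dn\<close> it is locality, since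
  \<open>|Dn|\<close> does not charge the frontier of the box.\<close>

lemma SBV_replace_box:
  fixes n m v :: "real^3 \<Rightarrow> real^3" and F :: "real \<Rightarrow> real^3" and Dv :: "real^3 \<Rightarrow> real^3^3"
  assumes U: "open U" "cbox l u \<subseteq> U" and lu: "\<And>k. l $ k < u $ k"
    and D: "distributional_derivative U n \<mu> \<sigma>" and n: "set_integrable lebesgue U n"
    and N: "N \<in> null_sets lborel" "absolutely_continuous lborel (density \<mu> (indicator (- N)))"
      "AE x in \<mu>. x \<in> N \<longrightarrow> x \<in> approx_discontinuity_set n"
    and eq: "AE p in lebesgue. p \<in> U \<longrightarrow> n p = F (p $ 3)"
    and Fm [measurable]: "F \<in> borel_measurable borel" and F: "\<And>s. norm (F s) \<le> 1"
    and LF: "lebesgue_point F (l $ 3)" "lebesgue_point F (u $ 3)"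
    and gen: "\<And>k. AE p in \<mu>. p $ k \<noteq> l $ k" "\<And>k. AE p in \<mu>. p $ k \<noteq> u $ k"
    and v: "\<And>x. (v has_derivative (\<lambda>h. Dv x *v h)) (at x)" and Dv: "continuous_on UNIV Dv"
    and vb: "\<And>x. norm (v x) \<le> 1"
    and m: "\<And>p. p \<in> U \<Longrightarrow> m p = (if p \<in> half_open_box l u then v p else n p)"
  shows "SBV U m"
proof -
  let ?B = "half_open_box l u"
  let ?\<Gamma> = "cbox l u - box l u"
  have BU: "?B \<subseteq> U" using half_open_box_subset(2) U(2) by blast
  have vc: "continuous_on UNIV v"
    by (intro continuous_at_imp_continuous_on ballI has_derivative_continuous[OF v])
  have vm [measurable]: "v \<in> borel_measurable borel" using vc by (rule borel_measurable_continuous_onI)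
  have Dvm [measurable]: "Dv \<in> borel_measurable borel" using Dv by (rule borel_measurable_continuous_onI)
  have Ub [measurable]: "U \<in> sets borel" using U(1) by simp
  have ind_cont: "integrable lborel (\<lambda>p. indicator ?B p *\<^sub>R f p)" if "continuous_on UNIV f"
    for f :: "real^3 \<Rightarrow> 'b::{banach,second_countable_topology}"
  proof -
    have "set_integrable lborel (cbox l u) f" unfolding set_integrable_def
      using that by (intro borel_integrable_compact) (auto intro: continuous_on_subset)
    then have "set_integrable lborel ?B f"
      by (rule set_integrable_subset) (use half_open_box_subset(2) in auto)
    then show ?thesis by (simp add: set_integrable_def)
  qed
  have mi: "set_integrable lebesgue U m"
  proof -
    have "set_integrable lebesgue ?B v"
      unfolding set_integrable_def by (subst integrable_completion) (use ind_cont[OF vc] in auto)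
    moreover have "set_integrable lebesgue (U - ?B) n"
      using n by (rule set_integrable_subset) auto
    ultimately have "integrable lebesgue (\<lambda>p. indicator ?B p *\<^sub>R v p + indicator (U - ?B) p *\<^sub>R n p)"
      unfolding set_integrable_def by (rule Bochner_Integration.integrable_add)
    also have "(\<lambda>p. indicator ?B p *\<^sub>R v p + indicator (U - ?B) p *\<^sub>R n p) = (\<lambda>p. indicator U p *\<^sub>R m p)"
      using m BU by (auto simp: fun_eq_iff indicator_def)
    finally show ?thesis by (simp add: set_integrable_def)
  qed
  have fin: "finite_measure \<mu>" and s\<mu> [measurable_cong]: "sets \<mu> = sets borel" and \<mu>U: "AE x in \<mu>. x \<in> U"
    and \<sigma>m [measurable]: "\<sigma> \<in> borel_measurable borel" and \<sigma>1: "AE x in \<mu>. norm (\<sigma> x) = 1"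
    and test: "\<And>\<phi> D\<phi> i j. test_function_on U \<phi> D\<phi> \<Longrightarrow>
        (LINT x:U|lebesgue. n x $ i * D\<phi> x $ j) = - (LINT x|\<mu>. \<phi> x * \<sigma> x $ i $ j)"
    using D unfolding distributional_derivative_def by auto
  interpret \<mu>: finite_measure \<mu> by fact
  \<comment> \<open>Index \<open>(j, b)\<close> is the face normal to \<open>j\<close>, upper if
    \<open>b\<close> holds; \<open>Inr True\<close> stands for \<open>Dn\<close> and
    \<open>Inr False\<close> for \<open>Dv\<close>. Crossing an upper face in the positive direction
    leads from \<open>v\<close> to \<open>F\<close>, crossing a lower face from \<open>F\<close> to
    \<open>v\<close>; hence the signs in \<open>g\<close>.\<close>
  define fc where "fc j b = (if b then u $ j else l $ j)" for j b
  define M :: "(3 \<times> bool) + bool \<Rightarrow> (real^3) measure" where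
    "M k = (case k of Inl (j, b) \<Rightarrow> face_measure l u j (fc j b)
        | Inr b \<Rightarrow> if b then \<mu> else density lborel (indicator ?B))" for k
  define g :: "(3 \<times> bool) + bool \<Rightarrow> real^3 \<Rightarrow> real^3^3" where
    "g k p = (case k of Inl (j, b) \<Rightarrow> (if b then 1 else - 1) *\<^sub>R column_matrix j (F (p $ 3) - v p)
        | Inr b \<Rightarrow> if b then indicator (- ?B) p *\<^sub>R \<sigma> p else Dv p)" for k p
  have Ms: "M (Inl (j, b)) = face_measure l u j (fc j b)" "M (Inr True) = \<mu>" "M (Inr False) = density lborel (indicator ?B)"
    for j b by (simp_all add: M_def)
  have gs: "g (Inl (j, b)) p = (if b then 1 else - 1) *\<^sub>R column_matrix j (F (p $ 3) - v p)"
    "g (Inr True) p = indicator (- ?B) p *\<^sub>R \<sigma> p" "g (Inr False) p = Dv p" for j b p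
    by (simp_all add: g_def)
  have cases: "P k" if "\<And>j b. P (Inl (j, b))" "P (Inr True)" "P (Inr False)" for P and k :: "(3 \<times> bool) + bool"
    using that by (cases k) (auto split: prod.splits, metis (full_types))
  have face: "AE p in face_measure l u j (fc j b). p \<in> ?\<Gamma>" for j b
    using AE_face_measure
  proof eventually_elim
    case (elim p)
    have "l $ k \<le> p $ k \<and> p $ k \<le> u $ k" for k
      using elim lu[of k] by (cases "k = j") (auto simp: fc_def less_imp_le)
    moreover have "\<not> (l $ j < p $ j \<and> p $ j < u $ j)" using elim by (auto simp: fc_def)
    ultimately show ?case unfolding Diff_iff mem_box_cart by blast
  qed
  have \<Gamma>: "?\<Gamma> \<in> null_sets lborel" by (rule null_sets_box_frontier)
  \<comment> \<open>Here the generic position of the box enters. Up to a \<mu>-null set, points lie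
    either in the open box, where \<open>Dn\<close> is discarded, or off the closed box, where
    \<open>m\<close> is locally \<open>n\<close>.\<close>
  have \<mu>\<Gamma>: "AE p in \<mu>. p \<notin> ?\<Gamma>"
  proof -
    have "AE p in \<mu>. \<forall>k\<in>UNIV. p $ k \<noteq> l $ k \<and> p $ k \<noteq> u $ k"
      by (intro AE_finite_allI) (use gen in auto)
    then show ?thesis
    proof eventually_elim
      case (elim p)
      show ?case
      proof
        assume "p \<in> ?\<Gamma>"
        then obtain k where "l $ k \<le> p $ k" "p $ k \<le> u $ k" "\<not> (l $ k < p $ k \<and> p $ k < u $ k)"
          unfolding Diff_iff mem_box_cart by blast
        moreover have "p $ k \<noteq> l $ k \<and> p $ k \<noteq> u $ k" using elim by blast
        ultimately show False by linarith
      qed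
    qed
  qed
  have cm [measurable]: "column_matrix j \<in> borel_measurable borel" for j
    by (intro borel_measurable_continuous_onI linear_continuous_on bounded_linear_column_matrix)
  \<comment> \<open>With the frontier added, the surface measures have no mass off
    \<open>N'\<close>, so their absolute continuity there is trivial.\<close>
  define N' where "N' = N \<union> ?\<Gamma>"
  have N': "N' \<in> null_sets lborel" unfolding N'_def using N(1) \<Gamma> by (rule null_sets.Un)
  have N'b [measurable]: "N' \<in> sets borel" "N \<in> sets borel" using N' N(1) by auto
  have fs: "finite_measure (density lborel (indicator ?B))"
  proof (rule finite_measureI)
    have "emeasure lborel ?B \<le> emeasure lborel (cbox l u)" using half_open_box_subset(2) by (intro emeasure_mono) auto
    also have "\<dots> < \<infinity>" by (simp add: emeasure_lborel_cbox_eq)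
    finally show "emeasure (density lborel (indicator ?B)) (space (density lborel (indicator ?B))) \<noteq> \<infinity>"
      by (subst emeasure_density) auto
  qed
  show ?thesis
  proof (rule SBV_intro[of U m UNIV M g N'])
    show "set_integrable lebesgue U m" by (rule mi)
    show "finite_measure (M k)" for k
      by (rule cases[of "\<lambda>k. finite_measure (M k)"]) (simp_all add: Ms finite_measure_face fin fs)
    show "sets (M k) = sets borel" for k
      by (rule cases[of "\<lambda>k. sets (M k) = sets borel"]) (simp_all add: Ms s\<mu>)
    show "AE x in M k. x \<in> U" for k
    proof (rule cases[of "\<lambda>k. AE x in M k. x \<in> U"])
      show "AE x in M (Inl (j, b)). x \<in> U" for j b
        unfolding Ms using face by eventually_elim (use U(2) in auto)
      show "AE x in M (Inr False). x \<in> U"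
        unfolding Ms using BU by (subst AE_density) (auto simp: indicator_def)
      show "AE x in M (Inr True). x \<in> U" unfolding Ms by (rule \<mu>U)
    qed
    show "g k \<in> borel_measurable borel" for k
    proof (rule cases[of "\<lambda>k. g k \<in> borel_measurable borel"])
      show "g (Inl (j, b)) \<in> borel_measurable borel" for j b unfolding gs[abs_def] by measurable
      show "g (Inr True) \<in> borel_measurable borel" unfolding gs[abs_def] by measurable
      show "g (Inr False) \<in> borel_measurable borel" unfolding gs[abs_def] by measurable
    qed
    show "integrable (M k) (g k)" for k
    proof (rule cases[of "\<lambda>k. integrable (M k) (g k)"])
      fix j b
      interpret f: finite_measure "face_measure l u j (fc j b)" by (rule finite_measure_face)
      obtain K where K: "K > 0" "\<And>q. norm (column_matrix j q) \<le> norm q * K"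
        using bounded_linear.pos_bounded[OF bounded_linear_column_matrix] by blast
      have "norm (column_matrix j (F (p $ 3) - v p)) \<le> 2 * K" for p
      proof -
        have "norm (F (p $ 3) - v p) \<le> 2" using norm_triangle_ineq4[of "F (p $ 3)" "v p"] F[of "p $ 3"] vb[of p] by linarith
        then have "norm (F (p $ 3) - v p) * K \<le> 2 * K" using K(1) by (intro mult_right_mono) auto
        then show ?thesis using K(2)[of "F (p $ 3) - v p"] by linarith
      qed
      then show "integrable (M (Inl (j, b))) (g (Inl (j, b)))"
        unfolding Ms gs[abs_def] by (intro f.integrable_const_bound[of _ "2 * K"] AE_I2) (auto, measurable)
    next
      show "integrable (M (Inr True)) (g (Inr True))"
        unfolding Ms gs[abs_def]
      proof (rule \<mu>.integrable_const_bound[of _ 1])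
        show "AE x in \<mu>. norm (indicator (- ?B) x *\<^sub>R \<sigma> x) \<le> 1" using \<sigma>1 by eventually_elim (auto simp: indicator_def)
      qed measurable
      have "integrable (density lborel (\<lambda>x. ennreal (indicator ?B x))) Dv"
        by (subst integrable_density) (use ind_cont[OF Dv] in auto)
      then show "integrable (M (Inr False)) (g (Inr False))"
        unfolding Ms gs[abs_def] by (simp add: ennreal_indicator)
    qed
    show "N' \<in> null_sets lborel" by (rule N')
    show "absolutely_continuous lborel (density (M k) (indicator (- N')))" for k
    proof (rule cases[of "\<lambda>k. absolutely_continuous lborel (density (M k) (indicator (- N')))"])
      fix j b
      show "absolutely_continuous lborel (density (M (Inl (j, b))) (indicator (- N')))"
        unfolding Ms
      proof (subst absolutely_continuous_density_iff, goal_cases)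
        case 3
        show ?case
        proof
          fix A :: "(real^3) set" assume A: "A \<in> null_sets lborel"
          have "AE p in face_measure l u j (fc j b). p \<notin> A - N'"
            using face by eventually_elim (auto simp: N'_def)
          moreover have "A - N' \<in> sets (face_measure l u j (fc j b))" using A by auto
          ultimately show "emeasure (face_measure l u j (fc j b)) (A - N') = 0"
            using AE_iff_null_sets by blast
        qed
      qed auto
    next
      have "\<forall>A\<in>null_sets lborel. emeasure \<mu> (A - N) = 0"
        using N(2) by (subst (asm) absolutely_continuous_density_iff[OF s\<mu>]) auto
      moreover have "emeasure \<mu> (A - N') \<le> emeasure \<mu> (A - N)" if "A \<in> null_sets lborel" for A
        using that by (intro emeasure_mono) (auto simp: N'_def s\<mu>)
      ultimately have "\<forall>A\<in>null_sets lborel. emeasure \<mu> (A - N') = 0" by (metis le_zero_eq)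
      then show "absolutely_continuous lborel (density (M (Inr True)) (indicator (- N')))"
        unfolding Ms by (subst absolutely_continuous_density_iff[OF s\<mu>]) auto
      show "absolutely_continuous lborel (density (M (Inr False)) (indicator (- N')))"
        unfolding Ms
      proof (subst absolutely_continuous_density_iff, goal_cases)
        case 3
        show ?case
        proof
          fix A :: "(real^3) set" assume A: "A \<in> null_sets lborel"
          have "AE x in lborel. x \<notin> A" using A by (rule AE_not_in)
          then have "AE x in density lborel (indicator ?B). x \<notin> A - N'"
            by (subst AE_density) (auto elim!: eventually_mono)
          moreover have "A - N' \<in> sets (density lborel (indicator ?B))" using A by auto
          ultimately show "emeasure (density lborel (indicator ?B)) (A - N') = 0"
            using AE_iff_null_sets by blast
        qed
      qed auto
    qed
    show "AE x in M k. x \<in> N' \<longrightarrow> g k x \<noteq> 0 \<longrightarrow> x \<in> approx_discontinuity_set m" for k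
    proof (rule cases[of "\<lambda>k. AE x in M k. x \<in> N' \<longrightarrow> g k x \<noteq> 0 \<longrightarrow> x \<in> approx_discontinuity_set m"])
      have "AE x in lborel. x \<notin> N'" using N' by (rule AE_not_in)
      then show "AE x in M (Inr False). x \<in> N' \<longrightarrow> g (Inr False) x \<noteq> 0 \<longrightarrow> x \<in> approx_discontinuity_set m"
        unfolding Ms by (subst AE_density) (auto elim!: eventually_mono)
      show "AE x in M (Inr True). x \<in> N' \<longrightarrow> g (Inr True) x \<noteq> 0 \<longrightarrow> x \<in> approx_discontinuity_set m"
        unfolding Ms using \<mu>U N(3) \<mu>\<Gamma>
      proof eventually_elim
        case (elim x)
        show ?case
        proof (intro impI)
          assume x: "x \<in> N'" "g (Inr True) x \<noteq> 0"
          then have "x \<notin> ?B" by (auto simp: gs)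
          then have xc: "x \<notin> cbox l u" using elim half_open_box_subset(1) by blast
          have "x \<in> approx_discontinuity_set n" using elim x by (auto simp: N'_def)
          moreover have "x \<in> approx_discontinuity_set m \<longleftrightarrow> x \<in> approx_discontinuity_set n"
          proof (rule approx_discontinuity_set_local[of "U - cbox l u"])
            show "open (U - cbox l u)" using U(1) by auto
            show "x \<in> U - cbox l u" using elim xc by auto
            show "m y = n y" if "y \<in> U - cbox l u" for y using that m half_open_box_subset(2) by auto
          qed
          ultimately show "x \<in> approx_discontinuity_set m" by simp
        qed
      qed
    next
      fix j b
      \<comment> \<open>Horizontal faces lie at Lebesgue points by choice; on vertical ones almost
        every point does.\<close>
      have nLP: "AE p in face_measure l u j (fc j b). lebesgue_point F (p $ 3)"
      proof (cases "j = 3")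
        case True
        show ?thesis using AE_face_measure by eventually_elim (use True LF in \<open>auto simp: fc_def\<close>)
      next
        case False
        have "{c. \<not> lebesgue_point F c} \<in> null_sets lebesgue"
          using negligible_not_lebesgue_point[OF Fm F] by (simp add: negligible_iff_null_sets)
        then obtain N0 where N0: "N0 \<in> null_sets lborel" "{c. \<not> lebesgue_point F c} \<subseteq> N0"
          by (auto simp: null_sets_completion_iff2)
        have "AE p in face_measure l u j (fc j b). p $ 3 \<notin> N0"
          by (rule AE_face_measure_component[OF _ N0(1)]) (use False in simp)
        then show ?thesis by eventually_elim (use N0(2) in auto)
      qed
      show "AE x in M (Inl (j, b)). x \<in> N' \<longrightarrow> g (Inl (j, b)) x \<noteq> 0 \<longrightarrow> x \<in> approx_discontinuity_set m"
        unfolding Ms using nLP AE_face_measure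
      proof eventually_elim
        case (elim p)
        have pU: "p \<in> U"
        proof -
          have "l $ k \<le> p $ k \<and> p $ k \<le> u $ k" for k
            using elim lu[of k] by (cases "k = j") (auto simp: fc_def less_imp_le)
          then have "p \<in> cbox l u" by (simp add: mem_box_cart)
          then show ?thesis using U(2) by blast
        qed
        show ?case
        proof (intro impI)
          assume g: "g (Inl (j, b)) p \<noteq> 0"
          have ne: "F (p $ 3) \<noteq> v p"
          proof
            assume "F (p $ 3) = v p"
            then have "g (Inl (j, b)) p = 0" by (simp add: gs vec_eq_iff)
            then show False using g by simp
          qed
          \<comment> \<open>Limits the cube size: in direction \<open>j\<close> the inner cube must
            not reach the opposite face, in the other directions it must stay within the extent of
            the box.\<close>
          define gap where "gap k = (if k = j then u $ k - l $ k else min (u $ k - p $ k) (p $ k - l $ k))" for k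
          obtain r0 where r0: "r0 > 0" "ball p r0 \<subseteq> U" using U(1) pU openE by blast
          define r where "r = min (r0 / 2) (Min (range gap))"
          have gap0: "gap k > 0" for k using lu elim by (auto simp: gap_def)
          have rk: "h < gap k" if "h < r" for h k
          proof -
            have "Min (range gap) \<le> gap k" by (rule Min_le) auto
            then show ?thesis using that by (simp add: r_def)
          qed
          have "Min (range gap) > 0" using gap0 by (subst Min_gr_iff) auto
          then have r: "r > 0" using r0 by (simp add: r_def)
          \<comment> \<open>In direction \<open>j\<close>, \<open>e\<close> points into the box and
            \<open>e'\<close> out of it; the choice in the other directions is arbitrary.\<close>
          define e where "e k = (if k = j then \<not> b else True)" for k
          define e' where "e' k = (if k = j then b else True)" for k
          show "p \<in> approx_discontinuity_set m"
          proof (rule jump_at_face[OF U(1) pU mi n eq Fm F _ _ r])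
            show "lebesgue_point F (p $ 3)" using elim by simp
            show "isCont v p" by (rule has_derivative_continuous[OF v])
            show "F (p $ 3) \<noteq> v p" by (rule ne)
            fix h y assume h: "0 < h" "h < r"
            have sub: "y \<in> U" if "y \<in> corner_cube e'' p h" for e''
            proof -
              have "y \<in> ball p (2 * h)" using corner_cube_subset_ball[OF h(1)] that by blast
              then have "y \<in> ball p r0" using h(2) by (auto simp: r_def)
              then show ?thesis using r0(2) by blast
            qed
            show "m y = v y" if y: "y \<in> corner_cube e p h"
            proof -
              have "l $ k < y $ k \<and> y $ k \<le> u $ k" for k
              proof -
                have yk: "if e k then p $ k + h / 2 \<le> y $ k \<and> y $ k \<le> p $ k + h else p $ k - h \<le> y $ k \<and> y $ k \<le> p $ k - h / 2"
                  using y unfolding mem_corner_cube by blast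
                show ?thesis
                proof (cases "k = j")
                  case True
                  then show ?thesis using yk rk[OF h(2), of k] h(1) elim by (cases b) (auto simp: e_def gap_def fc_def)
                next
                  case False
                  then have "l $ k < p $ k" "p $ k < u $ k" using elim by auto
                  then show ?thesis using yk rk[OF h(2), of k] h(1) False by (auto simp: e_def gap_def)
                qed
              qed
              then have "y \<in> ?B" by (simp add: half_open_box_def)
              then show ?thesis using m[OF sub[OF y]] by simp
            qed
            show "y \<in> U \<and> m y = n y" if y: "y \<in> corner_cube e' p h"
            proof -
              have "if e' j then p $ j + h / 2 \<le> y $ j \<and> y $ j \<le> p $ j + h else p $ j - h \<le> y $ j \<and> y $ j \<le> p $ j - h / 2"
                using y unfolding mem_corner_cube by blast
              then have "\<not> (l $ j < y $ j \<and> y $ j \<le> u $ j)"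
                using h(1) elim by (cases b) (auto simp: e'_def fc_def)
              then have "y \<notin> ?B" by (auto simp: half_open_box_def)
              then show ?thesis using m[OF sub[OF y]] sub[OF y] by simp
            qed
          qed
        qed
      qed
    qed
    fix \<phi> D\<phi> i j assume t: "test_function_on U \<phi> D\<phi>"
    obtain C where C: "compact C" "C \<subseteq> U" "\<And>x. x \<notin> C \<Longrightarrow> \<phi> x = 0" "\<And>x. x \<notin> C \<Longrightarrow> D\<phi> x = 0"
      using test_function_support[OF t] by metis
    have CU: "D\<phi> p = 0" if "p \<notin> U" for p using that C(2,4) by blast
    note [measurable] = test_function_measurable[OF t]
    have \<phi>c: "continuous_on UNIV \<phi>" "continuous_on UNIV D\<phi>"
      using test_function_continuous[OF t] t by (auto simp: test_function_on_def)
    let ?d = "\<lambda>p. (F (p $ 3) - v p) $ i"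
    have Fi: "\<bar>F s $ i\<bar> \<le> 1" for s using component_le_norm_cart[of "F s" i] F[of s] by linarith
    have J2: "integrable lborel (\<lambda>p. F (p $ 3) $ i * D\<phi> p $ j)"
      by (rule integrable_bounded_mult_continuous[OF _ Fi _ C(1)])
        (auto intro!: continuous_intros \<phi>c simp: C)
    have db: "\<bar>indicator ?B p * ?d p\<bar> \<le> 2" for p
    proof -
      have "\<bar>?d p\<bar> \<le> 2"
        using component_le_norm_cart[of "F (p $ 3) - v p" i] norm_triangle_ineq4[of "F (p $ 3)" "v p"] F[of "p $ 3"] vb[of p]
        by linarith
      then show ?thesis by (auto simp: indicator_def)
    qed
    have J3: "integrable lborel (\<lambda>p. (indicator ?B p * ?d p) * D\<phi> p $ j)"
      by (rule integrable_bounded_mult_continuous[OF _ db _ C(1)])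
        (auto intro!: continuous_intros \<phi>c simp: C)
    note J\<sigma> = integrable_distributional_component[OF D t, of i j]
    \<comment> \<open>Almost everywhere on \<open>U\<close>, \<open>m\<close> equals
      \<open>F\<close> minus the restriction of \<open>F - v\<close> to the box.\<close>
    have lhs: "(LINT x:U|lebesgue. m x $ i * D\<phi> x $ j) =
        (LINT p|lborel. F (p $ 3) $ i * D\<phi> p $ j) - (LINT p|lborel. (indicator ?B p * ?d p) * D\<phi> p $ j)"
    proof -
      have mm: "(\<lambda>p. F (p $ 3) $ i * D\<phi> p $ j - (indicator ?B p * ?d p) * D\<phi> p $ j) \<in> borel_measurable borel" by measurable
      have [measurable]: "(\<lambda>p. indicator U p *\<^sub>R m p) \<in> borel_measurable lebesgue" using mi by (auto simp: set_integrable_def)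
      have "(LINT x:U|lebesgue. m x $ i * D\<phi> x $ j) = (LINT x|lebesgue. (indicator U x *\<^sub>R m x) $ i * D\<phi> x $ j)"
        by (simp add: set_lebesgue_integral_def mult.assoc)
      also have "\<dots> = (LINT p|lebesgue. F (p $ 3) $ i * D\<phi> p $ j - (indicator ?B p * ?d p) * D\<phi> p $ j)"
      proof (rule integral_cong_AE)
        have [measurable]: "(\<lambda>p. D\<phi> p $ j) \<in> borel_measurable lebesgue" by (rule measurable_completion) measurable
        show "(\<lambda>x. (indicator U x *\<^sub>R m x) $ i * D\<phi> x $ j) \<in> borel_measurable lebesgue" by measurable
        show "(\<lambda>p. F (p $ 3) $ i * D\<phi> p $ j - (indicator ?B p * ?d p) * D\<phi> p $ j) \<in> borel_measurable lebesgue"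
          by (rule measurable_completion) (use mm in simp)
        show "AE p in lebesgue. (indicator U p *\<^sub>R m p) $ i * D\<phi> p $ j = F (p $ 3) $ i * D\<phi> p $ j - (indicator ?B p * ?d p) * D\<phi> p $ j"
          using eq
        proof eventually_elim
          case (elim p)
          show ?case
          proof (cases "p \<in> U")
            case True
            then show ?thesis using elim m[OF True] by (simp add: left_diff_distrib)
          qed (simp add: CU)
        qed
      qed
      also have "\<dots> = (LINT p|lborel. F (p $ 3) $ i * D\<phi> p $ j - (indicator ?B p * ?d p) * D\<phi> p $ j)"
        by (rule integral_completion) (use mm in simp)
      also have "\<dots> = (LINT p|lborel. F (p $ 3) $ i * D\<phi> p $ j) - (LINT p|lborel. (indicator ?B p * ?d p) * D\<phi> p $ j)"
        by (rule Bochner_Integration.integral_diff[OF J2 J3])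
      finally show ?thesis .
    qed
    have slice: "(LINT p|lborel. F (p $ 3) $ i * D\<phi> p $ j) = - (LINT x|\<mu>. \<phi> x * \<sigma> x $ i $ j)"
      using test[OF t, of i j] set_integral_slice[OF n eq Fm, of "\<lambda>p. D\<phi> p $ j" i] CU by simp
    have div: "(LINT p|face_measure l u j (l $ j). ?d p * \<phi> p) - (LINT p|face_measure l u j (u $ j). ?d p * \<phi> p)
        = - (LINT p|\<mu>. indicator ?B p * (\<phi> p * \<sigma> p $ i $ j))
          + (LINT p|lborel. indicator ?B p * (\<phi> p * Dv p $ i $ j))
          - (LINT p|lborel. indicator ?B p * (?d p * D\<phi> p $ j))"
      by (rule box_divergence[OF D n eq Fm F lu _ _ v Dv t]) (use LF in \<open>auto simp: lebesgue_point_def\<close>)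
    have S1: "(LINT x|M (Inr True). \<phi> x * g (Inr True) x $ i $ j)
        = (LINT x|\<mu>. \<phi> x * \<sigma> x $ i $ j) - (LINT p|\<mu>. indicator ?B p * (\<phi> p * \<sigma> p $ i $ j))"
    proof -
      have i: "integrable \<mu> (\<lambda>p. indicator ?B p * (\<phi> p * \<sigma> p $ i $ j))"
        using integrable_mult_indicator[OF _ J\<sigma>, of ?B] by (simp add: s\<mu>)
      have "(LINT x|M (Inr True). \<phi> x * g (Inr True) x $ i $ j) = (LINT x|\<mu>. \<phi> x * \<sigma> x $ i $ j - indicator ?B x * (\<phi> x * \<sigma> x $ i $ j))"
        unfolding Ms by (intro Bochner_Integration.integral_cong refl) (auto simp: gs indicator_def)
      also have "\<dots> = (LINT x|\<mu>. \<phi> x * \<sigma> x $ i $ j) - (LINT p|\<mu>. indicator ?B p * (\<phi> p * \<sigma> p $ i $ j))"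
        by (rule Bochner_Integration.integral_diff[OF J\<sigma> i])
      finally show ?thesis .
    qed
    have S2: "(LINT x|M (Inr False). \<phi> x * g (Inr False) x $ i $ j) = (LINT p|lborel. indicator ?B p * (\<phi> p * Dv p $ i $ j))"
    proof -
      have "(LINT x|density lborel (\<lambda>x. ennreal (indicator ?B x)). \<phi> x * Dv x $ i $ j) = (LINT x|lborel. indicator ?B x *\<^sub>R (\<phi> x * Dv x $ i $ j))"
        by (rule integral_density) auto
      then show ?thesis by (simp add: Ms gs ennreal_indicator)
    qed
    \<comment> \<open>Only the faces normal to \<open>j\<close> have an entry in column
      \<open>j\<close>.\<close>
    have S3: "(LINT x|M (Inl (j', b)). \<phi> x * g (Inl (j', b)) x $ i $ j)
        = (if j' = j then (if b then 1 else - 1) * (LINT p|face_measure l u j (fc j b). ?d p * \<phi> p) else 0)" for j' b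
      by (cases b) (auto simp: Ms gs mult.commute)
    have S: "(\<Sum>k\<in>UNIV. LINT x|M k. \<phi> x * g k x $ i $ j) = (LINT x|M (Inr True). \<phi> x * g (Inr True) x $ i $ j)
        + (LINT x|M (Inr False). \<phi> x * g (Inr False) x $ i $ j)
        + (LINT p|face_measure l u j (u $ j). ?d p * \<phi> p) - (LINT p|face_measure l u j (l $ j). ?d p * \<phi> p)"
    proof -
      have "(\<Sum>k\<in>UNIV. LINT x|M k. \<phi> x * g k x $ i $ j) = (\<Sum>jb\<in>UNIV. LINT x|M (Inl jb). \<phi> x * g (Inl jb) x $ i $ j)
          + (\<Sum>b\<in>UNIV. LINT x|M (Inr b). \<phi> x * g (Inr b) x $ i $ j)"
        by (simp only: UNIV_Plus_UNIV[symmetric] sum.Plus finite) (simp add: o_def)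
      also have "(\<Sum>jb\<in>UNIV. LINT x|M (Inl jb). \<phi> x * g (Inl jb) x $ i $ j)
          = (\<Sum>j'\<in>UNIV. \<Sum>b\<in>UNIV. LINT x|M (Inl (j', b)). \<phi> x * g (Inl (j', b)) x $ i $ j)"
        by (simp only: UNIV_Times_UNIV[symmetric] sum.cartesian_product) (simp add: split_beta)
      also have "\<dots> = (\<Sum>j'\<in>UNIV. if j' = j then (LINT p|face_measure l u j (u $ j). ?d p * \<phi> p) - (LINT p|face_measure l u j (l $ j). ?d p * \<phi> p) else 0)"
        by (intro sum.cong refl) (simp add: S3 UNIV_bool fc_def)
      also have "\<dots> = (LINT p|face_measure l u j (u $ j). ?d p * \<phi> p) - (LINT p|face_measure l u j (l $ j). ?d p * \<phi> p)"
        by simp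
      finally show ?thesis by (simp add: UNIV_bool)
    qed
    show "(LINT x:U|lebesgue. m x $ i * D\<phi> x $ j) = - (\<Sum>k\<in>UNIV. LINT x|M k. \<phi> x * g k x $ i $ j)"
      unfolding S S1 S2 lhs slice using div by (simp add: mult.assoc)
  qed simp_all
qed

section \<open>The double twist\<close>

lemma w_eq:
  "w t q G = (norm G)\<^sup>2 + 2 * t * (q $ 1 * (G $ 3 $ 2 - G $ 2 $ 3) + q $ 2 * (G $ 1 $ 3 - G $ 3 $ 1) + q $ 3 * (G $ 2 $ 1 - G $ 1 $ 2))
     + t\<^sup>2 * (norm q)\<^sup>2"
  by (simp add: w_def curl_of_def inner_vec_def sum_3)

lemma norm_vec3_squared: "(norm (q :: real^3))\<^sup>2 = (q $ 1)\<^sup>2 + (q $ 2)\<^sup>2 + (q $ 3)\<^sup>2"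
  unfolding power2_norm_eq_inner by (simp add: inner_vec_def sum_3 power2_eq_square)

lemma norm_mat3_squared: "(norm (G :: real^3^3))\<^sup>2 = (norm (G $ 1))\<^sup>2 + (norm (G $ 2))\<^sup>2 + (norm (G $ 3))\<^sup>2"
  unfolding power2_norm_eq_inner by (simp add: inner_vec_def sum_3)

text \<open>With only the third column present, the curl term is
  \<open>2 * t * (q $ 2 * G $ 1 $ 3 - q $ 1 * G $ 2 $ 3)\<close> and completes two squares. The
  density becomes negative only by twisting in more than one direction.\<close>

lemma w_nonneg:
  assumes "\<And>i. G $ i $ 1 = 0" "\<And>i. G $ i $ 2 = 0"
  shows "0 \<le> w t q G"
proof -
  have "w t q G = (G $ 1 $ 3 + t * q $ 2)\<^sup>2 + (G $ 2 $ 3 - t * q $ 1)\<^sup>2 + (G $ 3 $ 3)\<^sup>2 + (t * q $ 3)\<^sup>2"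
    unfolding w_eq norm_mat3_squared norm_vec3_squared
    by (simp add: assms power2_eq_square algebra_simps)
  then show ?thesis by simp
qed

definition twist_scale :: "real \<Rightarrow> real^3 \<Rightarrow> real^3 \<Rightarrow> real" where
  "twist_scale t c p = inverse (sqrt (1 + t\<^sup>2 * ((p $ 1 - c $ 1)\<^sup>2 + (p $ 2 - c $ 2)\<^sup>2)))"

definition twist_dir :: "real \<Rightarrow> real^3 \<Rightarrow> real^3 \<Rightarrow> real^3" where
  "twist_dir t c p = (t * (p $ 2 - c $ 2)) *\<^sub>R axis 1 1 - (t * (p $ 1 - c $ 1)) *\<^sub>R axis 2 1 + axis 3 1"

text \<open>The double twist around the vertical line through \<open>c\<close>.\<close>

definition twist :: "real \<Rightarrow> real^3 \<Rightarrow> real^3 \<Rightarrow> real^3" where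
  "twist t c p = twist_scale t c p *\<^sub>R twist_dir t c p"

definition twist_grad :: "real \<Rightarrow> real^3 \<Rightarrow> real^3 \<Rightarrow> real^3^3" where
  "twist_grad t c p = (\<chi> i k. twist_scale t c p * (if i = 1 \<and> k = 2 then t else if i = 2 \<and> k = 1 then - t else 0)
     - t\<^sup>2 * twist_scale t c p ^ 3 * (twist_dir t c p $ i * (if k = 3 then 0 else p $ k - c $ k)))"

lemma twist_dir_nth [simp]:
  "twist_dir t c p $ 1 = t * (p $ 2 - c $ 2)" "twist_dir t c p $ 2 = - (t * (p $ 1 - c $ 1))" "twist_dir t c p $ 3 = 1"
  by (simp_all add: twist_dir_def axis_def)

lemma twist_radius_pos: "1 + t\<^sup>2 * ((p $ 1 - c $ 1)\<^sup>2 + (p $ 2 - c $ 2)\<^sup>2) > (0::real)"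
proof -
  have "t\<^sup>2 * ((p $ 1 - c $ 1)\<^sup>2 + (p $ 2 - c $ 2)\<^sup>2) \<ge> 0" by (intro mult_nonneg_nonneg) auto
  then show ?thesis by linarith
qed

lemma twist_scale_squared:
  "(twist_scale t c p)\<^sup>2 = 1 / (1 + t\<^sup>2 * ((p $ 1 - c $ 1)\<^sup>2 + (p $ 2 - c $ 2)\<^sup>2))"
  using twist_radius_pos[of t p c] by (simp add: twist_scale_def inverse_eq_divide power_divide)

lemma norm_twist: "norm (twist t c p) = 1"
proof -
  have "(norm (twist t c p))\<^sup>2 = (twist_scale t c p)\<^sup>2 * (1 + t\<^sup>2 * ((p $ 1 - c $ 1)\<^sup>2 + (p $ 2 - c $ 2)\<^sup>2))"
    unfolding norm_vec3_squared twist_def by (simp add: power2_eq_square algebra_simps)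
  also have "\<dots> = 1" using twist_radius_pos[of t p c] by (simp add: twist_scale_squared)
  finally show ?thesis by (simp add: power2_eq_1_iff) (use norm_ge_zero[of "twist t c p"] in linarith)
qed

text \<open>With \<open>s = twist_scale t c p\<close>, the relation
  \<open>s\<^sup>2 * (1 + t\<^sup>2 * r\<^sup>2) = 1\<close> eliminates the distance
  \<open>r\<close> from the axis. On the axis \<open>s = 1\<close>, and the density is
  \<open>- t\<^sup>2\<close>.\<close>

lemma w_twist:
  "w t (twist t c p) (twist_grad t c p) = t\<^sup>2 * (1 - 3 * (twist_scale t c p)\<^sup>2 + (twist_scale t c p)^4)"
proof -
  define s x y where "s = twist_scale t c p" and "x = p $ 1 - c $ 1" and "y = p $ 2 - c $ 2"
  have s: "s\<^sup>2 * (1 + t\<^sup>2 * (x\<^sup>2 + y\<^sup>2)) = 1"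
    using twist_radius_pos[of t p c] unfolding s_def x_def y_def by (simp add: twist_scale_squared)
  have entries: "twist_grad t c p $ 1 $ 1 = - (t\<^sup>2 * s^3 * (t * y * x))" "twist_grad t c p $ 1 $ 2 = s * t - t\<^sup>2 * s^3 * (t * y * y)"
    "twist_grad t c p $ 2 $ 1 = - (s * t - t\<^sup>2 * s^3 * (t * x * x))" "twist_grad t c p $ 2 $ 2 = t\<^sup>2 * s^3 * (t * x * y)"
    "twist_grad t c p $ 3 $ 1 = - (t\<^sup>2 * s^3 * x)" "twist_grad t c p $ 3 $ 2 = - (t\<^sup>2 * s^3 * y)" "twist_grad t c p $ i $ 3 = 0" for i
    by (simp_all add: twist_grad_def s_def[symmetric] x_def[symmetric] y_def[symmetric])
  have "(norm (twist_grad t c p))\<^sup>2 =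
      (t\<^sup>2 * s^3 * (t * y * x))\<^sup>2 + (s * t - t\<^sup>2 * s^3 * (t * y * y))\<^sup>2 + (s * t - t\<^sup>2 * s^3 * (t * x * x))\<^sup>2 + (t\<^sup>2 * s^3 * (t * x * y))\<^sup>2
      + (t\<^sup>2 * s^3 * x)\<^sup>2 + (t\<^sup>2 * s^3 * y)\<^sup>2"
    unfolding norm_mat3_squared norm_vec3_squared entries by (simp add: power2_commute)
  also have "\<dots> = t\<^sup>2 * s\<^sup>2 + t\<^sup>2 * s^4" using s by algebra
  finally have n: "(norm (twist_grad t c p))\<^sup>2 = t\<^sup>2 * s\<^sup>2 + t\<^sup>2 * s^4" .
  have "w t (twist t c p) (twist_grad t c p) = t\<^sup>2 * s\<^sup>2 + t\<^sup>2 * s^4 - 4 * t\<^sup>2 * s\<^sup>2 + t\<^sup>2"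
    unfolding w_eq n norm_twist entries
    by (simp add: twist_def s_def[symmetric] x_def[symmetric] y_def[symmetric])
      (simp add: power2_eq_square power3_eq_cube algebra_simps)
  then show ?thesis unfolding s_def by (simp add: algebra_simps)
qed

lemma w_twist_le:
  assumes "t\<^sup>2 * ((p $ 1 - c $ 1)\<^sup>2 + (p $ 2 - c $ 2)\<^sup>2) \<le> 1 / 3"
  shows "w t (twist t c p) (twist_grad t c p) \<le> - (t\<^sup>2 / 2)"
proof -
  define \<tau> where "\<tau> = (twist_scale t c p)\<^sup>2"
  have "3 / 4 \<le> \<tau>" "\<tau> \<le> 1"
    using assms twist_radius_pos[of t p c] mult_nonneg_nonneg[of "t\<^sup>2" "(p $ 1 - c $ 1)\<^sup>2 + (p $ 2 - c $ 2)\<^sup>2"]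
    unfolding \<tau>_def twist_scale_squared by (auto simp: le_divide_eq divide_le_eq)
  \<comment> \<open>The lower bound \<open>3 / 4\<close> is \<open>1 / (1 + 1 / 3)\<close>. The
    other root \<open>9 / 4\<close> makes the roots add up to 3, so the product differs from
    \<open>1 - 3 * \<tau> + \<tau>\<^sup>2\<close> by a constant; the resulting bound
    \<open>- 11 / 16\<close> is weakened to \<open>- 1 / 2\<close>.\<close>
  then have "(\<tau> - 3 / 4) * (\<tau> - 9 / 4) \<le> 0" by (intro mult_nonneg_nonpos) auto
  moreover have "(\<tau> - 3 / 4) * (\<tau> - 9 / 4) = \<tau>\<^sup>2 - 3 * \<tau> + 27 / 16" by (simp add: power2_eq_square field_simps)
  ultimately have "1 - 3 * \<tau> + \<tau>\<^sup>2 \<le> - (1 / 2)" by linarith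
  then have "t\<^sup>2 * (1 - 3 * \<tau> + \<tau>\<^sup>2) \<le> t\<^sup>2 * - (1 / 2)" by (intro mult_left_mono) auto
  then show ?thesis by (simp add: w_twist \<tau>_def power_mult[symmetric])
qed

lemma has_derivative_twist: "(twist t c has_derivative (\<lambda>h. twist_grad t c p *v h)) (at p)"
proof -
  define R where "R p = 1 + t\<^sup>2 * ((p $ 1 - c $ 1)\<^sup>2 + (p $ 2 - c $ 2)\<^sup>2)" for p :: "real^3"
  have Rp: "R p > 0" unfolding R_def by (rule twist_radius_pos)
  have comp: "((\<lambda>p::real^3. p $ k) has_derivative (\<lambda>h. h $ k)) (at p)" for k
    by (rule bounded_linear_imp_has_derivative[OF bounded_linear_vec_nth])
  have Rd: "(R has_derivative (\<lambda>h. 2 * t\<^sup>2 * ((p $ 1 - c $ 1) * h $ 1 + (p $ 2 - c $ 2) * h $ 2))) (at p)"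
    unfolding R_def by (auto intro!: derivative_eq_intros comp simp: algebra_simps)
  have "((\<lambda>r. inverse (sqrt r)) has_real_derivative - (inverse (sqrt (R p)) ^ 3 / 2)) (at (R p))"
    using Rp by (auto intro!: derivative_eq_intros simp: power3_eq_cube divide_simps)
  note Id = has_derivative_compose[OF Rd this[unfolded has_field_derivative_def]]
  have sR: "twist_scale t c = (\<lambda>p. inverse (sqrt (R p)))" by (simp add: fun_eq_iff twist_scale_def R_def)
  have sd: "(twist_scale t c has_derivative (\<lambda>h. - (t\<^sup>2 * twist_scale t c p ^ 3 * ((p $ 1 - c $ 1) * h $ 1 + (p $ 2 - c $ 2) * h $ 2)))) (at p)"
    unfolding sR by (rule has_derivative_eq_rhs[OF Id]) (simp add: fun_eq_iff)
  have Nd: "(twist_dir t c has_derivative (\<lambda>h. (t * h $ 2) *\<^sub>R axis 1 1 - (t * h $ 1) *\<^sub>R axis 2 1)) (at p)"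
    unfolding twist_dir_def[abs_def] by (auto intro!: derivative_eq_intros comp)
  have "(\<lambda>h. twist_scale t c p *\<^sub>R ((t * h $ 2) *\<^sub>R axis 1 1 - (t * h $ 1) *\<^sub>R axis 2 1)
      + (- (t\<^sup>2 * twist_scale t c p ^ 3 * ((p $ 1 - c $ 1) * h $ 1 + (p $ 2 - c $ 2) * h $ 2))) *\<^sub>R twist_dir t c p)
      = (\<lambda>h. twist_grad t c p *v h)"
    by (auto simp: fun_eq_iff vec_eq_iff forall_3 matrix_vector_mult_def sum_3 twist_grad_def axis_def algebra_simps)
  then show ?thesis
    using has_derivative_scaleR[OF sd Nd] unfolding twist_def[abs_def] by simp
qed

lemma continuous_twist_grad: "continuous_on UNIV (twist_grad t c)"
proof -
  have "sqrt (1 + t\<^sup>2 * ((p $ 1 - c $ 1)\<^sup>2 + (p $ 2 - c $ 2)\<^sup>2)) \<noteq> 0" for p :: "real^3"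
    using twist_radius_pos[of t p c] by simp
  then have s: "continuous_on UNIV (twist_scale t c)"
    unfolding twist_scale_def by (intro continuous_on_inverse continuous_intros) auto
  have d: "continuous_on UNIV (twist_dir t c)"
    unfolding twist_dir_def by (intro continuous_intros)
  show ?thesis
    unfolding twist_grad_def
  proof (intro continuous_on_vec_lambda)
    fix i k
    have "continuous_on UNIV (\<lambda>p::real^3. if k = 3 then 0 else p $ k - c $ k)"
      by (cases "k = 3") (auto intro!: continuous_intros)
    then show "continuous_on UNIV (\<lambda>p. twist_scale t c p * (if i = 1 \<and> k = 2 then t else if i = 2 \<and> k = 1 then - t else 0)
       - t\<^sup>2 * twist_scale t c p ^ 3 * (twist_dir t c p $ i * (if k = 3 then 0 else p $ k - c $ k)))"
      by (intro continuous_on_diff continuous_on_mult continuous_on_const continuous_on_power continuous_on_component s d)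
  qed
qed

section \<open>The competitor and its energy\<close>

text \<open>A finite measure has at most countably many atoms. For the image of \<mu> under the
  \<open>k\<close>-th coordinate this excludes a null set of values, and an open interval does not
  fit into a null set.\<close>

lemma generic_coordinate:
  assumes "finite_measure \<mu>" "sets \<mu> = sets (borel :: (real^3) measure)" "negligible Z" "\<alpha> < \<beta>"
  obtains c where "\<alpha> < c" "c < \<beta>" "c \<notin> Z" "AE p in \<mu>. p $ k \<noteq> c"
proof -
  interpret finite_measure \<mu> by fact
  note [measurable_cong] = assms(2)
  have sp: "space \<mu> = UNIV" using assms(2) sets_eq_imp_space_eq by force
  interpret D: finite_measure "distr \<mu> borel (\<lambda>p. p $ k)" by (rule finite_measure_distr) measurable
  define Y where "Y = {c. measure (distr \<mu> borel (\<lambda>p. p $ k)) {c} \<noteq> 0}"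
  have "countable Y" unfolding Y_def by (rule D.countable_support)
  then have "negligible Y"
    by (simp add: negligible_iff_null_sets null_sets_completionI countable_imp_null_set_lborel)
  then have ZY: "negligible (Z \<union> Y)" using assms(3) by simp
  have "\<not> negligible {\<alpha><..<\<beta>}" using open_not_negligible[of "{\<alpha><..<\<beta>}"] assms(4) by simp
  then have "\<not> {\<alpha><..<\<beta>} \<subseteq> Z \<union> Y" using negligible_subset[OF ZY] by blast
  then have "\<exists>c. \<alpha> < c \<and> c < \<beta> \<and> c \<notin> Z \<and> c \<notin> Y" by auto
  then obtain c where c: "\<alpha> < c" "c < \<beta>" "c \<notin> Z" "c \<notin> Y" by blast
  have "measure (distr \<mu> borel (\<lambda>p. p $ k)) {c} = measure \<mu> {p. p $ k = c}"
    by (subst measure_distr) (auto simp: sp vimage_def, measurable)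
  then have "measure \<mu> {p. p $ k = c} = 0" using c(4) by (simp add: Y_def)
  moreover have "{p. p $ k = c} \<in> sets \<mu>" unfolding assms(2) by measurable
  ultimately have "{p. p $ k = c} \<in> null_sets \<mu>" by (simp add: null_sets_def emeasure_eq_measure)
  then have "AE p in \<mu>. p $ k \<noteq> c" by (rule AE_I') auto
  then show ?thesis using that c by blast
qed

lemma Omega_eq_box: "Omega L1 L2 d = box (vector [- L1, - L2, 0]) (vector [L1, L2, d])"
  by (auto simp: Omega_def mem_box_cart forall_3)

text \<open>A shift by a multiple of \<open>axis k 1\<close> leaves coordinate \<open>j\<close>
  unchanged, so \<open>n\<close> is invariant under it almost everywhere.\<close>

lemma approx_gradient_slice:
  fixes n :: "real^3 \<Rightarrow> real^3"
  assumes U: "open U" "x \<in> U" and n: "set_integrable lebesgue U n"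
    and eq: "AE p in lebesgue. p \<in> U \<longrightarrow> n p = F (p $ j)" and k: "k \<noteq> j"
  shows "approx_gradient n x $ i $ k = 0"
proof (rule approx_gradient_column_zero[OF U n])
  fix s
  show "AE y in lebesgue. y \<in> U \<longrightarrow> y + s *\<^sub>R axis k 1 \<in> U \<longrightarrow> n (y + s *\<^sub>R axis k 1) = n y"
    using eq AE_lebesgue_translation[OF eq, of "s *\<^sub>R axis k 1"]
    by eventually_elim (use k in \<open>auto simp: axis_def\<close>)
qed

text \<open>\<open>energy_on\<close> uses the Bochner integral, which would be 0 for a
  non-integrable density, so the comparison of energies rests on this. The curl term is linear in
  \<open>G\<close> and is absorbed by \<open>2 * |G| \<le> 1 + |G|\<^sup>2\<close>.\<close>

lemma set_integrable_w:
  fixes q :: "real^3 \<Rightarrow> real^3" and G :: "real^3 \<Rightarrow> real^3^3"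
  assumes U: "U \<in> sets borel" "emeasure lborel U < \<infinity>"
    and q: "(\<lambda>p. indicator U p *\<^sub>R q p) \<in> borel_measurable lebesgue" and qb: "AE p in lebesgue. p \<in> U \<longrightarrow> norm (q p) \<le> 1"
    and G: "(\<lambda>p. indicator U p *\<^sub>R G p) \<in> borel_measurable lebesgue"
    and G2: "set_integrable lebesgue U (\<lambda>p. (norm (G p))\<^sup>2)" and t: "t \<ge> 0"
  shows "set_integrable lebesgue U (\<lambda>p. w t (q p) (G p))"
  unfolding set_integrable_def
proof (rule Bochner_Integration.integrable_bound)
  let ?q = "\<lambda>p. indicator U p *\<^sub>R q p" and ?G = "\<lambda>p. indicator U p *\<^sub>R G p"
  let ?b = "\<lambda>p. indicator U p *\<^sub>R ((1 + 6 * t) * (norm (G p))\<^sup>2 + (6 * t + t\<^sup>2))"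
  have "(\<lambda>p. w t (?q p) (?G p)) \<in> borel_measurable lebesgue"
    unfolding w_eq using q G by measurable
  also have "(\<lambda>p. w t (?q p) (?G p)) = (\<lambda>p. indicator U p *\<^sub>R w t (q p) (G p))"
    by (auto simp: fun_eq_iff indicator_def w_eq)
  finally show "(\<lambda>p. indicator U p *\<^sub>R w t (q p) (G p)) \<in> borel_measurable lebesgue" .
  have "set_integrable lebesgue U (\<lambda>p. 6 * t + t\<^sup>2)"
    unfolding set_integrable_def using U by (intro integrable_scaleR_left) (simp add: integrable_indicator_iff less_top)
  then have "set_integrable lebesgue U (\<lambda>p. (1 + 6 * t) * (norm (G p))\<^sup>2 + (6 * t + t\<^sup>2))"
    by (rule set_integral_add(1)[OF set_integrable_mult_right[OF G2]])
  then show "integrable lebesgue ?b" by (simp add: set_integrable_def)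
  show "AE p in lebesgue. norm (indicator U p *\<^sub>R w t (q p) (G p)) \<le> norm (?b p)"
    using qb
  proof eventually_elim
    case (elim p)
    have "\<bar>w t (q p) (G p)\<bar> \<le> (1 + 6 * t) * (norm (G p))\<^sup>2 + (6 * t + t\<^sup>2)" if qn: "norm (q p) \<le> 1"
    proof -
      have e: "\<bar>G p $ i $ k\<bar> \<le> norm (G p)" for i k
        using component_le_norm_cart[of "G p $ i" k] Finite_Cartesian_Product.norm_nth_le[of "G p" i] by linarith
      have qk: "\<bar>q p $ k\<bar> \<le> 1" for k using component_le_norm_cart[of "q p" k] qn by linarith
      have bd: "\<bar>q p $ k * (G p $ i $ j - G p $ i' $ j')\<bar> \<le> 2 * norm (G p)" for k i j i' j'
      proof -
        have "\<bar>G p $ i $ j - G p $ i' $ j'\<bar> \<le> 2 * norm (G p)" using e[of i j] e[of i' j'] by linarith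
        then have "\<bar>q p $ k\<bar> * \<bar>G p $ i $ j - G p $ i' $ j'\<bar> \<le> 1 * (2 * norm (G p))"
          using qk[of k] by (intro mult_mono) auto
        then show ?thesis by (simp add: abs_mult)
      qed
      define c where "c = q p $ 1 * (G p $ 3 $ 2 - G p $ 2 $ 3) + q p $ 2 * (G p $ 1 $ 3 - G p $ 3 $ 1) + q p $ 3 * (G p $ 2 $ 1 - G p $ 1 $ 2)"
      have "\<bar>c\<bar> \<le> 6 * norm (G p)"
        unfolding c_def using bd[of 1 3 2 2 3] bd[of 2 1 3 3 1] bd[of 3 2 1 1 2] by linarith
      also have "\<dots> \<le> 3 * (1 + (norm (G p))\<^sup>2)"
        using zero_le_power2[of "norm (G p) - 1"] by (simp add: power2_eq_square algebra_simps)
      finally have "2 * t * \<bar>c\<bar> \<le> 2 * t * (3 * (1 + (norm (G p))\<^sup>2))" using t by (intro mult_left_mono) auto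
      then have "\<bar>2 * t * c\<bar> \<le> 6 * t + 6 * t * (norm (G p))\<^sup>2" using t by (simp add: abs_mult algebra_simps)
      moreover have "t\<^sup>2 * (norm (q p))\<^sup>2 \<le> t\<^sup>2 * 1" using qn by (intro mult_left_mono power_le_one) auto
      moreover have "w t (q p) (G p) = (norm (G p))\<^sup>2 + 2 * t * c + t\<^sup>2 * (norm (q p))\<^sup>2" by (simp add: w_eq c_def)
      moreover have "0 \<le> t\<^sup>2 * (norm (q p))\<^sup>2" "0 \<le> (norm (G p))\<^sup>2" by auto
      moreover have "(1 + 6 * t) * (norm (G p))\<^sup>2 = (norm (G p))\<^sup>2 + 6 * t * (norm (G p))\<^sup>2" by (simp add: algebra_simps)
      ultimately show ?thesis by linarith
    qed
    then show ?case using elim by (cases "p \<in> U") auto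
  qed
qed

section \<open>Gradient, jump set and energy after a replacement in a box\<close>

locale box_replacement =
  fixes U :: "(real^3) set" and l u :: "real^3" and n m v :: "real^3 \<Rightarrow> real^3" and Dv :: "real^3 \<Rightarrow> real^3^3"
  assumes U: "open U" "cbox l u \<subseteq> U"
    and v: "\<And>x. (v has_derivative (\<lambda>h. Dv x *v h)) (at x)" and Dv: "continuous_on UNIV Dv"
    and m: "\<And>p. p \<in> U \<Longrightarrow> m p = (if p \<in> half_open_box l u then v p else n p)"
begin

lemma v_continuous: "continuous_on UNIV v"
  by (intro continuous_at_imp_continuous_on ballI has_derivative_continuous[OF v])

lemma inside_eq: "y \<in> box l u \<Longrightarrow> m y = v y"
  using m half_open_box_subset(1)[of l u] U(2) box_subset_cbox[of l u] by (metis subsetD)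

lemma outside_eq: "y \<in> U - cbox l u \<Longrightarrow> m y = n y"
  using m half_open_box_subset(2)[of l u] by auto

lemma open_outside: "open (U - cbox l u)"
  using U(1) by auto

lemma gradient_inside:
  assumes "p \<in> box l u"
  shows "approx_gradient m p = Dv p"
  using approx_gradient_local[OF open_box assms inside_eq] approx_gradient_derivative[OF v_continuous v] by simp

lemma gradient_outside: "p \<in> U - cbox l u \<Longrightarrow> approx_gradient m p = approx_gradient n p"
  by (rule approx_gradient_local[OF open_outside _ outside_eq])

text \<open>Inside the box \<open>v\<close> is continuous, and off the closed box \<open>m\<close>
  is locally \<open>n\<close>, so new discontinuities can only lie on the frontier.\<close>

lemma discontinuity_subset:
  assumes "A \<subseteq> U"
  shows "A \<inter> approx_discontinuity_set m \<subseteq> (A \<inter> approx_discontinuity_set n) \<union> (cbox l u - box l u)"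
proof
  fix p assume p: "p \<in> A \<inter> approx_discontinuity_set m"
  consider "p \<in> box l u" | "p \<in> cbox l u - box l u" | "p \<in> U - cbox l u" using p assms by blast
  then show "p \<in> (A \<inter> approx_discontinuity_set n) \<union> (cbox l u - box l u)"
  proof cases
    case 1
    have "isCont v p" by (rule has_derivative_continuous[OF v])
    then have "p \<notin> approx_discontinuity_set v"
      using approx_limit_continuous unfolding approx_discontinuity_set_def by blast
    then show ?thesis using approx_discontinuity_set_local[OF open_box 1 inside_eq] p by simp
  next
    case 3
    then show ?thesis using approx_discontinuity_set_local[OF open_outside 3 outside_eq] p by simp
  qed auto
qed

text \<open>The frontier is null, so the half-open box in the definition of \<open>m\<close> may be
  exchanged for the open one, on which gradients are local.\<close>

lemma AE_replaced:
  "AE p in lebesgue. p \<in> U \<longrightarrow> m p = (if p \<in> box l u then v p else n p) \<and>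
     approx_gradient m p = (if p \<in> box l u then Dv p else approx_gradient n p)"
  using AE_completion[OF AE_not_in[OF null_sets_box_frontier[of l u]]]
proof eventually_elim
  case (elim p)
  show ?case
    using elim inside_eq[of p] outside_eq[of p] gradient_inside[of p] gradient_outside[of p] by auto
qed

lemma SBV2_replace:
  assumes n: "SBV2 U n" and mS: "SBV U m" and s: "s > 0" "\<And>k. u $ k \<le> l $ k + s"
  shows "SBV2 U m"
proof -
  have Ub: "U \<in> sets borel" "U \<in> sets lebesgue" using U(1) by auto
  have gn: "approx_gradient n \<in> borel_measurable (lebesgue_on U)"
    and gn2: "set_integrable lebesgue U (\<lambda>p. (norm (approx_gradient n p))\<^sup>2)"
    and hn: "hausdorff 2 (U \<inter> approx_discontinuity_set n) < \<infinity>"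
    using n by (auto simp: SBV2_def)
  have bU: "box l u \<subseteq> U" using U(2) box_subset_cbox[of l u] by blast
  have gn': "(\<lambda>p. indicator U p *\<^sub>R approx_gradient n p) \<in> borel_measurable lebesgue"
    using gn Ub(2) by (simp add: borel_measurable_restrict_space_iff)
  have Dvm: "Dv \<in> borel_measurable lebesgue"
    by (rule measurable_completion) (use borel_measurable_continuous_onI[OF Dv] in simp)
  let ?g = "\<lambda>p. indicator (box l u) p *\<^sub>R Dv p + indicator (- box l u) p *\<^sub>R (indicator U p *\<^sub>R approx_gradient n p)"
  have "?g \<in> borel_measurable lebesgue"
    by (intro borel_measurable_add borel_measurable_scaleR borel_measurable_indicator Dvm gn') auto
  moreover have "AE p in lebesgue. ?g p = indicator U p *\<^sub>R approx_gradient m p"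
    using AE_replaced by eventually_elim (use bU in \<open>auto simp: indicator_def\<close>)
  ultimately have gm': "(\<lambda>p. indicator U p *\<^sub>R approx_gradient m p) \<in> borel_measurable lebesgue"
    by (rule borel_measurable_AE)
  have "set_integrable lborel (cbox l u) (\<lambda>p. (norm (Dv p))\<^sup>2)"
    unfolding set_integrable_def
    by (intro borel_integrable_compact continuous_intros continuous_on_subset[OF Dv]) auto
  then have "set_integrable lborel (box l u) (\<lambda>p. (norm (Dv p))\<^sup>2)"
    by (rule set_integrable_subset) (use box_subset_cbox in auto)
  then have i1: "integrable lebesgue (\<lambda>p. indicator (box l u) p *\<^sub>R (norm (Dv p))\<^sup>2)"
    unfolding set_integrable_def by (subst integrable_completion) auto
  have i2: "integrable lebesgue (\<lambda>p. indicator (U - box l u) p *\<^sub>R (norm (approx_gradient n p))\<^sup>2)"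
    using set_integrable_subset[OF gn2, of "U - box l u"] Ub by (auto simp: set_integrable_def)
  have "integrable lebesgue (\<lambda>p. indicator U p *\<^sub>R (norm (approx_gradient m p))\<^sup>2)"
  proof (rule integrable_cong_AE_imp[OF Bochner_Integration.integrable_add[OF i1 i2]])
    have "(\<lambda>p. (norm (indicator U p *\<^sub>R approx_gradient m p))\<^sup>2) \<in> borel_measurable lebesgue"
      using gm' by measurable
    also have "(\<lambda>p. (norm (indicator U p *\<^sub>R approx_gradient m p))\<^sup>2) = (\<lambda>p. indicator U p *\<^sub>R (norm (approx_gradient m p))\<^sup>2)"
      by (auto simp: fun_eq_iff indicator_def)
    finally show "(\<lambda>p. indicator U p *\<^sub>R (norm (approx_gradient m p))\<^sup>2) \<in> borel_measurable lebesgue" .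
    show "AE p in lebesgue. indicator (box l u) p *\<^sub>R (norm (Dv p))\<^sup>2 + indicator (U - box l u) p *\<^sub>R (norm (approx_gradient n p))\<^sup>2
        = indicator U p *\<^sub>R (norm (approx_gradient m p))\<^sup>2"
      using AE_replaced by eventually_elim (use bU in \<open>auto simp: indicator_def\<close>)
  qed
  moreover have "hausdorff 2 (U \<inter> approx_discontinuity_set m) < \<infinity>"
  proof -
    have "hausdorff 2 (U \<inter> approx_discontinuity_set m) \<le> hausdorff 2 ((U \<inter> approx_discontinuity_set n) \<union> (cbox l u - box l u))"
      by (rule hausdorff_mono[OF discontinuity_subset]) simp
    also have "\<dots> \<le> hausdorff 2 (U \<inter> approx_discontinuity_set n) + hausdorff 2 (cbox l u - box l u)" by (rule hausdorff_Un)
    also have "\<dots> \<le> hausdorff 2 (U \<inter> approx_discontinuity_set n) + ennreal (6 * pi * s\<^sup>2)"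
      by (intro add_left_mono hausdorff_frontier_box s)
    also have "\<dots> < \<infinity>" using hn by simp
    finally show ?thesis .
  qed
  moreover have "approx_gradient m \<in> borel_measurable (lebesgue_on U)"
    using gm' Ub(2) by (simp add: borel_measurable_restrict_space_iff)
  ultimately show ?thesis using mS by (simp add: SBV2_def set_integrable_def)
qed

lemma energy_integral_le:
  assumes A: "A \<in> sets borel" "cbox l u \<subseteq> A" "A \<subseteq> U"
    and Wn: "set_integrable lebesgue A (\<lambda>p. w t (n p) (approx_gradient n p))"
    and Wn0: "AE p in lebesgue. p \<in> A \<longrightarrow> 0 \<le> w t (n p) (approx_gradient n p)"
    and \<kappa>: "\<And>p. p \<in> box l u \<Longrightarrow> w t (v p) (Dv p) \<le> - \<kappa>"
  shows "(LINT p:A|lebesgue. w t (m p) (approx_gradient m p))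
      \<le> (LINT p:A|lebesgue. w t (n p) (approx_gradient n p)) - \<kappa> * measure lebesgue (box l u)"
proof -
  let ?Wn = "\<lambda>p. w t (n p) (approx_gradient n p)" and ?Wm = "\<lambda>p. w t (m p) (approx_gradient m p)"
  let ?Wv = "\<lambda>p. w t (v p) (Dv p)"
  have Al: "A \<in> sets lebesgue" using A(1) by simp
  have bc: "box l u \<subseteq> cbox l u" by (rule box_subset_cbox)
  have "continuous_on UNIV ?Wv"
    unfolding w_eq by (intro continuous_intros v_continuous Dv)
  then have "set_integrable lborel (cbox l u) ?Wv"
    unfolding set_integrable_def by (intro borel_integrable_compact) (auto intro: continuous_on_subset)
  then have "set_integrable lborel (box l u) ?Wv"
    by (rule set_integrable_subset) (use bc in auto)
  then have iv: "integrable lebesgue (\<lambda>p. indicator (box l u) p *\<^sub>R ?Wv p)"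
    unfolding set_integrable_def by (subst integrable_completion) auto
  have "box l u \<in> sets lebesgue" by simp
  then have "A - box l u \<in> sets lebesgue" by (rule sets.Diff[OF Al])
  then have io: "integrable lebesgue (\<lambda>p. indicator (A - box l u) p *\<^sub>R ?Wn p)"
    using set_integrable_subset[OF Wn, of "A - box l u"] unfolding set_integrable_def by blast
  have ae: "AE p in lebesgue. indicator (A - box l u) p *\<^sub>R ?Wn p + indicator (box l u) p *\<^sub>R ?Wv p = indicator A p *\<^sub>R ?Wm p"
    using AE_replaced by eventually_elim (use bc A in \<open>auto simp: indicator_def\<close>)
  have "(LINT p:A|lebesgue. ?Wm p) = (LINT p|lebesgue. indicator (A - box l u) p *\<^sub>R ?Wn p + indicator (box l u) p *\<^sub>R ?Wv p)"
    unfolding set_lebesgue_integral_def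
  proof (rule integral_cong_AE)
    show m: "(\<lambda>p. indicator (A - box l u) p *\<^sub>R ?Wn p + indicator (box l u) p *\<^sub>R ?Wv p) \<in> borel_measurable lebesgue"
      using Bochner_Integration.integrable_add[OF io iv] by (rule borel_measurable_integrable)
    show "(\<lambda>p. indicator A p *\<^sub>R ?Wm p) \<in> borel_measurable lebesgue" by (rule borel_measurable_AE[OF m ae])
    show "AE p in lebesgue. indicator A p *\<^sub>R ?Wm p = indicator (A - box l u) p *\<^sub>R ?Wn p + indicator (box l u) p *\<^sub>R ?Wv p"
      using ae by eventually_elim simp
  qed
  also have "\<dots> = (LINT p|lebesgue. indicator (A - box l u) p *\<^sub>R ?Wn p) + (LINT p|lebesgue. indicator (box l u) p *\<^sub>R ?Wv p)"
    by (rule Bochner_Integration.integral_add[OF io iv])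
  also have "\<dots> \<le> (LINT p:A|lebesgue. ?Wn p) + (LINT p|lebesgue. indicator (box l u) p *\<^sub>R (- \<kappa>))"
  proof (rule add_mono)
    show "(LINT p|lebesgue. indicator (A - box l u) p *\<^sub>R ?Wn p) \<le> (LINT p:A|lebesgue. ?Wn p)"
      unfolding set_lebesgue_integral_def
    proof (rule integral_mono_AE[OF io])
      show "integrable lebesgue (\<lambda>p. indicator A p *\<^sub>R ?Wn p)" using Wn by (simp add: set_integrable_def)
      show "AE p in lebesgue. indicator (A - box l u) p *\<^sub>R ?Wn p \<le> indicator A p *\<^sub>R ?Wn p"
        using Wn0 by eventually_elim (auto simp: indicator_def)
    qed
    have "integrable lebesgue (\<lambda>p. indicator (box l u) p *\<^sub>R (- \<kappa>))"
      by (intro integrable_scaleR_left) (simp add: integrable_indicator_iff emeasure_lborel_box_eq)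
    then show "(LINT p|lebesgue. indicator (box l u) p *\<^sub>R ?Wv p) \<le> (LINT p|lebesgue. indicator (box l u) p *\<^sub>R (- \<kappa>))"
      using \<kappa> by (intro integral_mono[OF iv]) (auto simp: indicator_def)
  qed
  also have "(LINT p|lebesgue. indicator (box l u) p *\<^sub>R (- \<kappa>)) = - \<kappa> * measure lebesgue (box l u)"
    by simp
  finally show ?thesis by simp
qed

end

text \<open>Translation by periods into the cell \<open>[-L1, L1) \<times> [-L2, L2)\<close>.
  Admissible maps are periodic on the whole slab, so the replacement in the box has to be repeated
  in every cell.\<close>

definition fold_cell :: "real \<Rightarrow> real \<Rightarrow> real^3 \<Rightarrow> real^3" where
  "fold_cell L1 L2 p = vector [p $ 1 - 2 * L1 * of_int \<lfloor>(p $ 1 + L1) / (2 * L1)\<rfloor>,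
     p $ 2 - 2 * L2 * of_int \<lfloor>(p $ 2 + L2) / (2 * L2)\<rfloor>, p $ 3]"

lemma fold_cell_eq:
  assumes "L1 > 0" "L2 > 0" "- L1 < p $ 1" "p $ 1 < L1" "- L2 < p $ 2" "p $ 2 < L2"
  shows "fold_cell L1 L2 p = p"
proof -
  have "\<lfloor>(p $ 1 + L1) / (2 * L1)\<rfloor> = 0" "\<lfloor>(p $ 2 + L2) / (2 * L2)\<rfloor> = 0"
    using assms by (auto simp: floor_eq_iff divide_simps)
  then show ?thesis by (simp add: fold_cell_def vec_eq_iff forall_3)
qed

lemma fold_cell_periodic:
  assumes "L1 > 0" "L2 > 0"
  shows "fold_cell L1 L2 (p + axis 1 (2 * L1)) = fold_cell L1 L2 p"
    and "fold_cell L1 L2 (p + axis 2 (2 * L2)) = fold_cell L1 L2 p"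
proof -
  have "(p $ 1 + 2 * L1 + L1) / (2 * L1) = (p $ 1 + L1) / (2 * L1) + 1" "(p $ 2 + 2 * L2 + L2) / (2 * L2) = (p $ 2 + L2) / (2 * L2) + 1"
    using assms by (auto simp: field_simps)
  then have "\<lfloor>(p $ 1 + 2 * L1 + L1) / (2 * L1)\<rfloor> = \<lfloor>(p $ 1 + L1) / (2 * L1)\<rfloor> + 1" "\<lfloor>(p $ 2 + 2 * L2 + L2) / (2 * L2)\<rfloor> = \<lfloor>(p $ 2 + L2) / (2 * L2)\<rfloor> + 1"
    by simp_all
  then show "fold_cell L1 L2 (p + axis 1 (2 * L1)) = fold_cell L1 L2 p"
    and "fold_cell L1 L2 (p + axis 2 (2 * L2)) = fold_cell L1 L2 p"
    by (simp_all add: fold_cell_def vec_eq_iff forall_3 axis_def algebra_simps)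
qed

lemma fold_cell_nth_3 [simp]: "fold_cell L1 L2 p $ 3 = p $ 3"
  by (simp add: fold_cell_def)

lemma AE_lebesgue_on_iff:
  assumes "S \<in> sets lebesgue"
  shows "(AE p in lebesgue_on S. P p) \<longleftrightarrow> (AE p in lebesgue. p \<in> S \<longrightarrow> P p)"
  using assms by (subst AE_restrict_space_iff) auto

text \<open>The lower vertex is chosen in the first quarter of \<open>{q $ k..q $ k + s}\<close> and
  the upper one in the last quarter, coordinate by coordinate. Each quarter has room to avoid both
  \<open>Z\<close> and the atoms, and the sides remain longer than \<open>s / 2\<close>.\<close>

lemma cube_vertices:
  assumes \<mu>: "finite_measure \<mu>" "sets \<mu> = sets (borel :: (real^3) measure)" and Z: "negligible Z" and s: "s > 0"
  obtains l u :: "real^3" where "\<And>k. q $ k < l $ k" "\<And>k. u $ k < q $ k + s" "\<And>k. l $ k + s / 2 < u $ k"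
    "\<And>k. l $ k \<notin> Z" "\<And>k. u $ k \<notin> Z" "\<And>k. AE p in \<mu>. p $ k \<noteq> l $ k" "\<And>k. AE p in \<mu>. p $ k \<noteq> u $ k"
proof -
  have "\<exists>c. \<alpha> < c \<and> c < \<beta> \<and> c \<notin> Z \<and> (AE p in \<mu>. p $ k \<noteq> c)" if "\<alpha> < \<beta>" for \<alpha> \<beta> and k :: 3
    by (rule generic_coordinate[OF \<mu> Z that, of k]) blast
  then have "\<exists>c. q $ k < c \<and> c < q $ k + s / 4 \<and> c \<notin> Z \<and> (AE p in \<mu>. p $ k \<noteq> c)"
    "\<exists>c. q $ k + 3 * s / 4 < c \<and> c < q $ k + s \<and> c \<notin> Z \<and> (AE p in \<mu>. p $ k \<noteq> c)" for k
    using s by simp_all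
  then have "\<exists>f. \<forall>k. q $ k < f k \<and> f k < q $ k + s / 4 \<and> f k \<notin> Z \<and> (AE p in \<mu>. p $ k \<noteq> f k)"
    "\<exists>g. \<forall>k. q $ k + 3 * s / 4 < g k \<and> g k < q $ k + s \<and> g k \<notin> Z \<and> (AE p in \<mu>. p $ k \<noteq> g k)"
    by (intro choice allI; simp)+
  then obtain f g where fg: "\<And>k. q $ k < f k \<and> f k < q $ k + s / 4 \<and> f k \<notin> Z \<and> (AE p in \<mu>. p $ k \<noteq> f k)"
    "\<And>k. q $ k + 3 * s / 4 < g k \<and> g k < q $ k + s \<and> g k \<notin> Z \<and> (AE p in \<mu>. p $ k \<noteq> g k)"
    by blast
  have "f k + s / 2 < g k" for k using fg(1)[of k] fg(2)[of k] by linarith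
  then show ?thesis using fg by (intro that[of "\<chi> k. f k" "\<chi> k. g k"]) simp_all
qed

text \<open>Finiteness of \<open>hn\<close> allows its cancellation from both sides; \<gamma> is the
  added area and \<delta> the bulk gain.\<close>

lemma ennreal_energy_gap:
  fixes a b K \<delta> \<gamma> :: real and hn hm :: ennreal
  assumes "ereal a + ereal K * enn2ereal hn \<le> ereal b + ereal K * enn2ereal hm"
    and "hn < \<infinity>" "hm \<le> hn + ennreal \<gamma>" "b \<le> a - \<delta>" "K > 0" "\<gamma> \<ge> 0" "K * \<gamma> < \<delta>"
  shows False
proof -
  obtain r where r: "r \<ge> 0" "hn = ennreal r" using assms(2) by (cases hn) auto
  have hm: "hm \<le> ennreal (r + \<gamma>)" using assms(3,6) r by simp
  then obtain r' where r': "r' \<ge> 0" "hm = ennreal r'" by (cases hm) (auto simp: top_unique)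
  have "r' \<le> r + \<gamma>" using hm assms(6) r(1) unfolding r'(2) by (subst (asm) ennreal_le_iff) auto
  then have "K * r' \<le> K * r + K * \<gamma>" using assms(5) by (simp add: distrib_left[symmetric])
  moreover have "a + K * r \<le> b + K * r'" using assms(1) r r' by (simp add: enn2ereal_ennreal)
  ultimately show False using assms(4,7) by linarith
qed

theorem corollary9p6:
  fixes L1 L2 d K \<epsilon> :: real
  assumes "L1 > 0" and "L2 > 0" and "d > 0" and "K > 0" and "\<epsilon> > 0"
  shows "\<exists>tbar > 0. \<forall>t > tbar. \<forall>n.
           admissible L1 L2 d \<epsilon> n \<and> depends_only_on_z L1 L2 d n \<longrightarrow>
           \<not> local_minimiser L1 L2 d \<epsilon> K t n"
proof (intro exI conjI allI impI notI)
  \<comment> \<open>The first entry comes from the energy balance at the end; the others let a cube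
    of side \<open>1 / (3 * t)\<close> fit into the domain.\<close>
  define tbar where "tbar = max (288 * pi * K) (max (1 / L1) (max (1 / L2) (1 / d)))"
  show "tbar > 0" using assms by (simp add: tbar_def less_max_iff_disj)
  fix t n
  assume t: "tbar < t" and n: "admissible L1 L2 d \<epsilon> n \<and> depends_only_on_z L1 L2 d n"
    and locmin: "local_minimiser L1 L2 d \<epsilon> K t n"
  have t0: "t > 0" using t \<open>tbar > 0\<close> by linarith
  \<comment> \<open>The axis will be the line through a vertical edge of a box with sides at most
    \<open>s\<close>, so squared distances from it are at most \<open>2 * s\<^sup>2\<close>, and
    \<open>t\<^sup>2 * (2 * s\<^sup>2) = 2 / 9\<close> is within the bound \<open>1 / 3\<close> of
    \<open>w_twist_le\<close>.\<close>
  define s where "s = 1 / (3 * t)"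
  have s0: "s > 0" using t0 by (simp add: s_def)
  have tK: "288 * pi * K < t" and tL: "1 / L1 < t" "1 / L2 < t" "1 / d < t" using t by (auto simp: tbar_def)
  have sL: "s < L1" "s < L2" "s < d / 2"
    using tL t0 assms(1-3) by (auto simp: s_def field_simps)
  define a b :: "real^3" where "a = vector [- L1, - L2, 0]" and "b = vector [L1, L2, d]"
  let ?U = "Omega L1 L2 d"
  have Ubox: "?U = box a b" by (simp add: Omega_eq_box a_def b_def)
  have Uo: "open ?U" unfolding Ubox by (rule open_box)
  have Us: "?U \<in> sets borel" "?U \<in> sets lebesgue" by (simp_all add: Ubox)
  have ab: "a $ k < b $ k" for k using assms exhaust_3[of k] by (auto simp: a_def b_def)
  have nS2: "SBV2 ?U n" and nSBV: "SBV ?U n" using n by (auto simp: admissible_def SBV2_def)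
  have ni: "set_integrable lebesgue ?U n" using nSBV by (simp add: SBV_def)
  have nval: "AE p in lebesgue. p \<in> ?U \<longrightarrow> n p \<in> sphere 0 1 \<union> {0}"
    using n Us by (simp add: admissible_def AE_lebesgue_on_iff)
  have nb: "AE p in lebesgue. p \<in> ?U \<longrightarrow> norm (n p) \<le> 1"
    using nval by eventually_elim auto
  obtain f where f: "AE p in lebesgue. p \<in> ?U \<longrightarrow> n p = f (p $ 3)"
    using n Us by (auto simp: depends_only_on_z_def AE_lebesgue_on_iff)
  obtain F where Fm: "F \<in> borel_measurable borel" and F1: "\<And>s. norm (F s) \<le> 1"
    and eq: "AE p in lebesgue. p \<in> ?U \<longrightarrow> n p = F (p $ 3)"
    using slice_function[OF ab ni[unfolded Ubox] nb[unfolded Ubox] f[unfolded Ubox]] unfolding Ubox by blast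
  obtain \<mu> \<sigma> N where D: "distributional_derivative ?U n \<mu> \<sigma>" and N: "N \<in> null_sets lborel"
      "absolutely_continuous lborel (density \<mu> (indicator (- N)))"
      "AE x in \<mu>. x \<in> N \<longrightarrow> x \<in> approx_discontinuity_set n"
    using nSBV unfolding SBV_def by blast
  have \<mu>: "finite_measure \<mu>" "sets \<mu> = sets borel" using D by (auto simp: distributional_derivative_def)
  \<comment> \<open>The centre of the domain. The open cube \<open>A\<close> with lower vertex
    \<open>q\<close> and side \<open>s\<close> is the set on which energies are compared, and the
    replacement box lies strictly inside it.\<close>
  define q :: "real^3" where "q = vector [0, 0, d / 2]"
  define A where "A = box q (\<chi> k. q $ k + s)"
  obtain l u where lu: "\<And>k. q $ k < l $ k" "\<And>k. u $ k < q $ k + s" "\<And>k. l $ k + s / 2 < u $ k"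
    and LP: "\<And>k. l $ k \<notin> {c. \<not> lebesgue_point F c}" "\<And>k. u $ k \<notin> {c. \<not> lebesgue_point F c}"
    and gen: "\<And>k. AE p in \<mu>. p $ k \<noteq> l $ k" "\<And>k. AE p in \<mu>. p $ k \<noteq> u $ k"
    by (rule cube_vertices[OF \<mu> negligible_not_lebesgue_point[OF Fm F1] s0, of q]) blast
  have lu_less: "l $ k < u $ k" for k using lu(3)[of k] s0 by linarith
  have cA: "cbox l u \<subseteq> A"
  proof
    fix p assume p: "p \<in> cbox l u"
    have "q $ k < p $ k \<and> p $ k < q $ k + s" for k
    proof -
      have "l $ k \<le> p $ k \<and> p $ k \<le> u $ k" using p by (simp add: mem_box_cart)
      then show ?thesis using lu(1)[of k] lu(2)[of k] by linarith
    qed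
    then show "p \<in> A" by (simp add: A_def mem_box_cart)
  qed
  have clA: "closure A \<subseteq> cbox q (\<chi> k. q $ k + s)"
    unfolding A_def by (intro closure_minimal box_subset_cbox closed_cbox)
  have qU: "cbox q (\<chi> k. q $ k + s) \<subseteq> ?U"
    using sL assms by (auto simp: Omega_def q_def mem_box_cart forall_3)
  have AU: "A \<subseteq> ?U" using clA qU closure_subset by blast
  have cU: "cbox l u \<subseteq> ?U" using cA AU by blast
  define v where "v = twist t l"
  define Dv where "Dv = twist_grad t l"
  have v: "(v has_derivative (\<lambda>h. Dv x *v h)) (at x)" for x unfolding v_def Dv_def by (rule has_derivative_twist)
  have Dvc: "continuous_on UNIV Dv" unfolding Dv_def by (rule continuous_twist_grad)
  have v1: "norm (v x) = 1" for x by (simp add: v_def norm_twist)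
  \<comment> \<open>The twist is evaluated at the folded point, which makes the replacement
    periodic; elsewhere the value of \<open>n\<close> is kept, which is periodic almost everywhere
    in the slab.\<close>
  define m where "m p = (let p' = fold_cell L1 L2 p in if p' \<in> half_open_box l u then v p' else n p)" for p
  have fold: "fold_cell L1 L2 p = p" if "p \<in> Omega_ext L1 L2 d \<epsilon>" for p
    using that assms by (intro fold_cell_eq) (auto simp: Omega_ext_def)
  have UE: "?U \<subseteq> Omega_ext L1 L2 d \<epsilon>" using assms by (auto simp: Omega_def Omega_ext_def)
  have mE: "m p = (if p \<in> half_open_box l u then v p else n p)" if "p \<in> Omega_ext L1 L2 d \<epsilon>" for p
    using fold[OF that] by (simp add: m_def)
  then have mU: "m p = (if p \<in> half_open_box l u then v p else n p)" if "p \<in> ?U" for p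
    using that UE by blast
  interpret box_replacement ?U l u n m v Dv
    by unfold_locales (use Uo cU v Dvc mU in auto)
  have us: "u $ k \<le> l $ k + s" for k using lu(1)[of k] lu(2)[of k] by linarith
  have mSBV: "SBV ?U m"
  proof (rule SBV_replace_box[OF Uo cU lu_less D ni N eq Fm F1 _ _ gen v Dvc _ mU])
    show "lebesgue_point F (l $ 3)" "lebesgue_point F (u $ 3)" using LP by blast+
    show "norm (v x) \<le> 1" for x by (simp add: v1)
  qed
  have mS2: "SBV2 ?U m" by (rule SBV2_replace[OF nS2 mSBV s0 us])
  \<comment> \<open>The replaced region does not meet the outer layers, so the values prescribed
    there are untouched.\<close>
  have B3: "0 < p $ 3 \<and> p $ 3 < d" if "fold_cell L1 L2 p \<in> half_open_box l u" for p
  proof -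
    have "fold_cell L1 L2 p \<in> ?U" using that half_open_box_subset(2) cU by blast
    then show ?thesis by (simp add: Omega_def)
  qed
  have adm: "admissible L1 L2 d \<epsilon> m"
    unfolding admissible_def
  proof (intro conjI mS2)
    show "AE p in lebesgue_on ?U. m p \<in> sphere 0 1 \<union> {0}"
      unfolding AE_lebesgue_on_iff[OF Us(2)] using nval
      by eventually_elim (auto simp: mU v1)
    have "AE p in lebesgue. - \<epsilon> < p $ 3 \<and> p $ 3 < 0 \<longrightarrow> n p = axis 1 1" using n by (simp add: admissible_def)
    then show "AE p in lebesgue. - \<epsilon> < p $ 3 \<and> p $ 3 < 0 \<longrightarrow> m p = axis 1 1"
      by eventually_elim (use B3 in \<open>fastforce simp: m_def Let_def\<close>)
    have "AE p in lebesgue. d < p $ 3 \<and> p $ 3 < d + \<epsilon> \<longrightarrow> n p = axis 3 1" using n by (simp add: admissible_def)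
    then show "AE p in lebesgue. d < p $ 3 \<and> p $ 3 < d + \<epsilon> \<longrightarrow> m p = axis 3 1"
      by eventually_elim (use B3 in \<open>fastforce simp: m_def Let_def\<close>)
    have "AE p in lebesgue. - \<epsilon> < p $ 3 \<and> p $ 3 < d + \<epsilon> \<longrightarrow>
        n (p + axis 1 (2 * L1)) = n p \<and> n (p + axis 2 (2 * L2)) = n p" using n by (simp add: admissible_def)
    then show "AE p in lebesgue. - \<epsilon> < p $ 3 \<and> p $ 3 < d + \<epsilon> \<longrightarrow>
        m (p + axis 1 (2 * L1)) = m p \<and> m (p + axis 2 (2 * L2)) = m p"
      by eventually_elim (simp add: m_def Let_def fold_cell_periodic assms)
  qed
  have "energy_on t K A n \<le> energy_on t K A m"
  proof -
    have "open A" unfolding A_def by (rule open_box)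
    moreover have "compactly_inside A (Omega_ext L1 L2 d \<epsilon>)"
    proof -
      have "compact (closure A)" by (simp add: A_def compact_closure)
      moreover have "closure A \<subseteq> Omega_ext L1 L2 d \<epsilon>" using clA qU UE by blast
      ultimately show ?thesis by (simp add: compactly_inside_def)
    qed
    moreover have "\<exists>B. compactly_inside B A \<and> (AE p in lebesgue_on (Omega_ext L1 L2 d \<epsilon>). p \<notin> B \<longrightarrow> n p = m p)"
    proof (intro exI conjI)
      show "compactly_inside (cbox l u) A" using cA by (simp add: compactly_inside_def)
      show "AE p in lebesgue_on (Omega_ext L1 L2 d \<epsilon>). p \<notin> cbox l u \<longrightarrow> n p = m p"
        using mE half_open_box_subset(2)[of l u] by (intro AE_I2) auto
    qed
    ultimately show ?thesis using locmin adm unfolding local_minimiser_def by blast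
  qed
  then have le: "ereal (LINT p:A|lebesgue. w t (n p) (approx_gradient n p)) + ereal K * enn2ereal (hausdorff 2 (A \<inter> approx_discontinuity_set n))
      \<le> ereal (LINT p:A|lebesgue. w t (m p) (approx_gradient m p)) + ereal K * enn2ereal (hausdorff 2 (A \<inter> approx_discontinuity_set m))"
    by (simp add: energy_on_def)
  have Wn: "set_integrable lebesgue A (\<lambda>p. w t (n p) (approx_gradient n p))"
  proof (rule set_integrable_subset)
    show "set_integrable lebesgue ?U (\<lambda>p. w t (n p) (approx_gradient n p))"
    proof (rule set_integrable_w[OF Us(1) _ _ nb])
      show "emeasure lborel ?U < \<infinity>" by (simp add: Ubox emeasure_lborel_box_eq)
      show "(\<lambda>p. indicator ?U p *\<^sub>R n p) \<in> borel_measurable lebesgue" using ni by (auto simp: set_integrable_def)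
      show "(\<lambda>p. indicator ?U p *\<^sub>R approx_gradient n p) \<in> borel_measurable lebesgue"
        using nS2 Us by (simp add: SBV2_def borel_measurable_restrict_space_iff)
      show "set_integrable lebesgue ?U (\<lambda>p. (norm (approx_gradient n p))\<^sup>2)" using nS2 by (simp add: SBV2_def)
      show "0 \<le> t" using t0 by simp
    qed
    show "A \<in> sets lebesgue" by (simp add: A_def)
  qed (rule AU)
  \<comment> \<open>Holds at each point of \<open>A\<close>, because the first two columns of the
    gradient of a slice function vanish everywhere.\<close>
  have Wn0: "0 \<le> w t (n p) (approx_gradient n p)" if "p \<in> A" for p
    using that AU by (intro w_nonneg approx_gradient_slice[OF Uo _ ni eq]) auto
  have Wv: "w t (v p) (Dv p) \<le> - (t\<^sup>2 / 2)" if p: "p \<in> box l u" for p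
    unfolding v_def Dv_def
  proof (rule w_twist_le)
    have "(p $ k - l $ k)\<^sup>2 \<le> s\<^sup>2" for k
    proof -
      have "l $ k < p $ k \<and> p $ k < u $ k" using p by (simp add: mem_box_cart)
      then show ?thesis using us[of k] by (intro power_mono) auto
    qed
    then have "(p $ 1 - l $ 1)\<^sup>2 + (p $ 2 - l $ 2)\<^sup>2 \<le> 2 * s\<^sup>2" by (metis add_mono mult_2)
    then have "t\<^sup>2 * ((p $ 1 - l $ 1)\<^sup>2 + (p $ 2 - l $ 2)\<^sup>2) \<le> t\<^sup>2 * (2 * s\<^sup>2)" by (intro mult_left_mono) auto
    also have "\<dots> = 2 / 9" using t0 by (simp add: s_def power_divide power_mult_distrib)
    finally show "t\<^sup>2 * ((p $ 1 - l $ 1)\<^sup>2 + (p $ 2 - l $ 2)\<^sup>2) \<le> 1 / 3" by simp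
  qed
  have bulk: "(LINT p:A|lebesgue. w t (m p) (approx_gradient m p))
      \<le> (LINT p:A|lebesgue. w t (n p) (approx_gradient n p)) - t\<^sup>2 / 2 * measure lebesgue (box l u)"
    by (rule energy_integral_le[OF _ cA AU Wn _ Wv]) (use Wn0 in \<open>auto simp: A_def intro!: AE_I2\<close>)
  have vol: "(s / 2)^3 \<le> measure lebesgue (box l u)"
  proof -
    have "(\<Prod>k\<in>(UNIV::3 set). s / 2) \<le> (\<Prod>k\<in>UNIV. u $ k - l $ k)"
      using s0 lu(3) by (intro prod_mono) (auto simp: less_imp_le algebra_simps)
    also have "\<dots> = measure lebesgue (cbox l u)"
    proof -
      have "cbox l u \<noteq> {}" using lu_less by (auto simp: interval_ne_empty_cart intro: less_imp_le)
      then show ?thesis by (simp add: content_cbox_cart)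
    qed
    also have "\<dots> = measure lebesgue (box l u)" by (simp add: measure_lborel_box_eq measure_lborel_cbox_eq)
    finally show ?thesis by simp
  qed
  have jump: "hausdorff 2 (A \<inter> approx_discontinuity_set m) \<le> hausdorff 2 (A \<inter> approx_discontinuity_set n) + ennreal (6 * pi * s\<^sup>2)"
  proof -
    have "hausdorff 2 (A \<inter> approx_discontinuity_set m) \<le> hausdorff 2 ((A \<inter> approx_discontinuity_set n) \<union> (cbox l u - box l u))"
      by (rule hausdorff_mono[OF discontinuity_subset[OF AU]])
    also have "\<dots> \<le> hausdorff 2 (A \<inter> approx_discontinuity_set n) + hausdorff 2 (cbox l u - box l u)" by (rule hausdorff_Un)
    also have "\<dots> \<le> hausdorff 2 (A \<inter> approx_discontinuity_set n) + ennreal (6 * pi * s\<^sup>2)"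
      by (intro add_left_mono hausdorff_frontier_box s0 us)
    finally show ?thesis .
  qed
  have fin: "hausdorff 2 (A \<inter> approx_discontinuity_set n) < \<infinity>"
  proof -
    have "hausdorff 2 (A \<inter> approx_discontinuity_set n) \<le> hausdorff 2 (?U \<inter> approx_discontinuity_set n)"
      by (rule hausdorff_mono) (use AU in auto)
    also have "\<dots> < \<infinity>" using nS2 by (simp add: SBV2_def)
    finally show ?thesis .
  qed
  have bulk': "(LINT p:A|lebesgue. w t (m p) (approx_gradient m p))
      \<le> (LINT p:A|lebesgue. w t (n p) (approx_gradient n p)) - t\<^sup>2 / 2 * (s / 2)^3"
  proof -
    have "t\<^sup>2 / 2 * (s / 2)^3 \<le> t\<^sup>2 / 2 * measure lebesgue (box l u)" using vol by (intro mult_left_mono) auto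
    then show ?thesis using bulk by linarith
  qed
  \<comment> \<open>By \<open>t * s = 1 / 3\<close>, the bulk gain
    \<open>t\<^sup>2 * s^3 / 16\<close> equals \<open>s\<^sup>2 * t / 48\<close>; comparison with
    the surface cost explains \<open>288 = 6 * 48\<close>.\<close>
  have "K * (6 * pi * s\<^sup>2) < t\<^sup>2 / 2 * (s / 2)^3"
  proof -
    have "t\<^sup>2 / 2 * (s / 2)^3 = s\<^sup>2 * (t / 48)"
      using t0 by (simp add: s_def field_simps power2_eq_square power3_eq_cube)
    moreover have "K * (6 * pi * s\<^sup>2) = s\<^sup>2 * (6 * pi * K)" by simp
    moreover have "s\<^sup>2 * (6 * pi * K) < s\<^sup>2 * (t / 48)" using tK s0 by (intro mult_strict_left_mono) auto
    ultimately show ?thesis by linarith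
  qed
  then show False
    using ennreal_energy_gap[OF le fin jump bulk' assms(4)] by simp
qed

end
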